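(* (i) There exist $(-1)$-homogeneous axisymmetric no-swirl solutions $\{(u_\nu^\pm(c),p_\nu^\pm(c))\}_{0<\nu\le1}$ of the stationary Navier-Stokes equations with viscosity $\nu$, belonging to $C^0(\mathring J_\nu\times(0,1],\,C^m(\mathbb{S}^2\setminus(B_\epsilon(S)\cup B_\epsilon(N))))$ for every integer $m\ge0$, such that for every compact subset $K\subset\mathring J_0$ and every $\epsilon>0$ there exists a constant $C$, depending only on $\epsilon,K$ and $m$, such that $$\|(u_\nu^\pm(c),p_\nu^\pm(c))-(v_c^\pm,q_c)\|_{C^m(\mathbb{S}^2\setminus(B_\epsilon(S)\cup B_\epsilon(N)))}\le C\nu,\qquad c\in K.$$ (ii) For every $0<\theta_0<\pi$ there exist $(-1)$-homogeneous axisymmetric no-swirl solutions $\{(u_\nu(c,\theta_0),p_\nu(c,\theta_0))\}_{0<\nu\le1}$ of the stationary Navier-Stokes equations with viscosity $\nu$, belonging to $C^0(\mathring J_\nu\times(0,1]\times(0,\pi),\,C^m(\mathbb{S}^2\setminus(B_\epsilon(S)\cup B_\epsilon(N))))$ for every integer $m\ge0$, such that for every compact subset $K\subset\mathring J_0$ and every $\epsilon>0$ there exists a constant $C$, depending on $\epsilon,K$ and $m$, such that for all $c\in K$ $$\|(u_\nu(c,\theta_0),p_\nu(c,\theta_0))-(v_c^+,q_c)\|_{C^m(\mathbb{S}^2\cap\{\theta_0+\epsilon<\theta<\pi-\epsilon\})}+\|(u_\nu(c,\theta_0),p_\nu(c,\theta_0))-(v_c^-,q_c)\|_{C^m(\mathbb{S}^2\cap\{\epsilon<\theta<\theta_0-\epsilon\})}\le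 C\nu.$$
   Context: The stationary Navier-Stokes equations in $\mathbb{R}^3$ with viscosity $\nu>0$ are $-\nu\Delta u+u\cdot\nabla u+\nabla p=0$, $\operatorname{div}u=0$. A solution $(u,p)$ is $(-1)$-homogeneous if $u$ is homogeneous of degree $-1$ and $p$ is homogeneous of degree $-2$. Spherical coordinates $(r,\theta,\phi)$: $r$ is the distance to the origin, $\theta$ the angle with the positive $x_3$-axis, $\phi$ the meridian angle; $u=u_r\vec e_r+u_\theta\vec e_\theta+u_\phi\vec e_\phi$. $u$ is axisymmetric if its components depend only on $r,\theta$, and no-swirl if $u_\phi=0$. $N,S$ are the north and south poles of the unit sphere $\mathbb{S}^2$, and $B_\epsilon(N)$, $B_\epsilon(S)$ are the $\epsilon$-balls around them. For $c=(c_1,c_2,c_3)\in\mathbb{R}^3$ let $P_c(x)=c_1(1-x)+c_2(1+x)+c_3(1-x^2)$. For $\nu\ge0$ let $$\bar c_3(c_1,c_2;\nu)=-\tfrac12\left(\sqrt{\nu^2+c_1}+\sqrt{\nu^2+c_2}\right)\left(\sqrt{\nu^2+c_1}+\sqrt{\nu^2+c_2}+2\nu\right),$$ $$J_\nu=\{c\in\mathbb{R}^3: c_1\ge-\nu^2,\ c_2\ge-\nu^2,\ c_3\ge\bar c_3(c_1,c_2;\nu)\},$$ and let $\mathring J_\nu$ be its interior; $J_{\nu'}\subset J_\nu$ for $0\le\nu'\le\nu$. The notation $C^0(\mathring J_\nu\times(0,1],X)$ means: continuous as a function of $(c,\nu)$ with $0<\nu\le1$ and $c\in\mathring J_\nu$,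 with values in $X$ (and similarly with the additional parameter $\theta_0\in(0,\pi)$). For $c\in\mathring J_0$ (where $P_c>0$ on $[-1,1]$) let $v_c^\pm=v^\pm_{c,r}\vec e_r+v^\pm_{c,\theta}\vec e_\theta$ with $$v^\pm_{c,\theta}=\pm\frac{\sqrt{2P_c(\cos\theta)}}{r\sin\theta},\quad v^\pm_{c,r}=\pm\frac{P_c'(\cos\theta)}{r\sqrt{2P_c(\cos\theta)}},\quad q_c=-\frac1{2r^2}\left(P_c''(\cos\theta)+\frac{2P_c(\cos\theta)}{\sin^2\theta}\right).$$
   Formalization: In (ii) v_c^+ and v_c^- are exchanged: convergence is to v_c^+ on {ε<θ<θ_0-ε} and to v_c^- on {θ_0+ε<θ<π-ε}. As printed the claim fails: with x=cosθ, any zero of r sinθ u_θ has positive x-derivative where P_c>0, so only this order can occur. *)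

theory Defs
  imports "HOL-Analysis.Analysis"
begin

section \<open>Partial derivatives and the spaces \<open>C\<^sup>m\<close>\<close>

definition pd :: "3 \<Rightarrow> (real^3 \<Rightarrow> 'b::real_normed_vector) \<Rightarrow> real^3 \<Rightarrow> 'b" where
  "pd i f x = frechet_derivative f (at x) (axis i 1)"

text \<open>\<open>C\<^sup>k\<close> on an open set.\<close>

primrec Ck_on :: "nat \<Rightarrow> (real^3 \<Rightarrow> 'b::real_normed_vector) \<Rightarrow> (real^3) set \<Rightarrow> bool" where
  "Ck_on 0 f W \<longleftrightarrow> continuous_on W f"
| "Ck_on (Suc k) f W \<longleftrightarrow> (\<forall>x\<in>W. f differentiable (at x)) \<and> (\<forall>i. Ck_on k (pd i f) W)"

definition mixed_pd :: "3 list \<Rightarrow> (real^3 \<Rightarrow> 'b::real_normed_vector) \<Rightarrow> real^3 \<Rightarrow> 'b" where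
  "mixed_pd is f = foldr pd is f"

text \<open>
  For \<open>A \<subseteq> S\<^sup>2\<close>, \<open>C\<^sup>m(A)\<close> is built from the Cartesian derivatives of the extension of a function on
  the sphere that is constant along rays. Only the values on the sphere enter, and the resulting
  norm is equivalent to the one given by covariant derivatives or by an atlas of \<open>S\<^sup>2\<close>. The norm
  takes values in \<open>[0,\<infinity>]\<close>, so an inequality \<open>sphere_norm m A f \<le> ennreal b\<close> includes finiteness,
  and the norm is 0 if \<open>A\<close> is empty.
\<close>

definition radial_ext :: "(real^3 \<Rightarrow> 'b) \<Rightarrow> real^3 \<Rightarrow> 'b" where
  "radial_ext f x = f (x /\<^sub>R norm x)"

definition sphere_norm :: "nat \<Rightarrow> (real^3) set \<Rightarrow> (real^3 \<Rightarrow> 'b::real_normed_vector) \<Rightarrow> ennreal" where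
  "sphere_norm m A f =
     (SUP is\<in>{is. length is \<le> m}. SUP x\<in>A. ennreal (norm (mixed_pd is (radial_ext f) x)))"

definition sphere_Cm :: "nat \<Rightarrow> (real^3) set \<Rightarrow> (real^3 \<Rightarrow> 'b::real_normed_vector) set" where
  "sphere_Cm m A =
     {f. (\<exists>W. open W \<and> A \<subseteq> W \<and> Ck_on m (radial_ext f) W) \<and> sphere_norm m A f < \<infinity>}"

text \<open>\<open>C\<^sup>0(D, C\<^sup>m(A))\<close>, for a family \<open>w\<close> of functions with parameter in \<open>D\<close>.\<close>

definition C0_sphere_Cm ::
  "'p::topological_space set \<Rightarrow> nat \<Rightarrow> (real^3) set \<Rightarrow> ('p \<Rightarrow> real^3 \<Rightarrow> 'b::real_normed_vector) set" where
  "C0_sphere_Cm D m A =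
     {w. (\<forall>a\<in>D. w a \<in> sphere_Cm m A) \<and>
         (\<forall>a\<in>D. ((\<lambda>b. sphere_norm m A (\<lambda>x. w b x - w a x)) \<longlongrightarrow> 0) (at a within D))}"

section \<open>Spherical coordinates\<close>

definition off_axis :: "(real^3) set" where
  "off_axis = {x. x $ 1 \<noteq> 0 \<or> x $ 2 \<noteq> 0}"

definition theta :: "real^3 \<Rightarrow> real" where
  "theta x = arccos (x $ 3 / norm x)"

definition axis_dist :: "real^3 \<Rightarrow> real" where
  "axis_dist x = sqrt ((x $ 1)\<^sup>2 + (x $ 2)\<^sup>2)"

text \<open>
  The orthonormal frame in the directions of increasing \<open>r\<close>, \<open>\<theta>\<close>, \<open>\<phi>\<close> (meaningful off the axis),
  written with \<open>sin \<theta> = axis_dist x / norm x\<close>, \<open>cos \<phi> = x $ 1 / axis_dist x\<close> and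
  \<open>sin \<phi> = x $ 2 / axis_dist x\<close>.
\<close>

definition e_r :: "real^3 \<Rightarrow> real^3" where
  "e_r x = x /\<^sub>R norm x"

definition e_theta :: "real^3 \<Rightarrow> real^3" where
  "e_theta x = vector
     [x $ 3 / norm x * (x $ 1 / axis_dist x),
      x $ 3 / norm x * (x $ 2 / axis_dist x),
      - axis_dist x / norm x]"

definition e_phi :: "real^3 \<Rightarrow> real^3" where
  "e_phi x = vector [- x $ 2 / axis_dist x, x $ 1 / axis_dist x, 0]"

definition north :: "real^3" where "north = axis 3 1"
definition south :: "real^3" where "south = - axis 3 1"

definition sphere_minus_poles :: "real \<Rightarrow> (real^3) set" where
  "sphere_minus_poles \<epsilon> = sphere 0 1 - (ball south \<epsilon> \<union> ball north \<epsilon>)"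

definition sphere_band :: "real \<Rightarrow> real \<Rightarrow> (real^3) set" where
  "sphere_band a b = {x \<in> sphere 0 1. a < theta x \<and> theta x < b}"

section \<open>Homogeneous axisymmetric no-swirl Navier-Stokes solutions\<close>

definition homogeneous_off_axis :: "int \<Rightarrow> (real^3 \<Rightarrow> 'b::real_vector) \<Rightarrow> bool" where
  "homogeneous_off_axis k f \<longleftrightarrow>
     (\<forall>x\<in>off_axis. \<forall>t>0. f (t *\<^sub>R x) = (t powi k) *\<^sub>R f x)"

definition axisymmetric :: "(real^3 \<Rightarrow> real^3) \<Rightarrow> bool" where
  "axisymmetric u \<longleftrightarrow>
     (\<exists>f g h :: real \<Rightarrow> real \<Rightarrow> real. \<forall>x\<in>off_axis.
        u x \<bullet> e_r x = f (norm x) (theta x) \<and>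
        u x \<bullet> e_theta x = g (norm x) (theta x) \<and>
        u x \<bullet> e_phi x = h (norm x) (theta x))"

definition no_swirl :: "(real^3 \<Rightarrow> real^3) \<Rightarrow> bool" where
  "no_swirl u \<longleftrightarrow> (\<forall>x\<in>off_axis. u x \<bullet> e_phi x = 0)"

definition laplacian :: "(real^3 \<Rightarrow> 'b::real_normed_vector) \<Rightarrow> real^3 \<Rightarrow> 'b" where
  "laplacian f x = (\<Sum>i\<in>UNIV. pd i (pd i f) x)"

definition advection :: "(real^3 \<Rightarrow> real^3) \<Rightarrow> real^3 \<Rightarrow> real^3" where
  "advection u x = (\<Sum>i\<in>UNIV. u x $ i *\<^sub>R pd i u x)"

definition grad :: "(real^3 \<Rightarrow> real) \<Rightarrow> real^3 \<Rightarrow> real^3" where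
  "grad p x = (\<chi> i. pd i p x)"

definition divergence :: "(real^3 \<Rightarrow> real^3) \<Rightarrow> real^3 \<Rightarrow> real" where
  "divergence u x = (\<Sum>i\<in>UNIV. pd i u x $ i)"

text \<open>
  Classical solutions on the cone over \<open>S\<^sup>2\<close> minus the poles; a singularity along the axis is
  allowed.
\<close>

definition stationary_NS :: "real \<Rightarrow> (real^3 \<Rightarrow> real^3) \<Rightarrow> (real^3 \<Rightarrow> real) \<Rightarrow> bool" where
  "stationary_NS \<nu> u p \<longleftrightarrow>
     Ck_on 2 u off_axis \<and> Ck_on 1 p off_axis \<and>
     (\<forall>x\<in>off_axis.
        - \<nu> *\<^sub>R laplacian u x + advection u x + grad p x = 0 \<and> divergence u x = 0)"

definition homogeneous_axisym_no_swirl_solution ::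
  "real \<Rightarrow> (real^3 \<Rightarrow> real^3) \<Rightarrow> (real^3 \<Rightarrow> real) \<Rightarrow> bool" where
  "homogeneous_axisym_no_swirl_solution \<nu> u p \<longleftrightarrow>
     stationary_NS \<nu> u p \<and>
     homogeneous_off_axis (- 1) u \<and> homogeneous_off_axis (- 2) p \<and>
     axisymmetric u \<and> no_swirl u"

section \<open>Parameters and the limiting Euler flows\<close>

definition P :: "real^3 \<Rightarrow> real \<Rightarrow> real" where
  "P c x = c $ 1 * (1 - x) + c $ 2 * (1 + x) + c $ 3 * (1 - x\<^sup>2)"

definition c3_bar :: "real \<Rightarrow> real \<Rightarrow> real \<Rightarrow> real" where
  "c3_bar c1 c2 \<nu> =
     - (1/2) * (sqrt (\<nu>\<^sup>2 + c1) + sqrt (\<nu>\<^sup>2 + c2)) * (sqrt (\<nu>\<^sup>2 + c1) + sqrt (\<nu>\<^sup>2 + c2) + 2 * \<nu>)"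

definition J :: "real \<Rightarrow> (real^3) set" where
  "J \<nu> = {c. c $ 1 \<ge> - \<nu>\<^sup>2 \<and> c $ 2 \<ge> - \<nu>\<^sup>2 \<and> c $ 3 \<ge> c3_bar (c $ 1) (c $ 2) \<nu>}"

text \<open>The sign \<open>s \<in> {1, -1}\<close> selects \<open>v\<^sub>c\<^sup>+\<close> or \<open>v\<^sub>c\<^sup>-\<close>.\<close>

definition euler_v :: "real \<Rightarrow> real^3 \<Rightarrow> real^3 \<Rightarrow> real^3" where
  "euler_v s c x =
     (s * (deriv (P c) (cos (theta x)) / (norm x * sqrt (2 * P c (cos (theta x)))))) *\<^sub>R e_r x +
     (s * (sqrt (2 * P c (cos (theta x))) / (norm x * sin (theta x)))) *\<^sub>R e_theta x"

definition euler_q :: "real^3 \<Rightarrow> real^3 \<Rightarrow> real" where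
  "euler_q c x =
     - (1 / (2 * (norm x)\<^sup>2)) *
       (deriv (deriv (P c)) (cos (theta x)) + 2 * P c (cos (theta x)) / (sin (theta x))\<^sup>2)"

text \<open>
  Orientation of the transition layer. With \<open>x = cos \<theta>\<close> and \<open>U(x) = r sin \<theta> u\<^sub>\<theta>\<close>, the homogeneous
  axisymmetric no-swirl solutions are given by
  \<open>\<nu>(1 - x\<^sup>2)U' + 2\<nu>xU + U\<^sup>2/2 = P\<^sub>c(x)\<close>. Where \<open>P\<^sub>c > 0\<close>, every zero of \<open>U\<close> satisfies \<open>U' > 0\<close>, so \<open>U\<close>
  changes sign at most once, from negative to positive as \<open>x\<close> increases. A layer at the latitude
  \<open>\<theta>\<^sub>0\<close> therefore joins \<open>v\<^sub>c\<^sup>+\<close> on the side \<open>\<theta> < \<theta>\<^sub>0\<close> to \<open>v\<^sub>c\<^sup>-\<close> on the side \<open>\<theta> > \<theta>\<^sub>0\<close>; the opposite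
  assignment is impossible.
\<close>

end

theory Submission
  imports Defs "HOL-Real_Asymp.Real_Asymp"
begin

text \<open>
  An axisymmetric no-swirl field of degree \<open>-1\<close> is determined by one function of \<open>t = cos \<theta>\<close>. In terms of
  \<open>b = r u\<^sub>\<theta> / sin \<theta>\<close>, incompressibility fixes the radial component, and the momentum equation follows from the
  Riccati equation \<open>\<nu> b' + b\<^sup>2 / 2 = P\<^sub>c / (1 - t\<^sup>2)\<^sup>2\<close> on \<open>(-1,1)\<close> with a suitable pressure
  (\<open>riccati_imp_solution\<close>). For \<open>\<nu> = 0\<close> its roots \<open>\<plusminus>\<beta>\<close> are the profiles of the Euler flows \<open>v\<^sub>c\<^sup>\<plusminus>\<close>
  (\<open>euler_v_eq\<close>, \<open>euler_q_eq\<close>). The theorem is thus a statement about a singularly perturbed scalar equation.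

  Existence. The substitution \<open>b = 2 \<nu> w' / w\<close> makes the equation linear, and splitting off the larger exponents at the
  two poles makes it hypergeometric. For \<open>c\<close> in the interior of \<open>J \<nu>\<close> all coefficients of the hypergeometric series are
  positive. The series regular at one pole and its mirror image are therefore positive, and they are strictly monotone in
  opposite directions. Every combination of them with nonnegative weights, not both zero, is positive as well and gives a
  solution \<open>profile\<close> on the whole interval (\<open>profile_has_derivative\<close>). The weights \<open>(1, 0)\<close> and \<open>(0, 1)\<close> give the upper and the lower family. For
  the layers the weights are chosen such that the profile vanishes at \<open>cos \<theta>\<^sub>0\<close>, or comes as close to this as the
  extremal profiles permit.

  Continuity in the parameters. The formulas are jointly continuous in parameters and \<open>t\<close>, and the Riccati equation turns
  continuity into joint continuity of all derivatives (\<open>jointly_smooth_profile\<close>).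

  Convergence. To the right of a point where it is nonnegative, a solution stays nonnegative, soon is bounded below by a
  positive constant, and is bounded above by a constant that does not depend on the solution, since otherwise it would blow
  up backwards. Hence \<open>E = b - \<beta>\<close> satisfies \<open>\<nu> E' = - A E + O(\<nu>)\<close> with \<open>A\<close> bounded below, so that the initial value is
  damped exponentially and \<open>E = O(\<nu>)\<close> at a fixed distance; the derivatives of \<open>E\<close> satisfy equations of the same form
  (\<open>deviation_estimate\<close>). The reflection \<open>t \<mapsto> - t\<close>, \<open>b \<mapsto> - b\<close> gives the convergence to \<open>-\<beta>\<close> on the left
  (\<open>left_deviation_estimate\<close>). The upper family is positive and the lower one negative on the whole interval, while a
  layer profile is positive to the right of \<open>cos \<theta>\<^sub>0\<close> and negative to the left; the constants do not depend on
  the position of the sign change.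

  Finally, \<open>sphere_norm_bound\<close> passes from derivatives in \<open>t\<close> to the norm of \<open>C\<^sup>m\<close> on the sphere: Cartesian derivatives of
  a zonal field are combinations of derivatives of its profiles, with coefficients that do not depend on the profiles.
\<close>

section \<open>Partial derivatives and smooth fields off the axis\<close>

lemma pd_eqI: "(f has_derivative f') (at x) \<Longrightarrow> pd i f x = f' (axis i 1)"
  by (simp add: pd_def frechet_derivative_at[symmetric])

text \<open>
  \<open>pd\<close> is defined through Hilbert choice on the relation \<open>has_derivative\<close>, which is local; hence it agrees for
  locally equal functions even where they are not differentiable.
\<close>

lemma pd_cong:
  assumes "open W" "x \<in> W" "\<And>y. y \<in> W \<Longrightarrow> f y = g y"
  shows "pd i f x = pd i g x"
proof -
  have "(f has_derivative f') (at x) \<longleftrightarrow> (g has_derivative f') (at x)" for f'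
    using has_derivative_transform_within_open[OF _ assms(1,2), of f f' UNIV g]
      has_derivative_transform_within_open[OF _ assms(1,2), of g f' UNIV f] assms(3) by auto
  then show ?thesis by (simp add: pd_def frechet_derivative_def)
qed

lemma Ck_on_cong:
  assumes "open W" "\<And>y. y \<in> W \<Longrightarrow> f y = g y" "Ck_on k f W"
  shows "Ck_on k g W"
  using assms(2,3)
proof (induction k arbitrary: f g)
  case 0 then show ?case by (simp cong: continuous_on_cong)
next
  case (Suc k)
  have "g differentiable (at x)" if "x \<in> W" for x
  proof -
    have "f differentiable (at x)" using Suc.prems that by simp
    then obtain f' where "(f has_derivative f') (at x)" by (auto simp: differentiable_def)
    from has_derivative_transform_within_open[OF this \<open>open W\<close> that, of g] Suc.prems(1)
    show ?thesis by (auto simp: differentiable_def)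
  qed
  moreover have "Ck_on k (pd i g) W" for i
  proof (rule Suc.IH)
    show "pd i f y = pd i g y" if "y \<in> W" for y
      by (rule pd_cong[OF \<open>open W\<close> that Suc.prems(1)])
    show "Ck_on k (pd i f) W" using Suc.prems(2) by simp
  qed
  ultimately show ?case by simp
qed

lemma Ck_on_Suc_imp: "Ck_on (Suc k) f W \<Longrightarrow> Ck_on k f W"
proof (induction k arbitrary: f)
  case 0 then show ?case
    by (auto intro!: continuous_at_imp_continuous_on differentiable_imp_continuous_within)
qed auto

lemma Ck_on_const: "Ck_on k (\<lambda>x. c) W"
proof (induction k arbitrary: c)
  case (Suc k)
  have "pd i (\<lambda>x. c) = (\<lambda>x. 0)" for i :: 3
    by (rule ext, rule pd_eqI[THEN trans]) (auto intro: derivative_eq_intros)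
  with Suc show ?case by simp
qed simp

lemma Ck_on_linear:
  assumes "bounded_linear f"
  shows "Ck_on k f W"
proof (cases k)
  case 0 then show ?thesis
    using assms by (simp add: linear_continuous_on)
next
  case (Suc j)
  have "(f has_derivative f) (at x)" for x
    using assms by (rule bounded_linear_imp_has_derivative)
  then have "pd i f = (\<lambda>x. f (axis i 1))" "f differentiable (at x)" for i x
    by (auto simp: fun_eq_iff pd_eqI differentiable_def)
  then show ?thesis using Suc by (simp add: Ck_on_const)
qed

lemma has_frechet_derivative:
  assumes "f differentiable (at x)"
  shows "(f has_derivative frechet_derivative f (at x)) (at x)"
  using assms frechet_derivative_works by blast

lemma pd_add:
  assumes "f differentiable (at x)" "g differentiable (at x)"
  shows "pd i (\<lambda>x. f x + g x) x = pd i f x + pd i g x"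
  using pd_eqI[OF has_derivative_add[OF assms[THEN has_frechet_derivative]], of i]
  by (simp add: pd_def)

lemma pd_scaleR:
  assumes "f differentiable (at x)" "g differentiable (at x)"
  shows "pd i (\<lambda>x. f x *\<^sub>R g x) x = f x *\<^sub>R pd i g x + pd i f x *\<^sub>R g x"
  using pd_eqI[OF has_derivative_scaleR[OF assms[THEN has_frechet_derivative]], of i]
  by (simp add: pd_def)

lemma Ck_on_add:
  assumes "open W"
  shows "Ck_on k f W \<Longrightarrow> Ck_on k g W \<Longrightarrow> Ck_on k (\<lambda>x. f x + g x) W"
proof (induction k arbitrary: f g)
  case 0 then show ?case by (simp add: continuous_on_add)
next
  case (Suc k)
  have "Ck_on k (pd i (\<lambda>x. f x + g x)) W" for i
    by (rule Ck_on_cong[OF \<open>open W\<close> _ Suc.IH[of "pd i f" "pd i g"]])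
       (use Suc.prems in \<open>auto simp: pd_add\<close>)
  with Suc.prems show ?case by (auto intro: differentiable_add)
qed

lemma Ck_on_scaleR:
  assumes "open W"
  shows "Ck_on k f W \<Longrightarrow> Ck_on k g W \<Longrightarrow> Ck_on k (\<lambda>x. f x *\<^sub>R g x) W"
proof (induction k arbitrary: f g)
  case 0 then show ?case by (simp add: continuous_on_scaleR)
next
  case (Suc k)
  have "Ck_on k (\<lambda>x. f x *\<^sub>R pd i g x + pd i f x *\<^sub>R g x) W" for i
    by (intro Ck_on_add[OF \<open>open W\<close>] Suc.IH) (use Suc.prems Ck_on_Suc_imp[of k f W] Ck_on_Suc_imp[of k g W] in auto)
  then have "Ck_on k (pd i (\<lambda>x. f x *\<^sub>R g x)) W" for i
    by (rule Ck_on_cong[OF \<open>open W\<close>, rotated]) (use Suc.prems in \<open>auto simp: pd_scaleR\<close>)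
  with Suc.prems show ?case by (auto intro: differentiable_scaleR)
qed

lemma Ck_on_mult:
  fixes f g :: "real^3 \<Rightarrow> real"
  shows "open W \<Longrightarrow> Ck_on k f W \<Longrightarrow> Ck_on k g W \<Longrightarrow> Ck_on k (\<lambda>x. f x * g x) W"
  using Ck_on_scaleR[of W k f g] by simp

lemma Ck_on_diff:
  assumes "open W" "Ck_on k f W" "Ck_on k g W" shows "Ck_on k (\<lambda>x. f x - g x) W"
  using Ck_on_add[OF assms(1,2) Ck_on_scaleR[OF assms(1) Ck_on_const[of k "-1"] assms(3)]] by simp

lemma Ck_on_sum:
  assumes "open W" "\<And>i. i \<in> S \<Longrightarrow> Ck_on k (f i) W"
  shows "Ck_on k (\<lambda>x. \<Sum>i\<in>S. f i x) W"
  using assms(2)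
  by (induction S rule: infinite_finite_induct) (auto intro: Ck_on_const Ck_on_add[OF assms(1)])

text \<open>
  All fields of the problem live off the axis and are \<open>C\<^sup>k\<close> there for every \<open>k\<close>. With this notion no
  loss of derivatives has to be tracked: it is closed under \<open>pd\<close>.
\<close>

definition smooth_off_axis :: "(real^3 \<Rightarrow> 'b::real_normed_vector) \<Rightarrow> bool" where
  "smooth_off_axis f \<longleftrightarrow> (\<forall>k. Ck_on k f off_axis)"

lemma open_off_axis: "open off_axis"
proof -
  have eq: "off_axis = {x. x $ 1 \<noteq> 0} \<union> {x. x $ 2 \<noteq> 0}" by (auto simp: off_axis_def)
  show ?thesis unfolding eq
    by (intro open_Un open_Collect_neq continuous_intros)
qed

lemma off_axis_nz: "x \<in> off_axis \<Longrightarrow> x \<noteq> 0"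
  by (auto simp: off_axis_def)

lemma smooth_off_axis_const: "smooth_off_axis (\<lambda>x. c)"
  by (simp add: smooth_off_axis_def Ck_on_const)

lemma smooth_off_axis_linear: "bounded_linear f \<Longrightarrow> smooth_off_axis f"
  by (simp add: smooth_off_axis_def Ck_on_linear)

lemma smooth_off_axis_add:
  "smooth_off_axis f \<Longrightarrow> smooth_off_axis g \<Longrightarrow> smooth_off_axis (\<lambda>x. f x + g x)"
  by (simp add: smooth_off_axis_def Ck_on_add[OF open_off_axis])

lemma smooth_off_axis_diff:
  "smooth_off_axis f \<Longrightarrow> smooth_off_axis g \<Longrightarrow> smooth_off_axis (\<lambda>x. f x - g x)"
  by (simp add: smooth_off_axis_def Ck_on_diff[OF open_off_axis])

lemma smooth_off_axis_scaleR:
  "smooth_off_axis f \<Longrightarrow> smooth_off_axis g \<Longrightarrow> smooth_off_axis (\<lambda>x. f x *\<^sub>R g x)"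
  by (simp add: smooth_off_axis_def Ck_on_scaleR[OF open_off_axis])

lemma smooth_off_axis_sum:
  "(\<And>i. i \<in> S \<Longrightarrow> smooth_off_axis (h i)) \<Longrightarrow> smooth_off_axis (\<lambda>x. \<Sum>i\<in>S. h i x)"
  by (simp add: smooth_off_axis_def Ck_on_sum[OF open_off_axis])

lemma smooth_off_axis_pd: "smooth_off_axis f \<Longrightarrow> smooth_off_axis (pd i f)"
  unfolding smooth_off_axis_def by (metis Ck_on.simps(2))

lemma smooth_off_axis_differentiable:
  "smooth_off_axis f \<Longrightarrow> x \<in> off_axis \<Longrightarrow> f differentiable (at x)"
  unfolding smooth_off_axis_def by (metis Ck_on.simps(2))

lemma smooth_off_axis_cong:
  "smooth_off_axis f \<Longrightarrow> (\<And>x. x \<in> off_axis \<Longrightarrow> f x = g x) \<Longrightarrow> smooth_off_axis g"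
  unfolding smooth_off_axis_def using Ck_on_cong[OF open_off_axis, of f g] by blast

lemma smooth_off_axis_mult:
  fixes f g :: "real^3 \<Rightarrow> real"
  shows "smooth_off_axis f \<Longrightarrow> smooth_off_axis g \<Longrightarrow> smooth_off_axis (\<lambda>x. f x * g x)"
  using smooth_off_axis_scaleR[of f g] by simp

abbreviation inv_norm :: "real^3 \<Rightarrow> real" where "inv_norm x \<equiv> inverse (norm x)"
definition cos_polar :: "real^3 \<Rightarrow> real" where "cos_polar x = x $ 3 * inv_norm x"

lemma inv_norm_has_derivative:
  assumes "x \<noteq> 0"
  shows "(inv_norm has_derivative (\<lambda>h. - (x \<bullet> h) * inv_norm x ^ 3)) (at x)"
proof -
  have "(norm has_derivative (\<lambda>h. h \<bullet> sgn x)) (at x)"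
    using has_derivative_norm[OF assms] by (simp add: inner_commute)
  from Deriv.has_derivative_inverse[OF _ this] assms show ?thesis
    by (auto elim!: has_derivative_eq_rhs simp: fun_eq_iff sgn_div_norm power3_eq_cube inner_commute)
qed

lemma pd_inv_norm: "x \<noteq> 0 \<Longrightarrow> pd i inv_norm x = - x $ i * inv_norm x ^ 3"
  by (simp add: pd_eqI[OF inv_norm_has_derivative] inner_axis)

text \<open>
  The derivatives of \<open>1/r\<close> are polynomials in the coordinates and \<open>1/r\<close> itself, so that the induction
  on the order closes on this one function.
\<close>

lemma smooth_inv_norm: "smooth_off_axis inv_norm"
proof -
  have "Ck_on k inv_norm off_axis" for k
  proof (induction k)
    case 0 then show ?case by (auto intro!: continuous_intros simp: off_axis_nz)
  next
    case (Suc k)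
    have "Ck_on k (\<lambda>x. (- x $ i) * (inv_norm x * (inv_norm x * inv_norm x))) off_axis" for i
      by (intro Ck_on_mult[OF open_off_axis] Suc Ck_on_linear bounded_linear_minus bounded_linear_vec_nth)
    then have "Ck_on k (pd i inv_norm) off_axis" for i
      by (rule Ck_on_cong[OF open_off_axis, rotated])
         (simp add: pd_inv_norm off_axis_nz power3_eq_cube)
    then show ?case
      using inv_norm_has_derivative off_axis_nz by (auto simp: differentiable_def)
  qed
  then show ?thesis by (simp add: smooth_off_axis_def)
qed

lemma smooth_cos_polar: "smooth_off_axis cos_polar"
  unfolding cos_polar_def[abs_def]
  by (intro smooth_off_axis_mult smooth_inv_norm smooth_off_axis_linear bounded_linear_vec_nth)

lemma pd_cos_polar:
  assumes "x \<noteq> 0"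
  shows "pd i cos_polar x = inv_norm x * (axis 3 1 $ i - cos_polar x * (inv_norm x * x $ i))"
proof -
  have "(cos_polar has_derivative (\<lambda>h. h $ 3 * inv_norm x + x $ 3 * (- (x \<bullet> h) * inv_norm x ^ 3))) (at x)"
    unfolding cos_polar_def[abs_def]
    by (rule has_derivative_eq_rhs[OF has_derivative_mult[OF
          bounded_linear_imp_has_derivative[OF bounded_linear_vec_nth] inv_norm_has_derivative[OF assms]]])
       (simp add: fun_eq_iff)
  then show ?thesis
    by (simp add: pd_eqI inner_axis cos_polar_def algebra_simps power3_eq_cube)
       (simp add: axis_def)
qed

lemma norm_sq_3: "(norm (x::real^3))\<^sup>2 = (x $ 1)\<^sup>2 + (x $ 2)\<^sup>2 + (x $ 3)\<^sup>2"
  by (simp only: power2_norm_eq_inner) (simp add: inner_vec_def sum_3 power2_eq_square)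

lemma cos_polar_in:
  assumes "x \<in> off_axis" shows "cos_polar x \<in> {-1<..<1}"
proof -
  have "(cos_polar x)\<^sup>2 < 1"
  proof -
    have "(x $ 3)\<^sup>2 < (norm x)\<^sup>2"
      using assms unfolding norm_sq_3 off_axis_def
      by (auto simp: add_pos_nonneg add_nonneg_pos)
    then show ?thesis using off_axis_nz[OF assms]
      by (simp add: cos_polar_def power_mult_distrib divide_simps)
  qed
  then show ?thesis by (simp add: power2_less_1_iff abs_less_iff)
qed

section \<open>Smooth functions on the open interval\<close>

text \<open>
  \<open>C\<^sup>\<infinity>\<close> on \<open>(-1,1)\<close>, the range of \<open>cos \<theta>\<close> off the axis. The derivatives are named by iterating \<open>deriv\<close>,
  so that later estimates can speak of \<open>(deriv ^^ n) f\<close> without choosing witnesses.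
\<close>

definition smooth :: "(real \<Rightarrow> real) \<Rightarrow> bool" where
  "smooth f \<longleftrightarrow> (\<forall>n. \<forall>x\<in>{-1<..<1}. ((deriv ^^ n) f has_real_derivative (deriv ^^ Suc n) f x) (at x))"

lemma deriv_cong_interval:
  assumes "\<And>y. y \<in> {-1<..<1::real} \<Longrightarrow> f y = g y" "x \<in> {-1<..<1}"
  shows "deriv f x = deriv g x"
  by (rule deriv_cong_ev) (use assms eventually_nhds_in_open[of "{-1<..<1::real}" x] in
      \<open>auto elim: eventually_mono\<close>)

lemma has_real_derivative_cong_interval:
  assumes "\<And>y. y \<in> {-1<..<1::real} \<Longrightarrow> f y = g y" "x \<in> {-1<..<1}"
    "(f has_real_derivative D) (at x)"
  shows "(g has_real_derivative D) (at x)"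
  by (rule DERIV_cong_ev[THEN iffD1, OF refl _ refl assms(3)])
     (use assms eventually_nhds_in_open[of "{-1<..<1::real}" x] in \<open>auto elim: eventually_mono\<close>)

text \<open>
  A tower of functions, each the derivative of its predecessor, exhibits the iterated derivatives. The
  closure properties of smooth functions, including the Leibniz rule, rest on such towers.
\<close>

lemma smooth_tower:
  assumes "\<And>x. x \<in> {-1<..<1} \<Longrightarrow> G 0 x = f x"
    and "\<And>n x. x \<in> {-1<..<1} \<Longrightarrow> (G n has_real_derivative G (Suc n) x) (at x)"
  shows smooth_towerI: "smooth f"
    and higher_deriv_tower: "x \<in> {-1<..<1} \<Longrightarrow> (deriv ^^ n) f x = G n x"
proof -
  have eq: "(deriv ^^ n) f x = G n x" if "x \<in> {-1<..<1}" for n x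
    using that
  proof (induction n arbitrary: x)
    case 0 then show ?case by (simp add: assms(1))
  next
    case (Suc n)
    have "(deriv ^^ Suc n) f x = deriv (G n) x"
      using deriv_cong_interval[of "(deriv ^^ n) f" "G n" x] Suc by simp
    then show ?case using DERIV_imp_deriv[OF assms(2)] Suc.prems by simp
  qed
  then show "x \<in> {-1<..<1} \<Longrightarrow> (deriv ^^ n) f x = G n x" by blast
  have "((deriv ^^ n) f has_real_derivative (deriv ^^ Suc n) f x) (at x)"
    if x: "x \<in> {-1<..<1}" for n x
  proof (rule has_real_derivative_cong_interval[OF _ x])
    show "(G n has_real_derivative (deriv ^^ Suc n) f x) (at x)"
      using assms(2)[OF x] eq[OF x, of "Suc n"] by metis
  qed (simp add: eq)
  then show "smooth f" by (simp add: smooth_def)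
qed

lemma smooth_cong:
  assumes "smooth f" "\<And>x. x \<in> {-1<..<1} \<Longrightarrow> f x = g x" shows "smooth g"
  by (rule smooth_towerI[of "\<lambda>n. (deriv ^^ n) f"]) (use assms in \<open>auto simp: smooth_def\<close>)

lemma higher_deriv_cong:
  assumes "smooth f" "\<And>x. x \<in> {-1<..<1} \<Longrightarrow> f x = g x" "x \<in> {-1<..<1}"
  shows "(deriv ^^ n) g x = (deriv ^^ n) f x"
  by (rule higher_deriv_tower[of "\<lambda>n. (deriv ^^ n) f"]) (use assms in \<open>auto simp: smooth_def\<close>)

lemma smooth_has_derivative:
  "smooth f \<Longrightarrow> x \<in> {-1<..<1} \<Longrightarrow> ((deriv ^^ n) f has_real_derivative (deriv ^^ Suc n) f x) (at x)"
  by (simp add: smooth_def)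

lemma smooth_DERIV: "smooth f \<Longrightarrow> x \<in> {-1<..<1} \<Longrightarrow> (f has_real_derivative deriv f x) (at x)"
  using smooth_has_derivative[of f x 0] by simp

lemma smooth_deriv: "smooth f \<Longrightarrow> smooth (deriv f)"
  unfolding smooth_def by (metis funpow_Suc_right o_apply)

lemma higher_deriv_deriv: "(deriv ^^ n) (deriv f) = (deriv ^^ Suc n) f"
  by (simp only: funpow_Suc_right o_apply)

lemma smooth_continuous_on:
  "smooth f \<Longrightarrow> S \<subseteq> {-1<..<1} \<Longrightarrow> continuous_on S ((deriv ^^ n) f)"
  by (meson DERIV_isCont continuous_at_imp_continuous_on smooth_has_derivative subsetD)

lemma
  assumes f: "smooth f" and g: "smooth g"
  shows smooth_add: "smooth (\<lambda>x. f x + g x)"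
    and higher_deriv_add: "x \<in> {-1<..<1} \<Longrightarrow>
      (deriv ^^ n) (\<lambda>x. f x + g x) x = (deriv ^^ n) f x + (deriv ^^ n) g x"
  by (rule smooth_tower[of "\<lambda>n x. (deriv ^^ n) f x + (deriv ^^ n) g x"];
      use f g in \<open>auto simp del: funpow.simps intro!: DERIV_add smooth_has_derivative, simp?\<close>)+

lemma
  shows smooth_const: "smooth (\<lambda>x. c)"
    and higher_deriv_const: "x \<in> {-1<..<1} \<Longrightarrow>
      (deriv ^^ n) (\<lambda>x. c) x = (if n = 0 then c else 0)"
  by (rule smooth_tower[of "\<lambda>n x. if n = 0 then c else 0"]; auto)+

lemma smooth_ident: "smooth (\<lambda>x. x)"
  by (rule smooth_towerI[of "\<lambda>n x. if n = 0 then x else if n = 1 then 1 else 0"])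
     (auto intro!: derivative_eq_intros)

lemma
  assumes f: "smooth f" and g: "smooth g"
  shows smooth_mult: "smooth (\<lambda>x. f x * g x)"
    and higher_deriv_mult: "x \<in> {-1<..<1} \<Longrightarrow>
      (deriv ^^ n) (\<lambda>x. f x * g x) x = (\<Sum>k\<le>n. (n choose k) * (deriv ^^ k) f x * (deriv ^^ (n - k)) g x)"
proof -
  define G where "G n x = (\<Sum>k\<le>n. real (n choose k) * (deriv ^^ k) f x * (deriv ^^ (n - k)) g x)" for n x
  have *: "(G n has_real_derivative G (Suc n) x) (at x)" if x: "x \<in> {-1<..<1}" for n x
  proof -
    have "(G n has_real_derivative (\<Sum>k\<le>n. real (n choose k) *
        ((deriv ^^ Suc k) f x * (deriv ^^ (n - k)) g x + (deriv ^^ Suc (n - k)) g x * (deriv ^^ k) f x))) (at x)"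
      unfolding G_def
      unfolding mult.assoc
      by (intro DERIV_sum DERIV_cmult DERIV_mult smooth_has_derivative f g x)
    also have "(\<Sum>k\<le>n. real (n choose k) *
        ((deriv ^^ Suc k) f x * (deriv ^^ (n - k)) g x + (deriv ^^ Suc (n - k)) g x * (deriv ^^ k) f x))
      = (\<Sum>k\<le>n. real (n choose k) * ((deriv ^^ Suc k) f x * (deriv ^^ (n - k)) g x)) +
        (\<Sum>k\<le>n. real (n choose k) * ((deriv ^^ k) f x * (deriv ^^ (Suc n - k)) g x))"
      unfolding sum.distrib[symmetric]
      by (rule sum.cong) (auto simp: algebra_simps Suc_diff_le simp del: funpow.simps)
    also have "(\<Sum>k\<le>n. real (n choose k) * ((deriv ^^ k) f x * (deriv ^^ (Suc n - k)) g x)) =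
       (deriv ^^ Suc n) g x * f x +
       (\<Sum>k\<le>n. real (n choose Suc k) * ((deriv ^^ Suc k) f x * (deriv ^^ (n - k)) g x))"
    proof -
      have "(\<Sum>k\<le>n. real (n choose k) * ((deriv ^^ k) f x * (deriv ^^ (Suc n - k)) g x)) =
        (\<Sum>k\<le>Suc n. real (n choose k) * ((deriv ^^ k) f x * (deriv ^^ (Suc n - k)) g x))"
        by (simp add: binomial_eq_0)
      then show ?thesis
        by (subst (asm) sum.atMost_Suc_shift) (simp del: funpow.simps add: funpow_0 mult.commute)
    qed
    also have "(\<Sum>k\<le>n. real (n choose k) * ((deriv ^^ Suc k) f x * (deriv ^^ (n - k)) g x)) +
       ((deriv ^^ Suc n) g x * f x +
       (\<Sum>k\<le>n. real (n choose Suc k) * ((deriv ^^ Suc k) f x * (deriv ^^ (n - k)) g x))) = G (Suc n) x"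
      unfolding G_def
      by (subst sum.atMost_Suc_shift)
         (simp del: funpow.simps add: funpow_0 sum.distrib[symmetric] algebra_simps)
    finally show ?thesis .
  qed
  show "smooth (\<lambda>x. f x * g x)"
    by (rule smooth_towerI[of G, OF _ *]) (simp add: G_def)
  show "x \<in> {-1<..<1} \<Longrightarrow>
      (deriv ^^ n) (\<lambda>x. f x * g x) x = (\<Sum>k\<le>n. (n choose k) * (deriv ^^ k) f x * (deriv ^^ (n - k)) g x)"
    using higher_deriv_tower[of G, OF _ *, of "\<lambda>x. f x * g x"] by (simp add: G_def)
qed

lemma
  assumes f: "smooth f"
  shows smooth_cmult: "smooth (\<lambda>x. c * f x)"
    and higher_deriv_cmult: "x \<in> {-1<..<1} \<Longrightarrow> (deriv ^^ n) (\<lambda>x. c * f x) x = c * (deriv ^^ n) f x"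
  by (rule smooth_tower[of "\<lambda>n x. c * (deriv ^^ n) f x"];
      use f in \<open>auto simp del: funpow.simps intro!: DERIV_cmult smooth_has_derivative, simp?\<close>)+

lemma smooth_diff: "smooth f \<Longrightarrow> smooth g \<Longrightarrow> smooth (\<lambda>x. f x - g x)"
  using smooth_add[OF _ smooth_cmult[of g "-1"], of f] by simp

lemma higher_deriv_diff:
  "smooth f \<Longrightarrow> smooth g \<Longrightarrow> x \<in> {-1<..<1} \<Longrightarrow>
      (deriv ^^ n) (\<lambda>x. f x - g x) x = (deriv ^^ n) f x - (deriv ^^ n) g x"
  using higher_deriv_add[OF _ smooth_cmult[of g "-1"], of f x n] higher_deriv_cmult[of g x n "-1"] by simp

lemma
  assumes f: "smooth f"
  shows smooth_reflect: "smooth (\<lambda>x. f (- x))"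
    and higher_deriv_reflect: "x \<in> {-1<..<1} \<Longrightarrow> (deriv ^^ n) (\<lambda>x. f (- x)) x = (-1) ^ n * (deriv ^^ n) f (- x)"
proof -
  have *: "((\<lambda>x. (-1) ^ n * (deriv ^^ n) f (- x)) has_real_derivative (-1) ^ Suc n * (deriv ^^ Suc n) f (- x)) (at x)"
    if "x \<in> {-1<..<1}" for n x
    by (rule DERIV_cong[OF DERIV_cmult[OF DERIV_chain2[OF smooth_has_derivative[OF f]]]])
       (use that in \<open>auto intro!: derivative_eq_intros simp del: funpow.simps\<close>)
  show "smooth (\<lambda>x. f (- x))" by (rule smooth_towerI[of "\<lambda>n x. (-1) ^ n * (deriv ^^ n) f (- x)", OF _ *]) auto
  show "x \<in> {-1<..<1} \<Longrightarrow> (deriv ^^ n) (\<lambda>x. f (- x)) x = (-1) ^ n * (deriv ^^ n) f (- x)"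
    by (rule higher_deriv_tower[of "\<lambda>n x. (-1) ^ n * (deriv ^^ n) f (- x)", OF _ *]) auto
qed

section \<open>Families that depend continuously on a parameter\<close>

text \<open>
  Families of functions on \<open>(-1,1)\<close> whose first \<open>k\<close> derivatives in the variable exist and are jointly
  continuous in parameter and variable. The recursion hides the
  derivative behind an existential quantifier, so that for products, inverses and roots it may be any
  expression that suits. A differential equation \<open>f' = F(f)\<close> lifts the class from \<open>k\<close> to \<open>k + 1\<close>.
\<close>

primrec jointly_Ck :: "nat \<Rightarrow> 'p::topological_space set \<Rightarrow> ('p \<Rightarrow> real \<Rightarrow> real) \<Rightarrow> bool" where
  "jointly_Ck 0 D f \<longleftrightarrow> continuous_on (D \<times> {-1<..<1}) (\<lambda>(p, x). f p x)"
| "jointly_Ck (Suc k) D f \<longleftrightarrow> continuous_on (D \<times> {-1<..<1}) (\<lambda>(p, x). f p x) \<and>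
     (\<exists>f'. (\<forall>p\<in>D. \<forall>x\<in>{-1<..<1}. (f p has_real_derivative f' p x) (at x)) \<and> jointly_Ck k D f')"

definition jointly_smooth :: "'p::topological_space set \<Rightarrow> ('p \<Rightarrow> real \<Rightarrow> real) \<Rightarrow> bool" where
  "jointly_smooth D f \<longleftrightarrow> (\<forall>k. jointly_Ck k D f)"

lemma jointly_Ck_continuous: "jointly_Ck k D f \<Longrightarrow> continuous_on (D \<times> {-1<..<1}) (\<lambda>(p, x). f p x)"
  by (cases k) auto

lemma jointly_Ck_Suc_imp: "jointly_Ck (Suc k) D f \<Longrightarrow> jointly_Ck k D f"
  by (induction k arbitrary: f) auto

lemma jointly_Ck_SucI:
  assumes "continuous_on (D \<times> {-1<..<1}) (\<lambda>(p, x). f p x)"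
    "\<And>p x. p \<in> D \<Longrightarrow> x \<in> {-1<..<1} \<Longrightarrow> (f p has_real_derivative f' p x) (at x)"
    "jointly_Ck k D f'"
  shows "jointly_Ck (Suc k) D f"
  using assms unfolding jointly_Ck.simps by blast

lemma jointly_Ck_SucE:
  assumes "jointly_Ck (Suc k) D f"
  obtains f' where "\<forall>p\<in>D. \<forall>x\<in>{-1<..<1}. (f p has_real_derivative f' p x) (at x)"
    "jointly_Ck k D f'" "jointly_Ck k D f"
  using assms jointly_Ck_Suc_imp[OF assms] unfolding jointly_Ck.simps by blast

lemma jointly_Ck_cong:
  assumes "jointly_Ck k D f" "\<And>p x. p \<in> D \<Longrightarrow> x \<in> {-1<..<1} \<Longrightarrow> f p x = g p x"
  shows "jointly_Ck k D g"
proof -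
  have c: "continuous_on (D \<times> {-1<..<1}) (\<lambda>(p, x). g p x)"
    using jointly_Ck_continuous[OF assms(1)]
    by (rule continuous_on_eq) (use assms(2) in auto)
  show ?thesis
  proof (cases k)
    case 0 with c show ?thesis by simp
  next
    case (Suc j)
    from assms(1)[unfolded Suc] obtain f' where f': "\<forall>p\<in>D. \<forall>x\<in>{-1<..<1}. (f p has_real_derivative f' p x) (at x)"
      "jointly_Ck j D f'" "jointly_Ck j D f" by (rule jointly_Ck_SucE)
    show ?thesis unfolding Suc
      by (rule jointly_Ck_SucI[OF c _ f'(2)])
         (rule has_real_derivative_cong_interval[OF assms(2) _ f'(1)[rule_format]])
  qed
qed

lemma jointly_Ck_add:
  "jointly_Ck k D f \<Longrightarrow> jointly_Ck k D g \<Longrightarrow> jointly_Ck k D (\<lambda>p x. f p x + g p x)"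
proof (induction k arbitrary: f g)
  case 0 then show ?case by (simp add: case_prod_beta continuous_on_add)
next
  case (Suc k)
  from Suc.prems(1) obtain f' where f': "\<forall>p\<in>D. \<forall>x\<in>{-1<..<1}. (f p has_real_derivative f' p x) (at x)"
    "jointly_Ck k D f'" "jointly_Ck k D f" by (rule jointly_Ck_SucE)
  from Suc.prems(2) obtain g' where g': "\<forall>p\<in>D. \<forall>x\<in>{-1<..<1}. (g p has_real_derivative g' p x) (at x)"
    "jointly_Ck k D g'" "jointly_Ck k D g" by (rule jointly_Ck_SucE)
  show ?case
    by (rule jointly_Ck_SucI[OF _ DERIV_add[OF f'(1)[rule_format] g'(1)[rule_format]] Suc.IH[OF f'(2) g'(2)]])
       (use Suc.prems in \<open>auto simp: case_prod_beta intro: continuous_on_add\<close>)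
qed

lemma jointly_Ck_mult:
  "jointly_Ck k D f \<Longrightarrow> jointly_Ck k D g \<Longrightarrow> jointly_Ck k D (\<lambda>p x. f p x * g p x)"
proof (induction k arbitrary: f g)
  case 0 then show ?case by (simp add: case_prod_beta continuous_on_mult)
next
  case (Suc k)
  from Suc.prems(1) obtain f' where f': "\<forall>p\<in>D. \<forall>x\<in>{-1<..<1}. (f p has_real_derivative f' p x) (at x)"
    "jointly_Ck k D f'" "jointly_Ck k D f" by (rule jointly_Ck_SucE)
  from Suc.prems(2) obtain g' where g': "\<forall>p\<in>D. \<forall>x\<in>{-1<..<1}. (g p has_real_derivative g' p x) (at x)"
    "jointly_Ck k D g'" "jointly_Ck k D g" by (rule jointly_Ck_SucE)
  show ?case
    by (rule jointly_Ck_SucI[OF _ DERIV_mult[OF f'(1)[rule_format] g'(1)[rule_format]]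
            jointly_Ck_add[OF Suc.IH[OF f'(2) g'(3)] Suc.IH[OF g'(2) f'(3)]]])
       (use Suc.prems in \<open>auto simp: case_prod_beta intro: continuous_on_mult\<close>)
qed

lemma jointly_Ck_param: "continuous_on D h \<Longrightarrow> jointly_Ck k D (\<lambda>p x. h p)"
proof (induction k arbitrary: h)
  case 0 then show ?case
    by (auto simp: case_prod_beta intro: continuous_on_compose2[OF _ continuous_on_fst[OF continuous_on_id]])
next
  case (Suc k)
  show ?case
    by (rule jointly_Ck_SucI[of _ _ "\<lambda>p x. 0"])
       (use Suc in \<open>auto simp: case_prod_beta intro: continuous_on_compose2[OF _ continuous_on_fst[OF continuous_on_id]]\<close>)
qed

lemma jointly_Ck_ident: "jointly_Ck k D (\<lambda>p x. x)"
proof (cases k)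
  case 0 then show ?thesis by (auto simp: case_prod_beta intro!: continuous_intros)
next
  case (Suc j)
  show ?thesis unfolding Suc
    by (rule jointly_Ck_SucI[of _ _ "\<lambda>p x. 1"])
       (auto simp: case_prod_beta intro!: continuous_intros jointly_Ck_param[of _ "\<lambda>p. 1"])
qed

lemma jointly_Ck_inverse:
  assumes "jointly_Ck k D f" "\<And>p x. p \<in> D \<Longrightarrow> x \<in> {-1<..<1} \<Longrightarrow> f p x \<noteq> 0"
  shows "jointly_Ck k D (\<lambda>p x. inverse (f p x))"
  using assms
proof (induction k)
  case 0 then show ?case by (auto simp: case_prod_beta intro!: continuous_on_inverse)
next
  case (Suc k)
  from Suc.prems(1) obtain f' where f': "\<forall>p\<in>D. \<forall>x\<in>{-1<..<1}. (f p has_real_derivative f' p x) (at x)"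
    "jointly_Ck k D f'" "jointly_Ck k D f" by (rule jointly_Ck_SucE)
  have i: "jointly_Ck k D (\<lambda>p x. inverse (f p x))" using Suc f'(3) by blast
  show ?case
  proof (rule jointly_Ck_SucI)
    show "continuous_on (D \<times> {-1<..<1}) (\<lambda>(p, x). inverse (f p x))"
      using Suc.prems by (auto simp: case_prod_beta intro!: continuous_on_inverse)
    show "((\<lambda>x. inverse (f p x)) has_real_derivative
        (-1) * (f' p x * (inverse (f p x) * inverse (f p x)))) (at x)"
      if "p \<in> D" "x \<in> {-1<..<1}" for p x
      by (rule DERIV_cong[OF DERIV_inverse'[OF f'(1)[rule_format, OF that] Suc.prems(2)[OF that]]]) simp
    show "jointly_Ck k D (\<lambda>p x. (-1) * (f' p x * (inverse (f p x) * inverse (f p x))))"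
      by (intro jointly_Ck_mult i f' jointly_Ck_param continuous_intros)
  qed
qed

lemma jointly_Ck_sqrt:
  assumes "jointly_Ck k D f" "\<And>p x. p \<in> D \<Longrightarrow> x \<in> {-1<..<1} \<Longrightarrow> f p x > 0"
  shows "jointly_Ck k D (\<lambda>p x. sqrt (f p x))"
  using assms
proof (induction k)
  case 0 then show ?case by (auto simp: case_prod_beta intro!: continuous_on_real_sqrt)
next
  case (Suc k)
  from Suc.prems(1) obtain f' where f': "\<forall>p\<in>D. \<forall>x\<in>{-1<..<1}. (f p has_real_derivative f' p x) (at x)"
    "jointly_Ck k D f'" "jointly_Ck k D f" by (rule jointly_Ck_SucE)
  have i: "jointly_Ck k D (\<lambda>p x. sqrt (f p x))" using Suc f'(3) by blast
  show ?case
  proof (rule jointly_Ck_SucI)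
    show "continuous_on (D \<times> {-1<..<1}) (\<lambda>(p, x). sqrt (f p x))"
      using Suc.prems by (auto simp: case_prod_beta intro!: continuous_on_real_sqrt)
    show "((\<lambda>x. sqrt (f p x)) has_real_derivative (1/2) * (f' p x * inverse (sqrt (f p x)))) (at x)"
      if "p \<in> D" "x \<in> {-1<..<1}" for p x
      using DERIV_chain2[OF DERIV_real_sqrt f'(1)[rule_format, OF that]] Suc.prems(2)[OF that]
      by (simp add: field_simps)
    show "jointly_Ck k D (\<lambda>p x. (1/2) * (f' p x * inverse (sqrt (f p x))))"
      by (intro jointly_Ck_mult i f' jointly_Ck_param continuous_intros jointly_Ck_inverse)
         (use Suc.prems(2) in \<open>auto simp: less_imp_neq[symmetric]\<close>)
  qed
qed

lemma jointly_Ck_reparam: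
  assumes "jointly_Ck k D f" "continuous_on E h" "h ` E \<subseteq> D"
  shows "jointly_Ck k E (\<lambda>q x. f (h q) x)"
  using assms(1)
proof (induction k arbitrary: f)
  case 0
  have h: "continuous_on (E \<times> {-1<..<1::real}) (\<lambda>z. (h (fst z), snd z))"
    by (intro continuous_intros continuous_on_compose2[OF assms(2)]) auto
  have sub: "(\<lambda>z. (h (fst z), snd z)) ` (E \<times> {-1<..<1::real}) \<subseteq> D \<times> {-1<..<1}"
    using assms(3) by auto
  from 0 have "continuous_on (D \<times> {-1<..<1}) (\<lambda>(p, x). f p x)" by simp
  from continuous_on_compose2[OF this h sub] show ?case
    by (simp add: case_prod_beta)
next
  case (Suc k)
  from Suc.prems obtain f' where f': "\<forall>p\<in>D. \<forall>x\<in>{-1<..<1}. (f p has_real_derivative f' p x) (at x)"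
    "jointly_Ck k D f'" "jointly_Ck k D f" by (rule jointly_Ck_SucE)
  show ?case
    by (rule jointly_Ck_SucI[OF jointly_Ck_continuous[OF Suc.IH[OF f'(3)]] _ Suc.IH[OF f'(2)]])
       (use f'(1)[rule_format] assms(3) in auto)
qed

text \<open>
  Uniqueness of derivatives identifies the existentially quantified tower with the iterates of \<open>deriv\<close>.
\<close>

lemma jointly_Ck_higher_deriv:
  assumes "jointly_Ck k D f"
  shows "j \<le> k \<Longrightarrow> continuous_on (D \<times> {-1<..<1}) (\<lambda>(p, x). (deriv ^^ j) (f p) x)"
    and "j < k \<Longrightarrow> p \<in> D \<Longrightarrow> x \<in> {-1<..<1} \<Longrightarrow>
      ((deriv ^^ j) (f p) has_real_derivative (deriv ^^ Suc j) (f p) x) (at x)"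
proof -
  have "\<exists>g. g 0 = f \<and> (\<forall>i\<le>k. continuous_on (D \<times> {-1<..<1}) (\<lambda>(p, x). g i p x)) \<and>
     (\<forall>i<k. \<forall>p\<in>D. \<forall>x\<in>{-1<..<1}. (g i p has_real_derivative g (Suc i) p x) (at x))"
    using assms
  proof (induction k arbitrary: f)
    case 0 then show ?case by (intro exI[of _ "\<lambda>i. f"]) auto
  next
    case (Suc k)
    from Suc.prems obtain f' where f': "\<forall>p\<in>D. \<forall>x\<in>{-1<..<1}. (f p has_real_derivative f' p x) (at x)"
      "jointly_Ck k D f'" "jointly_Ck k D f" by (rule jointly_Ck_SucE)
    from Suc.IH[OF f'(2)] obtain g where g: "g 0 = f'"
      "\<forall>i\<le>k. continuous_on (D \<times> {-1<..<1}) (\<lambda>(p, x). g i p x)"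
      "\<forall>i<k. \<forall>p\<in>D. \<forall>x\<in>{-1<..<1}. (g i p has_real_derivative g (Suc i) p x) (at x)"
      by (elim exE conjE) (rule that)
    define h where "h = case_nat f g"
    have h: "h 0 = f" "h (Suc i) = g i" for i by (simp_all add: h_def)
    show ?case
    proof (intro exI[of _ h] conjI allI impI)
      show "continuous_on (D \<times> {-1<..<1}) (\<lambda>(p, x). h i p x)" if "i \<le> Suc k" for i
        using that g(2) jointly_Ck_continuous[OF f'(3)] by (cases i) (simp_all add: h)
      show "\<forall>p\<in>D. \<forall>x\<in>{-1<..<1}. (h i p has_real_derivative h (Suc i) p x) (at x)" if "i < Suc k" for i
        using that g(1,3) f'(1) by (cases i) (simp_all add: h)
    qed (simp add: h)
  qed
  then obtain g where g: "g 0 = f"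
    "\<forall>i\<le>k. continuous_on (D \<times> {-1<..<1}) (\<lambda>(p, x). g i p x)"
    and g3: "\<forall>i<k. \<forall>p\<in>D. \<forall>x\<in>{-1<..<1}. (g i p has_real_derivative g (Suc i) p x) (at x)"
    by (elim exE conjE) (rule that)
  have eq: "i \<le> k \<Longrightarrow> (deriv ^^ i) (f p) x = g i p x" if "p \<in> D" "x \<in> {-1<..<1}" for i p x
    using that
  proof (induction i arbitrary: x)
    case 0 then show ?case by (simp add: g)
  next
    case (Suc i)
    have "(deriv ^^ Suc i) (f p) x = deriv (g i p) x"
      using deriv_cong_interval[of "(deriv ^^ i) (f p)" "g i p" x] Suc by simp
    then show ?case using DERIV_imp_deriv[OF g3[rule_format]] Suc.prems by simp
  qed
  show "j \<le> k \<Longrightarrow> continuous_on (D \<times> {-1<..<1}) (\<lambda>(p, x). (deriv ^^ j) (f p) x)"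
    by (rule continuous_on_eq[OF g(2)[rule_format]]) (auto simp: eq)
  assume j: "j < k" "p \<in> D" "x \<in> {-1<..<1}"
  show "((deriv ^^ j) (f p) has_real_derivative (deriv ^^ Suc j) (f p) x) (at x)"
  proof (rule has_real_derivative_cong_interval[OF _ j(3)])
    show "(g j p has_real_derivative (deriv ^^ Suc j) (f p) x) (at x)"
      using g3[rule_format, OF j] eq[OF j(2,3), of "Suc j"] j(1) by simp
    show "g j p y = (deriv ^^ j) (f p) y" if "y \<in> {-1<..<1}" for y
      using eq[OF j(2) that, of j] j(1) by simp
  qed
qed

lemma jointly_smooth_imp_smooth: "jointly_smooth D f \<Longrightarrow> p \<in> D \<Longrightarrow> smooth (f p)"
  unfolding jointly_smooth_def smooth_def using jointly_Ck_higher_deriv(2) by blast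

lemma jointly_smooth_continuous:
  "jointly_smooth D f \<Longrightarrow> continuous_on (D \<times> {-1<..<1}) (\<lambda>(p, x). (deriv ^^ j) (f p) x)"
  unfolding jointly_smooth_def using jointly_Ck_higher_deriv(1) by blast

lemma jointly_smooth_deriv:
  assumes "jointly_smooth D f" shows "jointly_smooth D (\<lambda>p. deriv (f p))"
  unfolding jointly_smooth_def
proof
  fix k
  have "jointly_Ck (Suc k) D f" using assms by (simp add: jointly_smooth_def del: jointly_Ck.simps)
  then obtain f' where f': "\<forall>p\<in>D. \<forall>x\<in>{-1<..<1}. (f p has_real_derivative f' p x) (at x)"
    "jointly_Ck k D f'" "jointly_Ck k D f" by (rule jointly_Ck_SucE)
  show "jointly_Ck k D (\<lambda>p. deriv (f p))"
    by (rule jointly_Ck_cong[OF f'(2)], rule DERIV_imp_deriv[symmetric], rule f'(1)[rule_format])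
qed

lemma jointly_smooth_add: "jointly_smooth D f \<Longrightarrow> jointly_smooth D g \<Longrightarrow> jointly_smooth D (\<lambda>p x. f p x + g p x)"
  and jointly_smooth_mult: "jointly_smooth D f \<Longrightarrow> jointly_smooth D g \<Longrightarrow> jointly_smooth D (\<lambda>p x. f p x * g p x)"
  and jointly_smooth_param: "continuous_on D h \<Longrightarrow> jointly_smooth D (\<lambda>p x. h p)"
  and jointly_smooth_ident: "jointly_smooth D (\<lambda>p x. x)"
  by (simp_all add: jointly_smooth_def jointly_Ck_add jointly_Ck_mult jointly_Ck_param jointly_Ck_ident)

lemma jointly_smooth_reparam:
  assumes "jointly_smooth D f" "continuous_on E q" "q ` E \<subseteq> D"
  shows "jointly_smooth E (\<lambda>p x. f (q p) x)"
  unfolding jointly_smooth_def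
  using jointly_Ck_reparam[OF _ assms(2,3)] assms(1) by (simp add: jointly_smooth_def)

lemma jointly_smooth_diff:
  assumes "jointly_smooth D f" "jointly_smooth D g" shows "jointly_smooth D (\<lambda>p x. f p x - g p x)"
  using jointly_smooth_add[OF assms(1) jointly_smooth_mult[OF jointly_smooth_param[of D "\<lambda>p. -1"] assms(2)]]
  by (simp add: continuous_on_const)

section \<open>Sphere norms of zonal fields\<close>

lemma comp_cos_polar_has_derivative:
  assumes "smooth \<phi>" "x \<in> off_axis"
  shows "((\<lambda>x. \<phi> (cos_polar x)) has_derivative (\<lambda>h. deriv \<phi> (cos_polar x) * frechet_derivative cos_polar (at x) h)) (at x)"
proof -
  have c: "(cos_polar has_derivative frechet_derivative cos_polar (at x)) (at x)"
    by (rule has_frechet_derivative smooth_off_axis_differentiable smooth_cos_polar assms)+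
  have "(\<phi> has_derivative (*) (deriv \<phi> (cos_polar x))) (at (cos_polar x))"
    using smooth_DERIV[OF assms(1) cos_polar_in[OF assms(2)]] by (simp add: has_field_derivative_def)
  from has_derivative_compose[OF c this] show ?thesis by simp
qed

lemma pd_comp_cos_polar:
  "smooth \<phi> \<Longrightarrow> x \<in> off_axis \<Longrightarrow> pd i (\<lambda>x. \<phi> (cos_polar x)) x = deriv \<phi> (cos_polar x) * pd i cos_polar x"
  using pd_eqI[OF comp_cos_polar_has_derivative] by (simp add: pd_def)

lemma smooth_off_axis_comp_cos_polar:
  assumes "smooth \<phi>"
  shows "smooth_off_axis (\<lambda>x. \<phi> (cos_polar x))"
proof -
  have "Ck_on k (\<lambda>x. \<phi> (cos_polar x)) off_axis" for k
    using assms
  proof (induction k arbitrary: \<phi>)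
    case 0
    have "\<forall>x\<in>off_axis. isCont (\<lambda>x. \<phi> (cos_polar x)) x"
      using comp_cos_polar_has_derivative[OF 0] has_derivative_continuous by blast
    then show ?case by (simp add: continuous_at_imp_continuous_on)
  next
    case (Suc k)
    have "Ck_on k (\<lambda>x. deriv \<phi> (cos_polar x) * pd i cos_polar x) off_axis" for i
      by (intro Ck_on_mult[OF open_off_axis] Suc.IH smooth_deriv Suc.prems)
         (use smooth_off_axis_pd[OF smooth_cos_polar] in \<open>simp add: smooth_off_axis_def\<close>)
    then have "Ck_on k (pd i (\<lambda>x. \<phi> (cos_polar x))) off_axis" for i
      using Ck_on_cong[OF open_off_axis, of "\<lambda>x. deriv \<phi> (cos_polar x) * pd i cos_polar x" "pd i (\<lambda>x. \<phi> (cos_polar x))"]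
      by (simp add: pd_comp_cos_polar Suc.prems)
    then show ?case
      using comp_cos_polar_has_derivative[OF Suc.prems] by (auto simp: differentiable_def)
  qed
  then show ?thesis by (simp add: smooth_off_axis_def)
qed

lemma pd_sum:
  assumes "finite S" "\<And>j. j \<in> S \<Longrightarrow> f j differentiable (at x)"
  shows "pd i (\<lambda>x. \<Sum>j\<in>S. f j x) x = (\<Sum>j\<in>S. pd i (f j) x)"
  using pd_eqI[OF has_derivative_sum[of S f, OF has_frechet_derivative[OF assms(2)]], of i]
  by (simp add: pd_def)

lemma mixed_pd_Nil: "mixed_pd [] f = f" and mixed_pd_Cons: "mixed_pd (i # is) f = pd i (mixed_pd is f)"
  by (simp_all add: mixed_pd_def)

lemma mixed_pd_cong:
  assumes "\<And>x. x \<in> off_axis \<Longrightarrow> f x = g x" "x \<in> off_axis"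
  shows "mixed_pd is f x = mixed_pd is g x"
  using assms(2)
proof (induction "is" arbitrary: x)
  case Nil then show ?case by (simp add: mixed_pd_Nil assms)
next
  case (Cons i "is")
  show ?case unfolding mixed_pd_Cons by (rule pd_cong[OF open_off_axis Cons.prems Cons.IH])
qed

text \<open>
  The functions \<open>\<phi> (cos_polar x)\<close> reach every Cartesian derivative only through the derivatives of \<open>\<phi>\<close>, with
  coefficients \<open>G\<close> that depend on the fixed fields \<open>\<psi>\<close> and the multi-index, but not on \<open>\<phi>\<close>. The independence of
  \<open>\<phi>\<close> is what makes the bounds derived from it uniform over families.
\<close>

lemma mixed_pd_expansion:
  fixes \<psi> :: "'j \<Rightarrow> real^3 \<Rightarrow> 'b::real_normed_vector"
  assumes S: "finite S" and \<psi>: "\<forall>j\<in>S. smooth_off_axis (\<psi> j)"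
  shows "\<exists>G. (\<forall>j\<in>S. \<forall>k. smooth_off_axis (G j k)) \<and>
    (\<forall>\<phi>. (\<forall>j\<in>S. smooth (\<phi> j)) \<longrightarrow> (\<forall>x\<in>off_axis.
       mixed_pd is (\<lambda>x. \<Sum>j\<in>S. \<phi> j (cos_polar x) *\<^sub>R \<psi> j x) x =
       (\<Sum>j\<in>S. \<Sum>k\<le>length is. (deriv ^^ k) (\<phi> j) (cos_polar x) *\<^sub>R G j k x)))"
proof (induction "is")
  case Nil
  show ?case by (rule exI[of _ "\<lambda>j k. \<psi> j"]) (simp add: \<psi> mixed_pd_Nil)
next
  case (Cons i "is")
  define n where "n = length is"
  from Cons.IH[folded n_def] obtain G where G: "\<forall>j\<in>S. \<forall>k. smooth_off_axis (G j k)"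
    and eq: "\<forall>\<phi>. (\<forall>j\<in>S. smooth (\<phi> j)) \<longrightarrow> (\<forall>x\<in>off_axis.
       mixed_pd is (\<lambda>x. \<Sum>j\<in>S. \<phi> j (cos_polar x) *\<^sub>R \<psi> j x) x =
       (\<Sum>j\<in>S. \<Sum>k\<le>n. (deriv ^^ k) (\<phi> j) (cos_polar x) *\<^sub>R G j k x))"
    by (elim exE conjE) (rule that)
  define G' where "G' j k = (\<lambda>x. (case k of 0 \<Rightarrow> 0 | Suc l \<Rightarrow> pd i cos_polar x *\<^sub>R G j l x) +
     (if k \<le> n then 1 else 0::real) *\<^sub>R pd i (G j k) x)" for j k
  have G': "smooth_off_axis (G' j k)" if "j \<in> S" for j k
    unfolding G'_def
    by (cases k) (auto intro!: smooth_off_axis_add smooth_off_axis_scaleR smooth_off_axis_const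
        smooth_off_axis_pd G[rule_format] smooth_cos_polar that)
  show ?case
  proof (intro exI[of _ G'] conjI ballI allI impI G')
    fix \<phi> :: "'j \<Rightarrow> real \<Rightarrow> real" and x :: "real^3"
    assume sm: "\<forall>j\<in>S. smooth (\<phi> j)" and x: "x \<in> off_axis"
    have smd: "smooth ((deriv ^^ k) (\<phi> j))" if "j \<in> S" for j k
      using sm that by (induction k) (auto intro: smooth_deriv)
    have d1: "(\<lambda>x. (deriv ^^ k) (\<phi> j) (cos_polar x)) differentiable (at x)" if "j \<in> S" for j k
      by (rule smooth_off_axis_differentiable[OF smooth_off_axis_comp_cos_polar[OF smd[OF that]] x])
    have d1': "G j k differentiable (at x)" if "j \<in> S" for j k
      using smooth_off_axis_differentiable[OF _ x] G that by blast
    have d2: "(\<lambda>x. (deriv ^^ k) (\<phi> j) (cos_polar x) *\<^sub>R G j k x) differentiable (at x)" if "j \<in> S" for j k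
      using d1[OF that] d1'[OF that] by (rule differentiable_scaleR)
    have "mixed_pd (i # is) (\<lambda>x. \<Sum>j\<in>S. \<phi> j (cos_polar x) *\<^sub>R \<psi> j x) x =
       pd i (\<lambda>x. \<Sum>j\<in>S. \<Sum>k\<le>n. (deriv ^^ k) (\<phi> j) (cos_polar x) *\<^sub>R G j k x) x"
      unfolding mixed_pd_Cons by (rule pd_cong[OF open_off_axis x eq[rule_format]], rule bspec[OF sm])
    also have "\<dots> = (\<Sum>j\<in>S. \<Sum>k\<le>n. (deriv ^^ k) (\<phi> j) (cos_polar x) *\<^sub>R pd i (G j k) x +
         ((deriv ^^ Suc k) (\<phi> j) (cos_polar x) * pd i cos_polar x) *\<^sub>R G j k x)"
      using d1 d1' d2 by (simp add: pd_sum S differentiable_sum pd_scaleR pd_comp_cos_polar smd x)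
    also have "\<dots> = (\<Sum>j\<in>S. \<Sum>k\<le>Suc n. (deriv ^^ k) (\<phi> j) (cos_polar x) *\<^sub>R G' j k x)"
    proof (rule sum.cong[OF refl])
      fix j
      have 1: "(\<Sum>k\<le>n. (deriv ^^ k) (\<phi> j) (cos_polar x) *\<^sub>R pd i (G j k) x) =
        (\<Sum>k\<le>Suc n. (deriv ^^ k) (\<phi> j) (cos_polar x) *\<^sub>R ((if k \<le> n then 1 else 0::real) *\<^sub>R pd i (G j k) x))"
        by simp
      have 2: "(\<Sum>k\<le>n. ((deriv ^^ Suc k) (\<phi> j) (cos_polar x) * pd i cos_polar x) *\<^sub>R G j k x) =
        (\<Sum>k\<le>Suc n. (deriv ^^ k) (\<phi> j) (cos_polar x) *\<^sub>R (case k of 0 \<Rightarrow> 0 | Suc l \<Rightarrow> pd i cos_polar x *\<^sub>R G j l x))"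
        by (subst sum.atMost_Suc_shift) simp
      show "(\<Sum>k\<le>n. (deriv ^^ k) (\<phi> j) (cos_polar x) *\<^sub>R pd i (G j k) x +
         ((deriv ^^ Suc k) (\<phi> j) (cos_polar x) * pd i cos_polar x) *\<^sub>R G j k x) =
         (\<Sum>k\<le>Suc n. (deriv ^^ k) (\<phi> j) (cos_polar x) *\<^sub>R G' j k x)"
        unfolding sum.distrib 1 2 G'_def scaleR_add_right by (rule add.commute)
    qed
    finally show "mixed_pd (i # is) (\<lambda>x. \<Sum>j\<in>S. \<phi> j (cos_polar x) *\<^sub>R \<psi> j x) x =
       (\<Sum>j\<in>S. \<Sum>k\<le>length (i # is). (deriv ^^ k) (\<phi> j) (cos_polar x) *\<^sub>R G' j k x)"
      by (simp add: n_def)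
  qed
qed

lemma smooth_off_axis_bounded:
  fixes G :: "real^3 \<Rightarrow> 'b::real_normed_vector"
  assumes "smooth_off_axis G" "compact A" "A \<subseteq> off_axis"
  shows "\<exists>M\<ge>0. \<forall>x\<in>A. norm (G x) \<le> M"
proof -
  have "continuous_on A G"
    using assms(1,3) unfolding smooth_off_axis_def
    by (metis Ck_on.simps(1) continuous_on_subset)
  then have "bounded (G ` A)"
    using assms(2) compact_continuous_image compact_imp_bounded by blast
  then obtain M where "\<forall>x\<in>A. norm (G x) \<le> M" by (auto simp: bounded_iff)
  then have "\<forall>x\<in>A. norm (G x) \<le> max M 0" by (auto intro: order_trans)
  then show ?thesis by (intro exI[of _ "max M 0"]) auto
qed

text \<open>
  All analysis on the sphere is reduced to one variable: a \<open>C\<^sup>m\<close> bound for the profiles \<open>\<phi>\<close> on the range of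
  \<open>cos \<theta>\<close> gives a \<open>C\<^sup>m\<close> bound for the field, with a constant that depends only on the frame \<open>\<psi>\<close>, on \<open>m\<close> and on a
  compact set away from the poles.
\<close>

lemma sphere_norm_bound:
  fixes \<psi> :: "'j \<Rightarrow> real^3 \<Rightarrow> 'b::real_normed_vector"
  assumes S: "finite S" and \<psi>: "\<forall>j\<in>S. smooth_off_axis (\<psi> j)"
    and K: "compact K" "K \<subseteq> off_axis"
  shows "\<exists>C\<ge>0. \<forall>f \<phi> B A. A \<subseteq> K \<longrightarrow> 0 \<le> B \<longrightarrow> (\<forall>j\<in>S. smooth (\<phi> j)) \<longrightarrow>
     (\<forall>x\<in>off_axis. radial_ext f x = (\<Sum>j\<in>S. \<phi> j (cos_polar x) *\<^sub>R \<psi> j x)) \<longrightarrow>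
     (\<forall>j\<in>S. \<forall>k\<le>m. \<forall>x\<in>A. \<bar>(deriv ^^ k) (\<phi> j) (cos_polar x)\<bar> \<le> B) \<longrightarrow>
     sphere_norm m A f \<le> ennreal (C * B)"
proof -
  let ?L = "{is::3 list. length is \<le> m}"
  have L: "finite ?L" using finite_lists_length_le[of "UNIV::3 set" m] by simp
  define Q where "Q is C \<longleftrightarrow> C \<ge> 0 \<and> (\<forall>\<phi>. (\<forall>j\<in>S. smooth (\<phi> j)) \<longrightarrow> (\<forall>x\<in>K. \<forall>B\<ge>0.
       (\<forall>j\<in>S. \<forall>k\<le>m. \<bar>(deriv ^^ k) (\<phi> j) (cos_polar x)\<bar> \<le> B) \<longrightarrow>
       norm (mixed_pd is (\<lambda>x. \<Sum>j\<in>S. \<phi> j (cos_polar x) *\<^sub>R \<psi> j x) x) \<le> C * B))" for "is" C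
  have "\<exists>C. Q is C" if "is \<in> ?L" for "is"
  proof -
    from mixed_pd_expansion[of S \<psi> "is", OF S \<psi>] obtain G where G: "\<forall>j\<in>S. \<forall>k. smooth_off_axis (G j k)"
      and eq: "\<forall>\<phi>. (\<forall>j\<in>S. smooth (\<phi> j)) \<longrightarrow> (\<forall>x\<in>off_axis.
       mixed_pd is (\<lambda>x. \<Sum>j\<in>S. \<phi> j (cos_polar x) *\<^sub>R \<psi> j x) x =
       (\<Sum>j\<in>S. \<Sum>k\<le>length is. (deriv ^^ k) (\<phi> j) (cos_polar x) *\<^sub>R G j k x))"
      by (elim exE conjE) (rule that)
    have "\<forall>j\<in>S. \<forall>k. \<exists>M\<ge>0. \<forall>x\<in>K. norm (G j k x) \<le> M"
      using smooth_off_axis_bounded[OF G[rule_format] K] by blast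
    then obtain M where M: "\<And>j k. j \<in> S \<Longrightarrow> M j k \<ge> 0" "\<And>j k x. j \<in> S \<Longrightarrow> x \<in> K \<Longrightarrow> norm (G j k x) \<le> M j k"
      by metis
    show ?thesis
      unfolding Q_def
    proof (intro exI[of _ "\<Sum>j\<in>S. \<Sum>k\<le>length is. M j k"] conjI allI impI ballI)
      show "0 \<le> (\<Sum>j\<in>S. \<Sum>k\<le>length is. M j k)" by (intro sum_nonneg M)
      fix \<phi> x and B :: real
      assume a: "\<forall>j\<in>S. smooth (\<phi> j)" "x \<in> K" "0 \<le> B" "\<forall>j\<in>S. \<forall>k\<le>m. \<bar>(deriv ^^ k) (\<phi> j) (cos_polar x)\<bar> \<le> B"
      have "norm (\<Sum>j\<in>S. \<Sum>k\<le>length is. (deriv ^^ k) (\<phi> j) (cos_polar x) *\<^sub>R G j k x) \<le>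
        (\<Sum>j\<in>S. \<Sum>k\<le>length is. M j k * B)"
      proof (intro sum_norm_le)
        fix j k assume jk: "j \<in> S" "k \<in> {..length is}"
        have "\<bar>(deriv ^^ k) (\<phi> j) (cos_polar x)\<bar> * norm (G j k x) \<le> B * M j k"
          by (rule mult_mono) (use a jk that M in auto)
        then show "norm ((deriv ^^ k) (\<phi> j) (cos_polar x) *\<^sub>R G j k x) \<le> M j k * B"
          by (simp add: mult.commute)
      qed
      also have "\<dots> = (\<Sum>j\<in>S. \<Sum>k\<le>length is. M j k) * B" by (simp add: sum_distrib_right)
      finally show "norm (mixed_pd is (\<lambda>x. \<Sum>j\<in>S. \<phi> j (cos_polar x) *\<^sub>R \<psi> j x) x) \<le> (\<Sum>j\<in>S. \<Sum>k\<le>length is. M j k) * B"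
        using eq a(1,2) K(2) by auto
    qed
  qed
  then obtain C where "\<forall>is\<in>?L. Q is (C is)" by metis
  then have C: "norm (mixed_pd is (\<lambda>x. \<Sum>j\<in>S. \<phi> j (cos_polar x) *\<^sub>R \<psi> j x) x) \<le> C is * B"
    if "is \<in> ?L" "\<forall>j\<in>S. smooth (\<phi> j)" "x \<in> K" "B \<ge> 0"
       "\<forall>j\<in>S. \<forall>k\<le>m. \<bar>(deriv ^^ k) (\<phi> j) (cos_polar x)\<bar> \<le> B" for "is" \<phi> x B
    using that unfolding Q_def by blast
  from \<open>\<forall>is\<in>?L. Q is (C is)\<close> have C0: "C is \<ge> 0" if "is \<in> ?L" for "is"
    using that unfolding Q_def by blast
  show ?thesis
  proof (intro exI[of _ "\<Sum>is\<in>?L. C is"] conjI allI impI)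
    show "0 \<le> (\<Sum>is\<in>?L. C is)" by (rule sum_nonneg) (use C0 in auto)
    fix f :: "real^3 \<Rightarrow> 'b" and \<phi> B and A :: "(real^3) set"
    assume a: "A \<subseteq> K" "0 \<le> B" "\<forall>j\<in>S. smooth (\<phi> j)"
      "\<forall>x\<in>off_axis. radial_ext f x = (\<Sum>j\<in>S. \<phi> j (cos_polar x) *\<^sub>R \<psi> j x)"
      "\<forall>j\<in>S. \<forall>k\<le>m. \<forall>x\<in>A. \<bar>(deriv ^^ k) (\<phi> j) (cos_polar x)\<bar> \<le> B"
    show "sphere_norm m A f \<le> ennreal ((\<Sum>is\<in>?L. C is) * B)"
      unfolding sphere_norm_def
    proof (intro SUP_least ennreal_leI)
      fix "is" x assume i: "is \<in> ?L" and x: "x \<in> A"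
      have "mixed_pd is (radial_ext f) x = mixed_pd is (\<lambda>x. \<Sum>j\<in>S. \<phi> j (cos_polar x) *\<^sub>R \<psi> j x) x"
        by (rule mixed_pd_cong) (use a x K in auto)
      also have "norm \<dots> \<le> C is * B"
        by (rule C[OF i a(3)]) (use a x in auto)
      also have "\<dots> \<le> (\<Sum>is\<in>?L. C is) * B"
        by (rule mult_right_mono[OF member_le_sum[OF i]]) (use L C0 a(2) in auto)
      finally show "norm (mixed_pd is (radial_ext f) x) \<le> (\<Sum>is\<in>?L. C is) * B" .
    qed
  qed
qed

section \<open>From the Riccati equation to the Navier-Stokes equations\<close>

text \<open>
  The zonal functions of degree \<open>-k\<close>. Derivatives of \<open>homog k \<phi>\<close> are again sums of such functions, multiplied
  by coordinates.
\<close>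

definition homog :: "nat \<Rightarrow> (real \<Rightarrow> real) \<Rightarrow> real^3 \<Rightarrow> real" where
  "homog k \<phi> x = inv_norm x ^ k * \<phi> (cos_polar x)"

abbreviation e3 :: "real^3" where "e3 \<equiv> axis 3 1"

definition unit_dir :: "real^3 \<Rightarrow> real^3" where "unit_dir x = inv_norm x *\<^sub>R x"

lemma unit_dir_inner_self: "x \<noteq> 0 \<Longrightarrow> unit_dir x \<bullet> unit_dir x = 1"
  by (simp add: unit_dir_def power2_norm_eq_inner[symmetric] power2_eq_square field_simps)

lemma unit_dir_inner_e3: "unit_dir x \<bullet> e3 = cos_polar x"
  by (simp add: unit_dir_def inner_axis cos_polar_def)

lemma unit_dir_nth_3: "unit_dir x $ 3 = cos_polar x"
  by (simp add: unit_dir_def cos_polar_def)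

lemma smooth_off_axis_inv_norm_power: "smooth_off_axis (\<lambda>x. inv_norm x ^ k)"
  by (induction k) (auto intro!: smooth_off_axis_const smooth_off_axis_mult smooth_inv_norm)

lemma smooth_off_axis_homog: "smooth \<phi> \<Longrightarrow> smooth_off_axis (homog k \<phi>)"
  unfolding homog_def[abs_def]
  by (intro smooth_off_axis_mult smooth_off_axis_inv_norm_power smooth_off_axis_comp_cos_polar)

lemma smooth_off_axis_ident: "smooth_off_axis (\<lambda>x. x)"
  by (rule smooth_off_axis_linear[OF bounded_linear_ident])

lemma smooth_off_axis_nth: "smooth_off_axis (\<lambda>x. x $ i)"
  by (rule smooth_off_axis_linear[OF bounded_linear_vec_nth])

lemma pd_const: "pd i (\<lambda>x. c) x = 0"
  by (rule pd_eqI[THEN trans]) (auto intro: derivative_eq_intros)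

lemma pd_ident: "pd i (\<lambda>x. x) x = axis i 1"
  by (rule pd_eqI) (rule has_derivative_ident)

lemma pd_nth: "pd i (\<lambda>x. x $ j) x = axis i 1 $ j"
  by (rule pd_eqI) (rule bounded_linear_imp_has_derivative[OF bounded_linear_vec_nth])

lemma pd_mult:
  fixes f g :: "real^3 \<Rightarrow> real"
  shows "f differentiable (at x) \<Longrightarrow> g differentiable (at x) \<Longrightarrow>
    pd i (\<lambda>x. f x * g x) x = f x * pd i g x + pd i f x * g x"
  using pd_scaleR[of f x g i] by simp

lemma pd_diff:
  assumes "f differentiable (at x)" "g differentiable (at x)"
  shows "pd i (\<lambda>x. f x - g x) x = pd i f x - pd i g x"
  using pd_eqI[OF has_derivative_diff[OF assms[THEN has_frechet_derivative]], of i]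
  by (simp add: pd_def)

lemma pd_inv_norm_power:
  assumes "x \<in> off_axis" shows "pd i (\<lambda>x. inv_norm x ^ k) x = - real k * inv_norm x ^ (k + 2) * x $ i"
proof (induction k)
  case 0 then show ?case by (simp add: pd_const)
next
  case (Suc k)
  have "pd i (\<lambda>x. inv_norm x * inv_norm x ^ k) x = inv_norm x * pd i (\<lambda>x. inv_norm x ^ k) x + pd i inv_norm x * inv_norm x ^ k"
    by (intro pd_mult smooth_off_axis_differentiable[OF _ assms] smooth_inv_norm smooth_off_axis_inv_norm_power)
  with Suc off_axis_nz[OF assms] show ?case
    by (simp add: pd_inv_norm algebra_simps power3_eq_cube)
qed

lemma pd_homog:
  assumes \<phi>: "smooth \<phi>" and x: "x \<in> off_axis"
  shows "pd i (homog k \<phi>) x = inv_norm x ^ (k + 1) *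
    (deriv \<phi> (cos_polar x) * e3 $ i - (k * \<phi> (cos_polar x) + cos_polar x * deriv \<phi> (cos_polar x)) * unit_dir x $ i)"
proof -
  have "pd i (homog k \<phi>) x = inv_norm x ^ k * pd i (\<lambda>x. \<phi> (cos_polar x)) x + pd i (\<lambda>x. inv_norm x ^ k) x * \<phi> (cos_polar x)"
    unfolding homog_def[abs_def]
    by (intro pd_mult smooth_off_axis_differentiable[OF _ x] smooth_off_axis_inv_norm_power smooth_off_axis_comp_cos_polar \<phi>)
  then show ?thesis
    using x by (simp add: pd_inv_norm_power pd_comp_cos_polar[OF \<phi>] pd_cos_polar off_axis_nz unit_dir_def algebra_simps)
qed

lemma pd_homog_eq:
  assumes \<phi>: "smooth \<phi>" and x: "x \<in> off_axis"
  shows "pd i (homog k \<phi>) x = homog (k + 1) (deriv \<phi>) x * e3 $ i -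
    homog (k + 2) (\<lambda>s. k * \<phi> s + s * deriv \<phi> s) x * x $ i"
  unfolding pd_homog[OF assms] by (simp add: homog_def unit_dir_def algebra_simps)

lemma smooth_radial_part: "smooth \<phi> \<Longrightarrow> smooth (\<lambda>s. real k * \<phi> s + s * deriv \<phi> s)"
  by (intro smooth_add smooth_mult smooth_const smooth_ident smooth_deriv)

lemma deriv_radial_part:
  assumes "smooth \<phi>" "t \<in> {-1<..<1}"
  shows "deriv (\<lambda>s. real k * \<phi> s + s * deriv \<phi> s) t = (real k + 1) * deriv \<phi> t + t * deriv (deriv \<phi>) t"
  by (rule DERIV_imp_deriv)
     (auto intro!: derivative_eq_intros smooth_DERIV assms smooth_deriv simp: algebra_simps)

lemma grad_homog:
  assumes \<phi>: "smooth \<phi>" and x: "x \<in> off_axis"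
  shows "grad (homog k \<phi>) x = inv_norm x ^ (k + 1) *\<^sub>R
    (deriv \<phi> (cos_polar x) *\<^sub>R e3 - (k * \<phi> (cos_polar x) + cos_polar x * deriv \<phi> (cos_polar x)) *\<^sub>R unit_dir x)"
  by (simp add: grad_def vec_eq_iff pd_homog[OF assms])

lemma norm_scaleR_unit_dir: "x \<in> off_axis \<Longrightarrow> x = norm x *\<^sub>R unit_dir x"
  by (simp add: unit_dir_def off_axis_nz)

text \<open>
  Euler's identity for a function of degree \<open>-k\<close>.
\<close>

lemma inner_grad_homog:
  assumes \<phi>: "smooth \<phi>" and x: "x \<in> off_axis"
  shows "x \<bullet> grad (homog k \<phi>) x = - real k * homog k \<phi> x"
proof -
  have 1: "x \<bullet> e3 = norm x * cos_polar x" "x \<bullet> unit_dir x = norm x"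
    using unit_dir_inner_e3[of x] unit_dir_inner_self[OF off_axis_nz[OF x]] norm_scaleR_unit_dir[OF x]
    by (metis inner_scaleR_left, metis inner_scaleR_left mult.right_neutral)
  have "norm x * inv_norm x = 1" using off_axis_nz[OF x] by simp
  moreover have "p * n * (d * (m * z) - q * m) = p * (d * z - q)" if "m * n = 1" for m n p d q z :: real
    using that by algebra
  ultimately show ?thesis
    unfolding grad_homog[OF assms] homog_def inner_scaleR_right inner_diff_right 1 power_add power_one_right
    by (simp add: algebra_simps)
qed

text \<open>
  The angular part is the Legendre operator; the radial part of a function of degree \<open>-k\<close> contributes
  \<open>k (k - 1)\<close>.
\<close>

lemma laplacian_homog:
  assumes \<phi>: "smooth \<phi>" and x: "x \<in> off_axis"
  shows "laplacian (homog k \<phi>) x = inv_norm x ^ (k + 2) *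
    ((1 - (cos_polar x)\<^sup>2) * deriv (deriv \<phi>) (cos_polar x) - 2 * cos_polar x * deriv \<phi> (cos_polar x) + real k * (real k - 1) * \<phi> (cos_polar x))"
proof -
  define \<psi> where "\<psi> = (\<lambda>s. real k * \<phi> s + s * deriv \<phi> s)"
  have sm: "smooth \<psi>" unfolding \<psi>_def by (rule smooth_radial_part[OF \<phi>])
  have d\<psi>: "deriv \<psi> (cos_polar x) = (real k + 1) * deriv \<phi> (cos_polar x) + cos_polar x * deriv (deriv \<phi>) (cos_polar x)"
    unfolding \<psi>_def by (rule deriv_radial_part[OF \<phi> cos_polar_in[OF x]])
  have "pd i (pd i (homog k \<phi>)) x = pd i (homog (k + 1) (deriv \<phi>)) x * e3 $ i -
     (pd i (homog (k + 2) \<psi>) x * x $ i + homog (k + 2) \<psi> x)" for i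
  proof -
    note d = smooth_off_axis_differentiable[OF _ x]
    have "pd i (pd i (homog k \<phi>)) x = pd i (\<lambda>x. homog (k + 1) (deriv \<phi>) x * e3 $ i - homog (k + 2) \<psi> x * x $ i) x"
      unfolding \<psi>_def by (rule pd_cong[OF open_off_axis x]) (simp add: pd_homog_eq[OF \<phi>])
    also have "\<dots> = pd i (\<lambda>x. homog (k + 1) (deriv \<phi>) x * e3 $ i) x - pd i (\<lambda>x. homog (k + 2) \<psi> x * x $ i) x"
      by (rule pd_diff; rule d; intro smooth_off_axis_mult smooth_off_axis_homog smooth_deriv \<phi> sm
          smooth_off_axis_const smooth_off_axis_nth)
    also have "pd i (\<lambda>x. homog (k + 1) (deriv \<phi>) x * e3 $ i) x = pd i (homog (k + 1) (deriv \<phi>)) x * e3 $ i"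
      by (subst pd_mult)
         (auto intro!: d smooth_off_axis_homog smooth_deriv \<phi> smooth_off_axis_const simp: pd_const)
    also have "pd i (\<lambda>x. homog (k + 2) \<psi> x * x $ i) x = pd i (homog (k + 2) \<psi>) x * x $ i + homog (k + 2) \<psi> x"
      by (subst pd_mult)
         (auto intro!: d smooth_off_axis_homog sm smooth_off_axis_nth simp: pd_nth)
    finally show ?thesis .
  qed
  note pdpd = this
  have "laplacian (homog k \<phi>) x = e3 \<bullet> grad (homog (k + 1) (deriv \<phi>)) x -
      (x \<bullet> grad (homog (k + 2) \<psi>) x + 3 * homog (k + 2) \<psi> x)"
    unfolding laplacian_def pdpd by (simp add: inner_vec_def grad_def sum_3)
  also have "\<dots> = inv_norm x ^ (k + 2) * (deriv (deriv \<phi>) (cos_polar x) -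
       ((real k + 1) * deriv \<phi> (cos_polar x) + cos_polar x * deriv (deriv \<phi>) (cos_polar x)) * cos_polar x) + (real k - 1) * homog (k + 2) \<psi> x"
    unfolding inner_grad_homog[OF sm x] grad_homog[OF smooth_deriv[OF \<phi>] x]
    by (simp add: inner_diff_right inner_axis_axis inner_commute[of e3] unit_dir_inner_e3 algebra_simps)
  also have "\<dots> = inv_norm x ^ (k + 2) *
    ((1 - (cos_polar x)\<^sup>2) * deriv (deriv \<phi>) (cos_polar x) - 2 * cos_polar x * deriv \<phi> (cos_polar x) + real k * (real k - 1) * \<phi> (cos_polar x))"
    unfolding homog_def \<psi>_def by (simp add: algebra_simps power2_eq_square)
  finally show ?thesis .
qed

text \<open>
  With \<open>U = r sin \<theta> u\<^sub>\<theta>\<close> as a function of \<open>t = cos \<theta>\<close>, put \<open>b = U / (1 - t\<^sup>2)\<close>. Since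
  \<open>sin \<theta> e\<^sub>\<theta> = t e\<^sub>r - e\<^sub>3\<close>, the field is a combination of \<open>e\<^sub>r\<close> and the constant vector \<open>e\<^sub>3\<close>, which is easier to
  differentiate than a combination of \<open>e\<^sub>r\<close> and \<open>e\<^sub>\<theta>\<close>. The coefficient of \<open>e\<^sub>r\<close> is dictated by
  \<open>div u = 0\<close>, which means \<open>u\<^sub>r = U' / r\<close>.
\<close>

definition radial_coeff :: "(real \<Rightarrow> real) \<Rightarrow> real \<Rightarrow> real" where
  "radial_coeff b t = (1 - t * t) * deriv b t - t * b t"

text \<open>
  The radial component of the momentum equation is algebraic in the pressure, because
  \<open>\<partial>\<^sub>r p = -2 p / r\<close>. Two derivatives of the Riccati equation remove the third derivative of \<open>U\<close> from it; what
  remains is \<open>c\<^sub>3 + \<nu> U' - U\<^sup>2 / (2 (1 - t\<^sup>2))\<close>, written here in terms of \<open>b\<close>.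
\<close>

definition pressure_coeff :: "real^3 \<Rightarrow> real \<Rightarrow> (real \<Rightarrow> real) \<Rightarrow> real \<Rightarrow> real" where
  "pressure_coeff c \<nu> b t = c $ 3 + \<nu> * ((1 - t * t) * deriv b t - 2 * (t * b t)) - 1/2 * ((1 - t * t) * (b t * b t))"

definition velocity :: "(real \<Rightarrow> real) \<Rightarrow> real^3 \<Rightarrow> real^3" where
  "velocity b x = homog 2 (radial_coeff b) x *\<^sub>R x - homog 1 b x *\<^sub>R e3"

definition pressure :: "real^3 \<Rightarrow> real \<Rightarrow> (real \<Rightarrow> real) \<Rightarrow> real^3 \<Rightarrow> real" where
  "pressure c \<nu> b = homog 2 (pressure_coeff c \<nu> b)"

lemma smooth_radial_coeff: "smooth b \<Longrightarrow> smooth (radial_coeff b)"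
  unfolding radial_coeff_def[abs_def]
  by (intro smooth_diff smooth_mult smooth_const smooth_ident smooth_deriv)

lemma smooth_pressure_coeff: "smooth b \<Longrightarrow> smooth (pressure_coeff c \<nu> b)"
  unfolding pressure_coeff_def[abs_def]
  by (intro smooth_diff smooth_add smooth_mult smooth_const smooth_ident smooth_deriv)

lemma smooth_off_axis_velocity: "smooth b \<Longrightarrow> smooth_off_axis (velocity b)"
  unfolding velocity_def[abs_def]
  by (intro smooth_off_axis_diff smooth_off_axis_scaleR smooth_off_axis_homog smooth_radial_coeff
      smooth_off_axis_ident smooth_off_axis_const)

lemma smooth_off_axis_pressure: "smooth b \<Longrightarrow> smooth_off_axis (pressure c \<nu> b)"
  unfolding pressure_def by (intro smooth_off_axis_homog smooth_pressure_coeff)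

lemma sum_nth_axis: "(\<Sum>i\<in>UNIV. v $ i *\<^sub>R axis i 1) = (v::real^3)"
  by (simp add: vec_eq_iff axis_def if_distrib sum.delta cong: if_cong)

text \<open>
  The differential operators for a field \<open>f x - g e\<^sub>3\<close>, expressed without coordinates through \<open>f\<close>, \<open>g\<close> and their
  gradients and Laplacians. The last two are known for the functions \<open>homog k \<phi>\<close>.
\<close>

lemma velocity_calculus:
  assumes f: "smooth_off_axis f" and g: "smooth_off_axis g" and x: "x \<in> off_axis"
    and u: "u = (\<lambda>x. f x *\<^sub>R x - g x *\<^sub>R e3)"
  shows "divergence u x = x \<bullet> grad f x + 3 * f x - e3 \<bullet> grad g x"
    and "advection u x = (u x \<bullet> grad f x) *\<^sub>R x + f x *\<^sub>R u x - (u x \<bullet> grad g x) *\<^sub>R e3"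
    and "laplacian u x = laplacian f x *\<^sub>R x + 2 *\<^sub>R grad f x - laplacian g x *\<^sub>R e3"
proof -
  have pdu: "pd i u y = pd i f y *\<^sub>R y + f y *\<^sub>R axis i 1 - pd i g y *\<^sub>R e3" if y: "y \<in> off_axis" for i y
  proof -
    note d = smooth_off_axis_differentiable[OF _ y]
    have "pd i u y = pd i (\<lambda>x. f x *\<^sub>R x) y - pd i (\<lambda>x. g x *\<^sub>R e3) y"
      unfolding u by (rule pd_diff; rule d; intro smooth_off_axis_scaleR f g smooth_off_axis_ident smooth_off_axis_const)
    then show ?thesis
      by (simp add: pd_scaleR d f g smooth_off_axis_ident smooth_off_axis_const pd_ident pd_const)
  qed
  note d = smooth_off_axis_differentiable[OF _ x]
  have pdpdu: "pd i (pd i u) x = pd i (pd i f) x *\<^sub>R x + (2 * pd i f x) *\<^sub>R axis i 1 - pd i (pd i g) x *\<^sub>R e3" for i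
  proof -
    have two: "v *\<^sub>R axis i 1 + v *\<^sub>R axis i 1 = (2 * v) *\<^sub>R (axis i 1 :: real^3)" for v :: real
      by (simp add: scaleR_add_left[symmetric])
    have s: "smooth_off_axis (pd i f)" "smooth_off_axis (pd i g)" by (intro smooth_off_axis_pd f g)+
    have "pd i (pd i u) x = pd i (\<lambda>y. (pd i f y *\<^sub>R y + f y *\<^sub>R axis i 1) - pd i g y *\<^sub>R e3) x"
      by (rule pd_cong[OF open_off_axis x pdu])
    also have "\<dots> = pd i (\<lambda>y. pd i f y *\<^sub>R y + f y *\<^sub>R axis i 1) x - pd i (\<lambda>y. pd i g y *\<^sub>R e3) x"
      by (rule pd_diff; rule d; intro smooth_off_axis_add smooth_off_axis_scaleR f g s smooth_off_axis_ident smooth_off_axis_const)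
    also have "pd i (\<lambda>y. pd i f y *\<^sub>R y + f y *\<^sub>R axis i 1) x =
       pd i (\<lambda>y. pd i f y *\<^sub>R y) x + pd i (\<lambda>y. f y *\<^sub>R axis i 1) x"
      by (rule pd_add; rule d; intro smooth_off_axis_scaleR f g s smooth_off_axis_ident smooth_off_axis_const)
    finally show ?thesis
      by (simp add: pd_scaleR d f g s smooth_off_axis_ident smooth_off_axis_const pd_ident pd_const two[symmetric])
  qed
  show "divergence u x = x \<bullet> grad f x + 3 * f x - e3 \<bullet> grad g x"
    by (simp add: divergence_def pdu[OF x] grad_def inner_vec_def sum_3 axis_def algebra_simps)
  have "advection u x = (\<Sum>i\<in>UNIV. (u x $ i * pd i f x) *\<^sub>R x + f x *\<^sub>R (u x $ i *\<^sub>R axis i 1) - (u x $ i * pd i g x) *\<^sub>R e3)"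
    unfolding advection_def
    by (rule sum.cong) (simp_all add: pdu[OF x] algebra_simps)
  also have "\<dots> = (u x \<bullet> grad f x) *\<^sub>R x + f x *\<^sub>R u x - (u x \<bullet> grad g x) *\<^sub>R e3"
    by (simp only: sum.distrib sum_subtractf scaleR_left.sum[symmetric] scaleR_right.sum[symmetric] sum_nth_axis)
       (simp add: inner_vec_def grad_def)
  finally show "advection u x = (u x \<bullet> grad f x) *\<^sub>R x + f x *\<^sub>R u x - (u x \<bullet> grad g x) *\<^sub>R e3" .
  have "laplacian u x = (\<Sum>i\<in>UNIV. pd i (pd i f) x *\<^sub>R x + 2 *\<^sub>R (grad f x $ i *\<^sub>R axis i 1) - pd i (pd i g) x *\<^sub>R e3)"
    unfolding laplacian_def by (rule sum.cong) (simp_all add: pdpdu grad_def)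
  also have "\<dots> = laplacian f x *\<^sub>R x + 2 *\<^sub>R grad f x - laplacian g x *\<^sub>R e3"
    unfolding laplacian_def
    by (simp only: sum.distrib sum_subtractf scaleR_left.sum[symmetric] scaleR_right.sum[symmetric] sum_nth_axis)
  finally show "laplacian u x = laplacian f x *\<^sub>R x + 2 *\<^sub>R grad f x - laplacian g x *\<^sub>R e3" .
qed

text \<open>
  The equation \<open>\<nu> (1 - t\<^sup>2) U' + 2 \<nu> t U + U\<^sup>2 / 2 = P\<^sub>c\<close> in terms of \<open>b = U / (1 - t\<^sup>2)\<close>: the term linear in
  \<open>U\<close> has disappeared, and \<open>\<nu> b' + b\<^sup>2 / 2 = P\<^sub>c / (1 - t\<^sup>2)\<^sup>2\<close>.
\<close>

definition riccati :: "real^3 \<Rightarrow> real \<Rightarrow> (real \<Rightarrow> real) \<Rightarrow> bool" where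
  "riccati c \<nu> b \<longleftrightarrow> (\<forall>t\<in>{-1<..<1}. (1 - t * t)\<^sup>2 * (\<nu> * deriv b t + b t * b t / 2) = P c t)"

text \<open>
  \<open>P\<^sub>c\<close> is a quadratic polynomial, so that two derivatives leave only \<open>c\<^sub>3\<close>. This is the form in which the
  Riccati equation enters the momentum equation.
\<close>

lemma riccati_deriv2:
  assumes b: "smooth b" and r: "riccati c \<nu> b" and t: "t \<in> {-1<..<1}"
  defines "b1 \<equiv> deriv b t" and "b2 \<equiv> deriv (deriv b) t" and "b3 \<equiv> deriv (deriv (deriv b)) t"
  shows "(1 - t * t)\<^sup>2 * (\<nu> * b3 + b t * b2 + b1 * b1) - 8 * t * (1 - t * t) * (\<nu> * b2 + b t * b1) +
     (12 * t * t - 4) * (\<nu> * b1 + b t * b t / 2) = - 2 * c $ 3"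
proof -
  let ?f = "\<lambda>t. (1 - t * t)\<^sup>2 * (\<nu> * deriv b t + b t * b t / 2)"
  let ?f' = "\<lambda>t. (1 - t * t)\<^sup>2 * (\<nu> * deriv (deriv b) t + b t * deriv b t) - 4 * t * (1 - t * t) * (\<nu> * deriv b t + b t * b t / 2)"
  have d: "(b has_real_derivative deriv b s) (at s)" "(deriv b has_real_derivative deriv (deriv b) s) (at s)"
    "(deriv (deriv b) has_real_derivative deriv (deriv (deriv b)) s) (at s)" if "s \<in> {-1<..<1}" for s
    by (intro smooth_DERIV smooth_deriv b that)+
  have f': "(?f has_real_derivative ?f' s) (at s)" if "s \<in> {-1<..<1}" for s
    by (auto intro!: derivative_eq_intros d that simp: power2_eq_square algebra_simps)
  have P': "(P c has_real_derivative (c $ 2 - c $ 1 - 2 * c $ 3 * s)) (at s)" for s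
    unfolding P_def[abs_def] by (auto intro!: derivative_eq_intros)
  have "?f' s = c $ 2 - c $ 1 - 2 * c $ 3 * s" if s: "s \<in> {-1<..<1}" for s
    by (rule DERIV_unique[OF has_real_derivative_cong_interval[OF _ s f'[OF s]] P'])
       (use r in \<open>auto simp: riccati_def\<close>)
  then have "((\<lambda>s. c $ 2 - c $ 1 - 2 * c $ 3 * s) has_real_derivative D) (at t)"
    if "(?f' has_real_derivative D) (at t)" for D
    by (rule has_real_derivative_cong_interval[OF _ t that])
  moreover have "(?f' has_real_derivative ((1 - t * t)\<^sup>2 * (\<nu> * b3 + b t * b2 + b1 * b1) - 8 * t * (1 - t * t) * (\<nu> * b2 + b t * b1) +
     (12 * t * t - 4) * (\<nu> * b1 + b t * b t / 2))) (at t)"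
    unfolding b1_def b2_def b3_def
    by (auto intro!: derivative_eq_intros d t simp: power2_eq_square algebra_simps)
  moreover have "((\<lambda>s. c $ 2 - c $ 1 - 2 * c $ 3 * s) has_real_derivative (- 2 * c $ 3)) (at t)"
    by (auto intro!: derivative_eq_intros)
  ultimately show ?thesis using DERIV_unique by blast
qed

lemma
  assumes b: "smooth b" and t: "t \<in> {-1<..<1}"
  shows deriv_radial_coeff: "deriv (radial_coeff b) t = (1 - t * t) * deriv (deriv b) t - 3 * t * deriv b t - b t"
    and deriv2_radial_coeff: "deriv (deriv (radial_coeff b)) t =
      (1 - t * t) * deriv (deriv (deriv b)) t - 5 * t * deriv (deriv b) t - 4 * deriv b t"
    and deriv_pressure_coeff: "deriv (pressure_coeff c \<nu> b) t =
      \<nu> * ((1 - t * t) * deriv (deriv b) t - 4 * t * deriv b t - 2 * b t) + t * (b t * b t) - (1 - t * t) * (b t * deriv b t)"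
proof -
  have d: "(b has_real_derivative deriv b s) (at s)" "(deriv b has_real_derivative deriv (deriv b) s) (at s)"
    "(deriv (deriv b) has_real_derivative deriv (deriv (deriv b)) s) (at s)" if "s \<in> {-1<..<1}" for s
    by (intro smooth_DERIV smooth_deriv b that)+
  have 1: "deriv (radial_coeff b) s = (1 - s * s) * deriv (deriv b) s - 3 * s * deriv b s - b s"
    if "s \<in> {-1<..<1}" for s
    unfolding radial_coeff_def[abs_def]
    by (rule DERIV_imp_deriv) (auto intro!: derivative_eq_intros d that simp: algebra_simps)
  show "deriv (radial_coeff b) t = (1 - t * t) * deriv (deriv b) t - 3 * t * deriv b t - b t"
    by (rule 1[OF t])
  have "deriv (deriv (radial_coeff b)) t = deriv (\<lambda>s. (1 - s * s) * deriv (deriv b) s - 3 * s * deriv b s - b s) t"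
    by (rule deriv_cong_interval[OF 1 t])
  also have "\<dots> = (1 - t * t) * deriv (deriv (deriv b)) t - 5 * t * deriv (deriv b) t - 4 * deriv b t"
    by (rule DERIV_imp_deriv) (auto intro!: derivative_eq_intros d t simp: algebra_simps)
  finally show "deriv (deriv (radial_coeff b)) t =
      (1 - t * t) * deriv (deriv (deriv b)) t - 5 * t * deriv (deriv b) t - 4 * deriv b t" .
  show "deriv (pressure_coeff c \<nu> b) t =
      \<nu> * ((1 - t * t) * deriv (deriv b) t - 4 * t * deriv b t - 2 * b t) + t * (b t * b t) - (1 - t * t) * (b t * deriv b t)"
    unfolding pressure_coeff_def[abs_def]
    by (rule DERIV_imp_deriv) (auto intro!: derivative_eq_intros d t simp: algebra_simps)
qed

text \<open>
  Both sides of the momentum equation are combinations of \<open>e\<^sub>r\<close> and \<open>e\<^sub>3\<close>. The coefficient of \<open>e\<^sub>3\<close> vanishes by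
  the choice of the pressure alone; the coefficient of \<open>e\<^sub>r\<close> is the twice differentiated Riccati equation.
  The divergence vanishes by the choice of \<open>radial_coeff\<close>.
\<close>

lemma riccati_imp_stationary_NS:
  assumes b: "smooth b" and r: "riccati c \<nu> b"
  shows "stationary_NS \<nu> (velocity b) (pressure c \<nu> b)"
  unfolding stationary_NS_def
proof (intro conjI ballI)
  show "Ck_on 2 (velocity b) off_axis" "Ck_on 1 (pressure c \<nu> b) off_axis"
    using smooth_off_axis_velocity[OF b] smooth_off_axis_pressure[OF b]
    unfolding smooth_off_axis_def by blast+
  fix x assume x: "x \<in> off_axis"
  define t a a1 a2 b0 b1 b2 b3 \<pi>0 \<pi>1 where
    "t = cos_polar x" and "a = radial_coeff b t" and "a1 = deriv (radial_coeff b) t"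
    and "a2 = deriv (deriv (radial_coeff b)) t" and "b0 = b t" and "b1 = deriv b t"
    and "b2 = deriv (deriv b) t" and "b3 = deriv (deriv (deriv b)) t"
    and "\<pi>0 = pressure_coeff c \<nu> b t" and "\<pi>1 = deriv (pressure_coeff c \<nu> b) t"
  note defs = this
  have t: "t \<in> {-1<..<1}" unfolding t_def by (rule cos_polar_in[OF x])
  have a: "a = (1 - t * t) * b1 - t * b0" by (simp add: defs radial_coeff_def)
  have a1: "a1 = (1 - t * t) * b2 - 3 * t * b1 - b0"
    using deriv_radial_coeff[OF b t] by (simp add: defs)
  have a2: "a2 = (1 - t * t) * b3 - 5 * t * b2 - 4 * b1"
    using deriv2_radial_coeff[OF b t] by (simp add: defs)
  have \<pi>0: "\<pi>0 = c $ 3 + \<nu> * ((1 - t * t) * b1 - 2 * (t * b0)) - 1/2 * ((1 - t * t) * (b0 * b0))"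
    by (simp add: defs pressure_coeff_def)
  have \<pi>1: "\<pi>1 = \<nu> * ((1 - t * t) * b2 - 4 * t * b1 - 2 * b0) + t * (b0 * b0) - (1 - t * t) * (b0 * b1)"
    using deriv_pressure_coeff[OF b t] by (simp add: defs)
  have ric: "(1 - t * t)\<^sup>2 * (\<nu> * b3 + b0 * b2 + b1 * b1) - 8 * t * (1 - t * t) * (\<nu> * b2 + b0 * b1) +
     (12 * t * t - 4) * (\<nu> * b1 + b0 * b0 / 2) = - 2 * c $ 3"
    using riccati_deriv2[OF b r t] by (simp add: defs)
  note sm = smooth_radial_coeff[OF b] smooth_pressure_coeff[OF b]
  define n where "n = inv_norm x"
  have n: "n * norm x = 1" using off_axis_nz[OF x] by (simp add: n_def)
  have X: "x = norm x *\<^sub>R unit_dir x" by (rule norm_scaleR_unit_dir[OF x])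
  have i1: "unit_dir x \<bullet> unit_dir x = 1" "unit_dir x \<bullet> e3 = t" "e3 \<bullet> unit_dir x = t" "e3 \<bullet> e3 = 1"
    using unit_dir_inner_self[OF off_axis_nz[OF x]] unit_dir_inner_e3[of x]
    by (auto simp: inner_commute t_def inner_axis_axis)
  have ga: "grad (homog 2 (radial_coeff b)) x = n ^ 3 *\<^sub>R (a1 *\<^sub>R e3 - (2 * a + t * a1) *\<^sub>R unit_dir x)"
    using grad_homog[OF sm(1) x, of 2] by (simp add: defs n_def)
  have gb: "grad (homog 1 b) x = n ^ 2 *\<^sub>R (b1 *\<^sub>R e3 - (b0 + t * b1) *\<^sub>R unit_dir x)"
    using grad_homog[OF b x, of 1] by (simp add: defs n_def power2_eq_square)
  have gp: "grad (pressure c \<nu> b) x = n ^ 3 *\<^sub>R (\<pi>1 *\<^sub>R e3 - (2 * \<pi>0 + t * \<pi>1) *\<^sub>R unit_dir x)"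
    using grad_homog[OF sm(2) x, of 2] by (simp add: defs n_def pressure_def)
  have la: "laplacian (homog 2 (radial_coeff b)) x = n ^ 4 * ((1 - t * t) * a2 - 2 * t * a1 + 2 * a)"
    using laplacian_homog[OF sm(1) x, of 2] by (simp add: defs n_def power2_eq_square)
  have lb: "laplacian (homog 1 b) x = n ^ 3 * ((1 - t * t) * b2 - 2 * t * b1)"
    using laplacian_homog[OF b x, of 1] by (simp add: defs n_def power2_eq_square numeral_3_eq_3)
  have Ha: "homog 2 (radial_coeff b) x = n ^ 2 * a" and Hb: "homog 1 b x = n * b0"
    by (simp_all add: homog_def defs n_def)
  have u: "velocity b x = n *\<^sub>R (a *\<^sub>R unit_dir x - b0 *\<^sub>R e3)"
    unfolding velocity_def Ha Hb
    by (simp add: unit_dir_def n_def power2_eq_square scaleR_diff_right)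
  have "velocity b = (\<lambda>x. homog 2 (radial_coeff b) x *\<^sub>R x - homog 1 b x *\<^sub>R e3)"
    by (rule ext) (rule velocity_def)
  note vc = velocity_calculus[OF smooth_off_axis_homog[OF sm(1)] smooth_off_axis_homog[OF b] x this]
  have "divergence (velocity b) x = - 2 * homog 2 (radial_coeff b) x + 3 * homog 2 (radial_coeff b) x - n ^ 2 * (b1 - (b0 + t * b1) * t)"
    unfolding vc(1) inner_grad_homog[OF sm(1) x] gb by (simp add: inner_diff_right i1)
  also have "\<dots> = 0" unfolding Ha a by (simp add: algebra_simps)
  finally show "divergence (velocity b) x = 0" .
  have ua: "velocity b x \<bullet> grad (homog 2 (radial_coeff b)) x =
     n ^ 4 * (a * a1 * t - a * (2 * a + t * a1) - b0 * a1 + b0 * (2 * a + t * a1) * t)"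
    unfolding u ga
    by (simp add: inner_diff_right inner_diff_left i1 algebra_simps power4_eq_xxxx power3_eq_cube)
  have ub: "velocity b x \<bullet> grad (homog 1 b) x =
     n ^ 3 * (a * b1 * t - a * (b0 + t * b1) - b0 * b1 + b0 * (b0 + t * b1) * t)"
    unfolding u gb
    by (simp add: inner_diff_right inner_diff_left i1 algebra_simps power2_eq_square power3_eq_cube)
  show "- \<nu> *\<^sub>R laplacian (velocity b) x + advection (velocity b) x + grad (pressure c \<nu> b) x = 0"
  proof (subst vec_eq_iff, intro allI)
    fix j
    define E D where "E = unit_dir x $ j" and "D = e3 $ j"
    have xj: "x $ j = norm x * E" unfolding E_def by (subst X) (simp del: X)
    have nn: "n ^ 4 * q * (norm x * E) = n ^ 3 * q * E" for q
      using n by algebra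
    \<comment> \<open>Coefficients of \<open>e\<^sub>r\<close> and \<open>e\<^sub>3\<close> in the momentum equation, up to the factor \<open>r\<^sup>-\<^sup>3\<close>.\<close>
    have e_part: "- \<nu> * ((1 - t * t) * a2 - 4 * t * a1 - 2 * a) - (1 - t * t) * a1 * b0 - a * a + 2 * a * b0 * t - 2 * \<pi>0 - t * \<pi>1 = 0"
      using ric unfolding a a1 a2 \<pi>0 \<pi>1 by (simp add: field_simps power2_eq_square)
    have e3_part: "- \<nu> * (2 * a1 - (1 - t * t) * b2 + 2 * t * b1) + a * b0 + \<pi>1 = 0"
      unfolding a a1 \<pi>1 by (simp add: algebra_simps)
    have "(- \<nu> *\<^sub>R laplacian (velocity b) x + advection (velocity b) x + grad (pressure c \<nu> b) x) $ j =
       n ^ 3 * ((- \<nu> * ((1 - t * t) * a2 - 4 * t * a1 - 2 * a) - (1 - t * t) * a1 * b0 - a * a + 2 * a * b0 * t - 2 * \<pi>0 - t * \<pi>1) * E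
        + (- \<nu> * (2 * a1 - (1 - t * t) * b2 + 2 * t * b1) + a * b0 + \<pi>1) * D)"
      unfolding vc(2,3) ua ub
      unfolding la lb ga gp Ha u
      by (simp only: vector_add_component vector_minus_component vector_scaleR_component
          vector_uminus_component xj E_def[symmetric] D_def[symmetric] real_scaleR_def nn)
         (use a in algebra)
    then show "(- \<nu> *\<^sub>R laplacian (velocity b) x + advection (velocity b) x + grad (pressure c \<nu> b) x) $ j = 0 $ j"
      unfolding e_part e3_part by simp
  qed
qed

lemma cos_polar_scale: "t > 0 \<Longrightarrow> cos_polar (t *\<^sub>R x) = cos_polar x"
  by (simp add: cos_polar_def)

lemma homog_scale: "t > 0 \<Longrightarrow> homog k \<phi> (t *\<^sub>R x) = inverse t ^ k * homog k \<phi> x"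
  by (simp add: homog_def cos_polar_scale power_mult_distrib)

lemma cos_theta: "x \<in> off_axis \<Longrightarrow> cos (theta x) = cos_polar x"
  using cos_polar_in[of x] by (simp add: theta_def cos_polar_def divide_inverse)

lemma sin_theta: "x \<in> off_axis \<Longrightarrow> sin (theta x) = sqrt (1 - cos_polar x * cos_polar x)"
  using cos_polar_in[of x] by (simp add: theta_def cos_polar_def divide_inverse sin_arccos power2_eq_square)

lemma one_minus_sq_pos: "t \<in> {-1<..<1} \<Longrightarrow> 1 - t * t > (0::real)"
  using mult_pos_pos[of "1 - t" "1 + t"] by (simp add: algebra_simps)

lemma axis_dist_cos_polar:
  assumes "x \<in> off_axis" shows "axis_dist x = norm x * sqrt (1 - cos_polar x * cos_polar x)"
proof -
  have "(x $ 1)\<^sup>2 + (x $ 2)\<^sup>2 = (norm x)\<^sup>2 * (1 - cos_polar x * cos_polar x)"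
  proof -
    have "norm x * cos_polar x = x $ 3" using off_axis_nz[OF assms] by (simp add: cos_polar_def)
    moreover have "A + B = n\<^sup>2 * (1 - t * t)" if "n * t = z" "n\<^sup>2 = A + B + z\<^sup>2" for A B n t z :: real
    proof -
      have "A + B = n\<^sup>2 - (n * t)\<^sup>2" using that by simp
      then show ?thesis by (simp add: power2_eq_square algebra_simps)
    qed
    ultimately show ?thesis using norm_sq_3[of x] by blast
  qed
  then show ?thesis by (simp add: axis_dist_def real_sqrt_mult)
qed

text \<open>
  This relation between the frames explains the form of \<open>velocity\<close>.
\<close>

lemma e_theta_eq:
  assumes x: "x \<in> off_axis"
  shows "e_theta x = inverse (sqrt (1 - cos_polar x * cos_polar x)) *\<^sub>R (cos_polar x *\<^sub>R unit_dir x - e3)"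
proof -
  define S where "S = sqrt (1 - cos_polar x * cos_polar x)"
  have pos: "norm x > 0" "S > 0" using off_axis_nz[OF x] one_minus_sq_pos[OF cos_polar_in[OF x]] by (auto simp: S_def)
  have c: "x $ 3 / norm x = cos_polar x" by (simp add: cos_polar_def divide_inverse)
  have S2: "S * S = 1 - cos_polar x * cos_polar x" using one_minus_sq_pos[OF cos_polar_in[OF x]] by (simp add: S_def)
  have "e_theta x $ j = (inverse S *\<^sub>R (cos_polar x *\<^sub>R unit_dir x - e3)) $ j" for j
    using exhaust_3[of j] pos S2
    by (auto simp: e_theta_def c axis_dist_cos_polar[OF x] S_def[symmetric] axis_def unit_dir_nth_3 field_simps)
       (simp_all add: unit_dir_def field_simps)
  then show ?thesis by (simp add: vec_eq_iff S_def)
qed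

lemma frame_inner:
  assumes x: "x \<in> off_axis"
  shows "unit_dir x \<bullet> e_theta x = 0" "e3 \<bullet> e_theta x = - sqrt (1 - cos_polar x * cos_polar x)"
    "unit_dir x \<bullet> e_phi x = 0" "e3 \<bullet> e_phi x = 0"
proof -
  note i = unit_dir_inner_self[OF off_axis_nz[OF x]] unit_dir_inner_e3[of x] inner_commute[of e3 "unit_dir x"]
  have p: "1 - cos_polar x * cos_polar x > 0" by (rule one_minus_sq_pos[OF cos_polar_in[OF x]])
  show "unit_dir x \<bullet> e_theta x = 0" by (simp add: e_theta_eq[OF x] inner_diff_right i)
  have "e3 \<bullet> e_theta x = - ((1 - cos_polar x * cos_polar x) / sqrt (1 - cos_polar x * cos_polar x))"
    by (simp add: e_theta_eq[OF x] inner_diff_right i inner_axis_axis divide_inverse algebra_simps)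
  then show "e3 \<bullet> e_theta x = - sqrt (1 - cos_polar x * cos_polar x)" using p by (simp add: real_div_sqrt)
  show "unit_dir x \<bullet> e_phi x = 0" "e3 \<bullet> e_phi x = 0"
    by (simp_all add: e_phi_def inner_vec_def sum_3 axis_def unit_dir_def)
qed

lemma velocity_unit_dir: "velocity b x = (inv_norm x * radial_coeff b (cos_polar x)) *\<^sub>R unit_dir x - (inv_norm x * b (cos_polar x)) *\<^sub>R e3"
  by (simp add: velocity_def homog_def unit_dir_def power2_eq_square mult_ac)

theorem riccati_imp_solution:
  assumes b: "smooth b" and r: "riccati c \<nu> b"
  shows "homogeneous_axisym_no_swirl_solution \<nu> (velocity b) (pressure c \<nu> b)"
  unfolding homogeneous_axisym_no_swirl_solution_def
proof (intro conjI)
  show "stationary_NS \<nu> (velocity b) (pressure c \<nu> b)" by (rule riccati_imp_stationary_NS[OF assms])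
  show "homogeneous_off_axis (- 1) (velocity b)"
    by (auto simp: homogeneous_off_axis_def velocity_def homog_scale power_int_minus scaleR_diff_right power2_eq_square)
  show "homogeneous_off_axis (- 2) (pressure c \<nu> b)"
    by (auto simp: homogeneous_off_axis_def pressure_def homog_scale power_int_minus power_inverse)
  show "no_swirl (velocity b)"
    by (auto simp: no_swirl_def velocity_unit_dir inner_diff_left frame_inner)
  show "axisymmetric (velocity b)"
    unfolding axisymmetric_def
  proof (intro exI ballI conjI)
    fix x assume x: "x \<in> off_axis"
    have e: "e_r x = unit_dir x" by (simp add: e_r_def unit_dir_def)
    show "velocity b x \<bullet> e_r x = (\<lambda>r \<theta>. inverse r * (radial_coeff b (cos \<theta>) - cos \<theta> * b (cos \<theta>))) (norm x) (theta x)"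
      using unit_dir_inner_self[OF off_axis_nz[OF x]] unit_dir_inner_e3[of x]
      by (simp add: velocity_unit_dir e inner_diff_left inner_commute[of e3] cos_theta[OF x] algebra_simps)
    show "velocity b x \<bullet> e_theta x = (\<lambda>r \<theta>. inverse r * b (cos \<theta>) * sin \<theta>) (norm x) (theta x)"
      by (simp add: velocity_unit_dir inner_diff_left frame_inner[OF x] cos_theta[OF x] sin_theta[OF x])
    show "velocity b x \<bullet> e_phi x = (\<lambda>r \<theta>. 0) (norm x) (theta x)"
      by (simp add: velocity_unit_dir inner_diff_left frame_inner[OF x])
  qed
qed

section \<open>The limiting Euler flows\<close>

text \<open>
  The positive root \<open>\<beta>\<close> of \<open>\<beta>\<^sup>2 / 2 = P\<^sub>c / (1 - t\<^sup>2)\<^sup>2\<close>, that is, the Riccati equation with \<open>\<nu> = 0\<close>. The limiting flows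
  \<open>v\<^sub>c\<^sup>\<plusminus>\<close> are the fields with profile \<open>\<plusminus>\<beta>\<close>, so that they and the viscous solutions can be compared profile by
  profile.
\<close>

definition euler_profile :: "real^3 \<Rightarrow> real \<Rightarrow> real" where
  "euler_profile c t = sqrt (2 * P c t) * inverse (1 - t * t)"

lemma P_has_derivative: "(P c has_real_derivative (c $ 2 - c $ 1 - 2 * c $ 3 * s)) (at s)"
  unfolding P_def[abs_def] by (auto intro!: derivative_eq_intros)

lemma euler_profile_has_derivative:
  assumes "P c t > 0" "t \<in> {-1<..<1}"
  shows "(euler_profile c has_real_derivative
    inverse (1 - t * t) * (deriv (P c) t / sqrt (2 * P c t) + 2 * t * euler_profile c t)) (at t)"
proof -
  have d: "(P c has_real_derivative deriv (P c) t) (at t)"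
    using P_has_derivative DERIV_imp_deriv by metis
  show ?thesis unfolding euler_profile_def[abs_def]
    using assms one_minus_sq_pos[OF assms(2)]
    by (auto intro!: derivative_eq_intros d simp: field_simps)
qed

lemma euler_v_eq:
  assumes x: "x \<in> off_axis" and pos: "P c (cos_polar x) > 0"
  shows "euler_v s c x = velocity (\<lambda>t. s * euler_profile c t) x"
proof -
  define t where "t = cos_polar x"
  define S where "S = sqrt (1 - t * t)"
  have t: "t \<in> {-1<..<1}" unfolding t_def by (rule cos_polar_in[OF x])
  have S: "S > 0" "S * S = 1 - t * t" using one_minus_sq_pos[OF t] by (simp_all add: S_def)
  have d: "deriv (\<lambda>t. s * euler_profile c t) t =
     s * (inverse (1 - t * t) * (deriv (P c) t / sqrt (2 * P c t) + 2 * t * euler_profile c t))"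
    by (rule DERIV_imp_deriv, rule DERIV_cmult, rule euler_profile_has_derivative) (use pos t in \<open>auto simp: t_def\<close>)
  have rc: "radial_coeff (\<lambda>t. s * euler_profile c t) t = s * (deriv (P c) t / sqrt (2 * P c t) + t * euler_profile c t)"
  proof -
    have "(1 - t * t) * (s * (inverse (1 - t * t) * X)) = s * X" for X
      using one_minus_sq_pos[OF t] by simp
    then show ?thesis unfolding radial_coeff_def d by (simp only:) (simp add: algebra_simps)
  qed
  have ep: "euler_profile c t = sqrt (2 * P c t) * inverse S * inverse S"
    by (simp add: euler_profile_def S(2)[symmetric])
  show ?thesis
    unfolding velocity_unit_dir euler_v_def e_theta_eq[OF x] cos_theta[OF x] sin_theta[OF x]
      t_def[symmetric] S_def[symmetric] rc
    unfolding ep e_r_def unit_dir_def[symmetric]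
    by (simp add: unit_dir_def[symmetric] divide_inverse algebra_simps scaleR_add_left)
qed

lemma euler_q_eq:
  assumes x: "x \<in> off_axis" and pos: "P c (cos_polar x) > 0" and s: "s * s = 1"
  shows "euler_q c x = pressure c 0 (\<lambda>t. s * euler_profile c t) x"
proof -
  define t where "t = cos_polar x"
  have t: "t \<in> {-1<..<1}" unfolding t_def by (rule cos_polar_in[OF x])
  have "deriv (P c) = (\<lambda>s. c $ 2 - c $ 1 - 2 * c $ 3 * s)"
    using P_has_derivative DERIV_imp_deriv by blast
  moreover have "((\<lambda>s. c $ 2 - c $ 1 - 2 * c $ 3 * s) has_real_derivative (- 2 * c $ 3)) (at t)"
    by (auto intro!: derivative_eq_intros)
  ultimately have d2: "deriv (deriv (P c)) t = - 2 * c $ 3" by (metis DERIV_imp_deriv)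
  have 1: "1 - t * t > 0" by (rule one_minus_sq_pos[OF t])
  have s2: "s * e * (s * e) = e * e" for e using s by algebra
  have q: "sqrt (2 * P c t) * sqrt (2 * P c t) = 2 * P c t" using pos by (simp add: t_def)
  have sq: "(1 - t * t) * (s * euler_profile c t * (s * euler_profile c t)) = 2 * P c t / (1 - t * t)"
  proof -
    have "w * ((q * inverse w) * (q * inverse w)) = q * q / w" if "w > 0" for w q :: real
      using that by (simp add: field_simps)
    from this[OF 1] show ?thesis unfolding s2 euler_profile_def by (simp only: q)
  qed
  have sin2: "(sqrt (1 - t * t))\<^sup>2 = 1 - t * t" using 1 by simp
  have gen: "- (1 / (2 * n\<^sup>2)) * (- 2 * d + Y) = inverse n ^ 2 * (d + 0 * Z - 1/2 * Y)" if "n \<noteq> 0" for n d Y Z :: real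
    using that by (simp add: power_inverse divide_simps)
  show ?thesis
    unfolding euler_q_def pressure_def homog_def pressure_coeff_def cos_theta[OF x] sin_theta[OF x]
      t_def[symmetric] d2 sq sin2
    by (rule gen) (simp add: off_axis_nz[OF x])
qed

section \<open>Scalar differential inequalities\<close>

text \<open>
  The integrating factor \<open>exp (\<integral> h)\<close> turns \<open>f' = g - h f\<close> into a monotonicity statement. With \<open>h\<close> depending on
  the solution itself this serves as comparison principle for the Riccati equation: differences of a solution
  and a constant satisfy such a linear equation.
\<close>

lemma
  fixes f g h :: "real \<Rightarrow> real"
  assumes ax: "a \<le> x" and h: "continuous_on {a..x} h"
    and f: "\<And>y. y \<in> {a..x} \<Longrightarrow> (f has_real_derivative g y - h y * f y) (at y)"
    and fa: "f a \<ge> 0"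
  shows barrier_nonneg: "(\<And>y. y \<in> {a..x} \<Longrightarrow> g y \<ge> 0) \<Longrightarrow> f x \<ge> 0"
    and barrier_pos: "(\<And>y. y \<in> {a..x} \<Longrightarrow> g y > 0) \<Longrightarrow> a < x \<Longrightarrow> f x > 0"
proof -
  define Hh where "Hh y = integral {a..y} h" for y
  define \<phi> where "\<phi> y = f y * exp (Hh y)" for y
  have dH: "(Hh has_real_derivative h y) (at y within {a..x})" if "y \<in> {a..x}" for y
    unfolding Hh_def[abs_def] by (rule integral_has_real_derivative[OF h that])
  have cont: "continuous_on {a..x} \<phi>"
    unfolding \<phi>_def[abs_def]
  proof (intro continuous_intros)
    show "continuous_on {a..x} Hh" using dH
      by (meson DERIV_continuous continuous_on_eq_continuous_within)
    show "continuous_on {a..x} f" using f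
      by (meson DERIV_isCont continuous_at_imp_continuous_on)
  qed
  have d: "(\<phi> has_real_derivative g y * exp (Hh y)) (at y)" if y: "a < y" "y < x" for y
  proof -
    have "(Hh has_real_derivative h y) (at y)"
      using dH[of y] y by (simp add: at_within_Icc_at)
    then show ?thesis unfolding \<phi>_def[abs_def] using f[of y] y
      by (auto intro!: derivative_eq_intros simp: algebra_simps)
  qed
  have a: "\<phi> a = f a" by (simp add: \<phi>_def Hh_def)
  show "f x \<ge> 0" if g: "\<And>y. y \<in> {a..x} \<Longrightarrow> g y \<ge> 0"
  proof -
    have "\<phi> a \<le> \<phi> x"
    proof (rule DERIV_nonneg_imp_increasing_open[OF ax _ cont])
      fix y assume "a < y" "y < x"
      then show "\<exists>z. (\<phi> has_real_derivative z) (at y) \<and> z \<ge> 0"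
        using d[of y] g[of y] by (intro exI[of _ "g y * exp (Hh y)"]) simp
    qed
    then have "\<phi> x \<ge> 0" using a fa by linarith
    then show ?thesis by (simp add: \<phi>_def zero_le_mult_iff)
  qed
  show "f x > 0" if g: "\<And>y. y \<in> {a..x} \<Longrightarrow> g y > 0" and "a < x"
  proof -
    have "\<phi> a < \<phi> x"
    proof (rule DERIV_pos_imp_increasing_open[OF \<open>a < x\<close> _ cont])
      fix y assume "a < y" "y < x"
      then show "\<exists>z. (\<phi> has_real_derivative z) (at y) \<and> z > 0"
        using d[of y] g[of y] by (intro exI[of _ "g y * exp (Hh y)"]) simp
    qed
    then have "\<phi> x > 0" using a fa by linarith
    then show ?thesis by (simp add: \<phi>_def zero_less_mult_iff)
  qed
qed

text \<open>
  The damping \<open>A / \<nu>\<close> is strong for small \<open>\<nu>\<close>: initial data are forgotten exponentially fast and the forcing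
  \<open>g\<close> produces a response of its own size. The proof shows that \<open>(f\<^sup>2 - (\<nu>G/k)\<^sup>2) exp (k (y - a) / \<nu>)\<close> decreases,
  where the mixed term is absorbed by a square.
\<close>

lemma fast_decay:
  fixes f f' A g :: "real \<Rightarrow> real"
  assumes ax: "a \<le> x" and pos: "\<nu> > 0" "k > 0"
    and f: "\<And>y. y \<in> {a..x} \<Longrightarrow> (f has_real_derivative f' y) (at y)"
    and ode: "\<And>y. y \<in> {a..x} \<Longrightarrow> \<nu> * f' y = - A y * f y + g y"
    and A: "\<And>y. y \<in> {a..x} \<Longrightarrow> A y \<ge> k"
    and g: "\<And>y. y \<in> {a..x} \<Longrightarrow> \<bar>g y\<bar> \<le> G * \<nu>"
  shows "(f x)\<^sup>2 \<le> (\<nu> * G / k)\<^sup>2 + (f a)\<^sup>2 * exp (- k * (x - a) / \<nu>)"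
proof -
  define q where "q = (\<nu> * G / k)\<^sup>2"
  define \<phi> where "\<phi> y = ((f y)\<^sup>2 - q) * exp (k * (y - a) / \<nu>)" for y
  have "\<exists>z. (\<phi> has_real_derivative z) (at y) \<and> z \<le> 0" if y: "a \<le> y" "y \<le> x" for y
  proof (intro exI conjI)
    show "(\<phi> has_real_derivative ((2 * f y * f' y + (k / \<nu>) * ((f y)\<^sup>2 - q)) * exp (k * (y - a) / \<nu>))) (at y)"
      unfolding \<phi>_def[abs_def] using f[of y] y pos
      by (auto intro!: derivative_eq_intros simp: algebra_simps)
    have "\<nu> * (2 * f y * f' y) = 2 * f y * (\<nu> * f' y)" by simp
    also have "\<dots> = - 2 * (A y * (f y)\<^sup>2) + 2 * (g y * f y)"
    proof -
      have "\<nu> * f' y = - A y * f y + g y" using ode y by simp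
      then show ?thesis by (simp only:) (simp add: power2_eq_square algebra_simps)
    qed
    also have "\<dots> \<le> - 2 * (k * (f y)\<^sup>2) + 2 * (G * \<nu> * \<bar>f y\<bar>)"
    proof -
      have "k * (f y)\<^sup>2 \<le> A y * (f y)\<^sup>2" using A[of y] y by (simp add: mult_right_mono)
      moreover have "g y * f y \<le> G * \<nu> * \<bar>f y\<bar>"
        using mult_right_mono[OF g[of y], of "\<bar>f y\<bar>"] y abs_ge_self[of "g y * f y"] by (simp add: abs_mult)
      ultimately show ?thesis by linarith
    qed
    also have "\<dots> \<le> - k * (f y)\<^sup>2 + k * q"
    proof -
      have "0 \<le> k * (\<bar>f y\<bar> - \<nu> * G / k)\<^sup>2" using pos by simp
      also have "\<dots> = k * (f y)\<^sup>2 - 2 * (G * \<nu> * \<bar>f y\<bar>) + k * q"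
        using pos by (simp add: q_def power2_eq_square field_simps)
      finally show ?thesis by linarith
    qed
    finally have "\<nu> * (2 * f y * f' y) \<le> - k * ((f y)\<^sup>2 - q)" by (simp add: algebra_simps)
    then have "2 * f y * f' y \<le> - k * ((f y)\<^sup>2 - q) / \<nu>" using pos by (simp add: field_simps)
    then have "2 * f y * f' y + (k / \<nu>) * ((f y)\<^sup>2 - q) \<le> 0" by simp
    then show "(2 * f y * f' y + (k / \<nu>) * ((f y)\<^sup>2 - q)) * exp (k * (y - a) / \<nu>) \<le> 0"
      by (simp add: mult_nonpos_nonneg)
  qed
  then have "\<phi> x \<le> \<phi> a" using DERIV_nonpos_imp_nonincreasing[OF ax, of \<phi>] by blast
  then have "((f x)\<^sup>2 - q) * exp (k * (x - a) / \<nu>) \<le> (f a)\<^sup>2 - q" by (simp add: \<phi>_def)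
  also have "\<dots> \<le> (f a)\<^sup>2" by (simp add: q_def)
  finally have "((f x)\<^sup>2 - q) * exp (k * (x - a) / \<nu>) * exp (- (k * (x - a) / \<nu>)) \<le> (f a)\<^sup>2 * exp (- (k * (x - a) / \<nu>))"
    by (intro mult_right_mono) auto
  then show ?thesis by (simp add: q_def mult.assoc exp_add[symmetric] del: mult_minus_left)
qed

text \<open>
  After a fixed distance \<open>\<eta>\<close> the exponential is bounded by \<open>2 \<nu>\<^sup>2 / (k \<eta>)\<^sup>2\<close>, so bounded data lead to \<open>f = O(\<nu>)\<close>.
\<close>

lemma fast_decay_bound:
  fixes f f' A g :: "real \<Rightarrow> real"
  assumes ax: "a + \<eta> \<le> x" and pos: "\<nu> > 0" "k > 0" "\<eta> > 0"
    and f: "\<And>y. y \<in> {a..x} \<Longrightarrow> (f has_real_derivative f' y) (at y)"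
    and ode: "\<And>y. y \<in> {a..x} \<Longrightarrow> \<nu> * f' y = - A y * f y + g y"
    and A: "\<And>y. y \<in> {a..x} \<Longrightarrow> A y \<ge> k"
    and g: "\<And>y. y \<in> {a..x} \<Longrightarrow> \<bar>g y\<bar> \<le> G * \<nu>"
    and fa: "\<bar>f a\<bar> \<le> M"
  shows "\<bar>f x\<bar> \<le> sqrt ((G / k)\<^sup>2 + 2 * M\<^sup>2 / (k * \<eta>)\<^sup>2) * \<nu>"
proof -
  have "(f x)\<^sup>2 \<le> (\<nu> * G / k)\<^sup>2 + (f a)\<^sup>2 * exp (- k * (x - a) / \<nu>)"
    by (rule fast_decay[OF _ pos(1,2) f ode A g]) (use ax pos in auto)
  moreover have "(f a)\<^sup>2 * exp (- k * (x - a) / \<nu>) \<le> M\<^sup>2 * (2 * \<nu>\<^sup>2 / (k * \<eta>)\<^sup>2)"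
  proof (rule mult_mono)
    show "(f a)\<^sup>2 \<le> M\<^sup>2" using fa by (rule power2_le_iff_abs_le[THEN iffD2, rotated]) (use fa in linarith)
    have s: "k * \<eta> / \<nu> > 0" using pos by simp
    have "exp (- k * (x - a) / \<nu>) \<le> exp (- (k * \<eta> / \<nu>))"
      using ax pos by (simp add: divide_right_mono)
    also have "\<dots> = 1 / exp (k * \<eta> / \<nu>)" by (simp add: exp_minus inverse_eq_divide)
    also have "\<dots> \<le> 1 / ((k * \<eta> / \<nu>)\<^sup>2 / 2)"
    proof (rule divide_left_mono)
      show "(k * \<eta> / \<nu>)\<^sup>2 / 2 \<le> exp (k * \<eta> / \<nu>)"
        using exp_lower_Taylor_quadratic[of "k * \<eta> / \<nu>"] s by linarith
      show "0 < exp (k * \<eta> / \<nu>) * ((k * \<eta> / \<nu>)\<^sup>2 / 2)"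
        using pos by (intro mult_pos_pos divide_pos_pos zero_less_power) auto
    qed simp
    also have "\<dots> = 2 * \<nu>\<^sup>2 / (k * \<eta>)\<^sup>2" using pos by (simp add: field_simps)
    finally show "exp (- k * (x - a) / \<nu>) \<le> 2 * \<nu>\<^sup>2 / (k * \<eta>)\<^sup>2" .
  qed auto
  ultimately have "(f x)\<^sup>2 \<le> (\<nu> * G / k)\<^sup>2 + M\<^sup>2 * (2 * \<nu>\<^sup>2 / (k * \<eta>)\<^sup>2)" by linarith
  also have "\<dots> = ((G / k)\<^sup>2 + 2 * M\<^sup>2 / (k * \<eta>)\<^sup>2) * \<nu>\<^sup>2"
    by (simp add: power_mult_distrib power_divide algebra_simps)
  finally have "sqrt ((f x)\<^sup>2) \<le> sqrt (((G / k)\<^sup>2 + 2 * M\<^sup>2 / (k * \<eta>)\<^sup>2) * \<nu>\<^sup>2)"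
    by (rule real_sqrt_le_mono)
  then show ?thesis using pos by (simp add: real_sqrt_mult)
qed

text \<open>
  The bound holds for all solutions at once. A value above \<open>B\<close> forces the solution to be above \<open>B\<close> everywhere
  before; there \<open>b' \<le> - b\<^sup>2 / 4\<close>, so that \<open>1 / b\<close> grows at rate \<open>1/4\<close> and exceeds \<open>\<eta> / 4\<close> after the distance
  \<open>\<eta>\<close>. Large solutions would therefore have to blow up backwards.
\<close>

lemma riccati_upper_bound:
  fixes b b' Q :: "real \<Rightarrow> real"
  assumes ax: "a + \<eta> \<le> x" and pos: "0 < \<nu>" "\<nu> \<le> 1" "\<eta> > 0" "B > 0"
    and b: "\<And>y. y \<in> {a..x} \<Longrightarrow> (b has_real_derivative b' y) (at y)"
    and ode: "\<And>y. y \<in> {a..x} \<Longrightarrow> \<nu> * b' y + b y * b y / 2 = Q y"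
    and Q: "\<And>y. y \<in> {a..x} \<Longrightarrow> 4 * Q y \<le> B * B"
  shows "b x \<le> max B (4 / \<eta>)"
proof (cases "b x \<le> B")
  case False
  have big: "b y > B" if y: "y \<in> {a..x}" for y
  proof (rule ccontr)
    assume "\<not> b y > B"
    have "B - b x \<ge> 0"
    proof (rule barrier_nonneg[of y x "\<lambda>z. (B + b z) / (2 * \<nu>)" "\<lambda>z. B - b z" "\<lambda>z. (B * B / 2 - Q z) / \<nu>"])
      show "continuous_on {y..x} (\<lambda>z. (B + b z) / (2 * \<nu>))"
      proof -
        have "isCont b z" if "z \<in> {y..x}" for z using b[of z] y that by (auto intro: DERIV_isCont)
        then show ?thesis
          using pos by (intro continuous_intros continuous_at_imp_continuous_on ballI) auto
      qed
      fix z assume z: "z \<in> {y..x}"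
      then have z': "z \<in> {a..x}" using y by auto
      have bz: "b' z = (Q z - b z * b z / 2) / \<nu>" using ode[OF z'] pos by (simp add: field_simps)
      have "(B * B / 2 - Q z) / \<nu> - (B + b z) / (2 * \<nu>) * (B - b z) = - b' z"
        unfolding bz using pos by (simp add: field_simps)
      then show "((\<lambda>z. B - b z) has_real_derivative (B * B / 2 - Q z) / \<nu> - (B + b z) / (2 * \<nu>) * (B - b z)) (at z)"
        using DERIV_diff[OF DERIV_const b[OF z'], of B] by simp
      show "0 \<le> (B * B / 2 - Q z) / \<nu>"
      proof (rule divide_nonneg_pos)
        show "0 \<le> B * B / 2 - Q z" using Q[OF z'] mult_pos_pos[OF pos(4) pos(4)] by linarith
      qed (rule pos(1))
    qed (use y \<open>\<not> b y > B\<close> in auto)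
    with False show False by simp
  qed
  have bpos: "b y > 0" if "y \<in> {a..x}" for y using big[OF that] pos by simp
  define \<phi> where "\<phi> y = inverse (b y) - y / 4" for y
  have "\<phi> a \<le> \<phi> x"
  proof (rule DERIV_nonneg_imp_nondecreasing[of a x \<phi>])
    fix y assume "a \<le> y" "y \<le> x"
    then have y: "y \<in> {a..x}" by simp
    have d: "(\<phi> has_real_derivative - (b' y * inverse (b y * b y)) - 1/4) (at y)"
      unfolding \<phi>_def[abs_def] using b[OF y] bpos[OF y]
      by (auto intro!: derivative_eq_intros simp: algebra_simps power2_eq_square)
    have "4 * Q y \<le> b y * b y"
      using Q[OF y] mult_mono[of B "b y" B "b y"] big[OF y] pos by simp
    then have "4 * (\<nu> * b' y) \<le> - (b y * b y)" using ode[OF y] by simp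
    moreover have "\<nu> * (b y * b y) \<le> 1 * (b y * b y)" using pos by (intro mult_right_mono) auto
    ultimately have "\<nu> * (4 * b' y) \<le> \<nu> * (- (b y * b y))" by (simp add: algebra_simps)
    then have "4 * b' y \<le> - (b y * b y)" using pos(1) by (simp only: mult_le_cancel_left_pos)
    then have "0 \<le> - (b' y * inverse (b y * b y)) - 1/4"
      using mult_pos_pos[OF bpos[OF y] bpos[OF y]] by (simp add: field_simps)
    with d show "\<exists>z. (\<phi> has_real_derivative z) (at y) \<and> 0 \<le> z" by blast
  qed (use ax pos in simp)
  then have "inverse (b x) \<ge> inverse (b a) + (x - a) / 4" by (simp add: \<phi>_def field_simps)
  moreover have "inverse (b a) > 0" using bpos[of a] ax pos by simp
  moreover have "u \<ge> \<eta> / 4" if "u \<ge> v + (x - a) / 4" "v > 0" for u v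
    using that ax by argo
  ultimately have "inverse (b x) \<ge> \<eta> / 4" by blast
  then have "b x \<le> 4 / \<eta>" using bpos[of x] ax pos by (simp add: field_simps)
  then show ?thesis by simp
qed simp

text \<open>
  The lower bound is the upper bound for \<open>- b (- y)\<close>, which solves an equation of the same kind.
\<close>

lemma riccati_bound:
  fixes b b' Q :: "real \<Rightarrow> real"
  assumes pos: "0 < \<nu>" "\<nu> \<le> 1" "\<eta> > 0" "B > 0"
    and b: "\<And>y. y \<in> {x - \<eta>..x + \<eta>} \<Longrightarrow> (b has_real_derivative b' y) (at y)"
    and ode: "\<And>y. y \<in> {x - \<eta>..x + \<eta>} \<Longrightarrow> \<nu> * b' y + b y * b y / 2 = Q y"
    and Q: "\<And>y. y \<in> {x - \<eta>..x + \<eta>} \<Longrightarrow> 4 * Q y \<le> B * B"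
  shows "\<bar>b x\<bar> \<le> max B (4 / \<eta>)"
proof -
  have "b x \<le> max B (4 / \<eta>)"
    by (rule riccati_upper_bound[of "x - \<eta>" \<eta> x \<nu> B b b' Q]) (use assms in auto)
  moreover have "- b (- (- x)) \<le> max B (4 / \<eta>)"
  proof (rule riccati_upper_bound[of "- x - \<eta>" \<eta> "- x" \<nu> B "\<lambda>y. - b (- y)" "\<lambda>y. b' (- y)" "\<lambda>y. Q (- y)"])
    fix y assume "y \<in> {- x - \<eta>..- x}"
    then have y: "- y \<in> {x - \<eta>..x + \<eta>}" using pos by auto
    show "((\<lambda>y. - b (- y)) has_real_derivative b' (- y)) (at y)"
      using DERIV_minus[OF DERIV_chain2[OF b[OF y] DERIV_minus[OF DERIV_ident]]] by simp
    show "\<nu> * b' (- y) + - b (- y) * - b (- y) / 2 = Q (- y)" using ode[OF y] by simp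
    show "4 * Q (- y) \<le> B * B" by (rule Q[OF y])
  qed (use pos in auto)
  ultimately show ?thesis by simp
qed

text \<open>
  As long as \<open>b\<close> is below \<open>k\<close> it grows at least at rate \<open>\<kappa> / 2\<close>, so that it reaches \<open>k\<close> within the distance \<open>\<eta>\<close>;
  after that the level \<open>k\<close> is a barrier.
\<close>

lemma riccati_lower_bound:
  fixes b b' Q :: "real \<Rightarrow> real"
  assumes ax: "a + \<eta> \<le> x" and pos: "0 < \<nu>" "\<nu> \<le> 1" "\<eta> > 0" "k > 0"
    and b: "\<And>y. y \<in> {a..x} \<Longrightarrow> (b has_real_derivative b' y) (at y)"
    and ode: "\<And>y. y \<in> {a..x} \<Longrightarrow> \<nu> * b' y + b y * b y / 2 = Q y"
    and Q: "\<And>y. y \<in> {a..x} \<Longrightarrow> \<kappa> \<le> Q y" and k: "k * k \<le> \<kappa>" "2 * k \<le> \<eta> * \<kappa>"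
    and nonneg: "\<And>y. y \<in> {a..x} \<Longrightarrow> b y \<ge> 0"
  shows "b x \<ge> k"
proof -
  have "\<exists>y\<in>{a..a + \<eta>}. b y \<ge> k"
  proof (rule ccontr)
    assume "\<not> ?thesis"
    then have small: "b y < k" if "y \<in> {a..a + \<eta>}" for y using that by force
    have "b a - \<kappa> / 2 * a \<le> b (a + \<eta>) - \<kappa> / 2 * (a + \<eta>)"
    proof (rule DERIV_nonneg_imp_nondecreasing[of a "a + \<eta>" "\<lambda>y. b y - \<kappa> / 2 * y"])
      fix y assume y0: "a \<le> y" "y \<le> a + \<eta>"
      then have y: "y \<in> {a..x}" using ax by simp
      have "b y * b y \<le> k * k" using small[of y] nonneg[OF y] y0 by (intro mult_mono) auto
      then have "\<kappa> / 2 \<le> \<nu> * b' y" using ode[OF y] Q[OF y] k(1) by linarith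
      moreover have "\<kappa> > 0" using k(1) pos mult_pos_pos[of k k] by linarith
      ultimately have "\<nu> * b' y > 0" by linarith
      from zero_less_mult_pos[OF this pos(1)] have "b' y \<ge> 0" by simp
      then have "\<nu> * b' y \<le> 1 * b' y" using pos by (intro mult_right_mono) auto
      then have "\<kappa> / 2 \<le> b' y" using \<open>\<kappa> / 2 \<le> \<nu> * b' y\<close> by linarith
      then show "\<exists>z. ((\<lambda>y. b y - \<kappa> / 2 * y) has_real_derivative z) (at y) \<and> 0 \<le> z"
        using b[OF y] by (intro exI[of _ "b' y - \<kappa> / 2"]) (auto intro!: derivative_eq_intros)
    qed (use pos in simp)
    moreover have "b a \<ge> 0" using nonneg[of a] ax pos by simp
    moreover have "\<kappa> / 2 * (a + \<eta>) = \<kappa> / 2 * a + \<eta> * \<kappa> / 2" by (simp add: algebra_simps)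
    ultimately have "k \<le> b (a + \<eta>)" using k(2) by linarith
    with small[of "a + \<eta>"] pos show False by simp
  qed
  then obtain y where y: "y \<in> {a..a + \<eta>}" "b y \<ge> k" by blast
  have "b x - k \<ge> 0"
  proof (rule barrier_nonneg[of y x "\<lambda>z. (k + b z) / (2 * \<nu>)" "\<lambda>z. b z - k" "\<lambda>z. (Q z - k * k / 2) / \<nu>"])
    show "continuous_on {y..x} (\<lambda>z. (k + b z) / (2 * \<nu>))"
    proof -
      have "isCont b z" if "z \<in> {y..x}" for z using b[of z] y that by (auto intro: DERIV_isCont)
      then show ?thesis
        using pos by (intro continuous_intros continuous_at_imp_continuous_on ballI) auto
    qed
    fix z assume "z \<in> {y..x}"
    then have z': "z \<in> {a..x}" using y by auto
    have bz: "b' z = (Q z - b z * b z / 2) / \<nu>" using ode[OF z'] pos by (simp add: field_simps)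
    have "(Q z - k * k / 2) / \<nu> - (k + b z) / (2 * \<nu>) * (b z - k) = b' z"
      unfolding bz using pos by (simp add: field_simps)
    then show "((\<lambda>z. b z - k) has_real_derivative (Q z - k * k / 2) / \<nu> - (k + b z) / (2 * \<nu>) * (b z - k)) (at z)"
      using DERIV_diff[OF b[OF z'] DERIV_const, of k] by simp
    have "k * k / 2 \<le> k * k" by simp
    then show "0 \<le> (Q z - k * k / 2) / \<nu>"
      using Q[OF z'] k(1) pos by (intro divide_nonneg_pos) (linarith, simp)
  qed (use y ax in auto)
  then show ?thesis by simp
qed

section \<open>Convergence to the right of a sign change\<close>

text \<open>
  Parameters for which the limiting Euler flow exists. On compact sets of such parameters all bounds are
  uniform.
\<close>

definition positive_params :: "(real^3) set" where
  "positive_params = {c. \<forall>t\<in>{-1..1}. P c t > 0}"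

lemma continuous_on_P: "continuous_on S (\<lambda>(c, t). P c t)"
  unfolding P_def case_prod_beta by (intro continuous_intros)

lemma P_bounds:
  assumes K: "compact K" "K \<subseteq> positive_params"
  shows "\<exists>\<kappa>>0. \<exists>M>0. \<forall>c\<in>K. \<forall>t\<in>{-1..1}. \<kappa> \<le> P c t \<and> P c t \<le> M"
proof (cases "K = {}")
  case False
  have c: "compact (K \<times> {-1..1::real})" "K \<times> {-1..1::real} \<noteq> {}"
    using K False by (auto intro: compact_Times)
  obtain z where z: "z \<in> K \<times> {-1..1}" "\<forall>y\<in>K \<times> {-1..1}. (case z of (c, t) \<Rightarrow> P c t) \<le> (case y of (c, t) \<Rightarrow> P c t)"
    using continuous_attains_inf[OF c continuous_on_P] by blast
  obtain w where w: "w \<in> K \<times> {-1..1}" "\<forall>y\<in>K \<times> {-1..1}. (case y of (c, t) \<Rightarrow> P c t) \<le> (case w of (c, t) \<Rightarrow> P c t)"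
    using continuous_attains_sup[OF c continuous_on_P] by blast
  have "P (fst z) (snd z) > 0" "P (fst w) (snd w) > 0" using z(1) w(1) K(2) by (auto simp: positive_params_def)
  moreover have "P (fst z) (snd z) \<le> P c t \<and> P c t \<le> P (fst w) (snd w)" if "c \<in> K" "t \<in> {-1..1}" for c t
    using z(2) w(2) that by (auto simp: case_prod_beta)
  ultimately show ?thesis by blast
qed (auto intro: exI[of _ 1])

lemma jointly_smooth_P: "jointly_smooth D P"
proof -
  have "jointly_smooth D (\<lambda>c x. c $ 1 * (1 - x) + c $ 2 * (1 + x) + c $ 3 * (1 - x * x))"
    by (intro jointly_smooth_add jointly_smooth_mult jointly_smooth_diff jointly_smooth_ident
        jointly_smooth_param continuous_intros)
  then show ?thesis by (simp add: P_def[abs_def] power2_eq_square)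
qed

lemma jointly_smooth_inverse:
  "jointly_smooth D f \<Longrightarrow> (\<And>p x. p \<in> D \<Longrightarrow> x \<in> {-1<..<1} \<Longrightarrow> f p x \<noteq> 0) \<Longrightarrow> jointly_smooth D (\<lambda>p x. inverse (f p x))"
  unfolding jointly_smooth_def using jointly_Ck_inverse by blast

lemma jointly_smooth_sqrt:
  "jointly_smooth D f \<Longrightarrow> (\<And>p x. p \<in> D \<Longrightarrow> x \<in> {-1<..<1} \<Longrightarrow> f p x > 0) \<Longrightarrow> jointly_smooth D (\<lambda>p x. sqrt (f p x))"
  unfolding jointly_smooth_def using jointly_Ck_sqrt by blast

lemma jointly_smooth_euler_profile: "jointly_smooth positive_params euler_profile"
proof -
  have p: "2 * P c x > 0" if "c \<in> positive_params" "x \<in> {-1<..<1}" for c x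
    using that by (auto simp: positive_params_def)
  have q: "1 - x * x \<noteq> 0" if "x \<in> {-1<..<1}" for x :: real
    using one_minus_sq_pos[OF that] by linarith
  have "jointly_smooth positive_params (\<lambda>c x. sqrt (2 * P c x) * inverse (1 - x * x))"
    by (intro jointly_smooth_mult jointly_smooth_diff jointly_smooth_ident jointly_smooth_sqrt jointly_smooth_inverse
        jointly_smooth_param continuous_intros jointly_smooth_P p q)
  then show ?thesis by (simp add: euler_profile_def[abs_def])
qed

text \<open>
  Joint continuity on a compact set of parameters times a compact interval.
\<close>

lemma jointly_smooth_bounded:
  assumes f: "jointly_smooth D f" and K: "compact K" "K \<subseteq> D" and \<eta>: "\<eta> > 0"
  shows "\<exists>L\<ge>0. \<forall>i\<le>n. \<forall>c\<in>K. \<forall>t\<in>{-1+\<eta>..1-\<eta>}. \<bar>(deriv ^^ i) (f c) t\<bar> \<le> L"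
proof -
  have one: "\<exists>L\<ge>0. \<forall>c\<in>K. \<forall>t\<in>{-1+\<eta>..1-\<eta>}. \<bar>(deriv ^^ i) (f c) t\<bar> \<le> L" for i
  proof -
    have "continuous_on (K \<times> {-1+\<eta>..1-\<eta>}) (\<lambda>(c, t). (deriv ^^ i) (f c) t)"
      by (rule continuous_on_subset[OF jointly_smooth_continuous[OF f]]) (use K \<eta> in auto)
    then have "bounded ((\<lambda>(c, t). (deriv ^^ i) (f c) t) ` (K \<times> {-1+\<eta>..1-\<eta>}))"
      using K by (intro compact_imp_bounded compact_continuous_image compact_Times) auto
    then obtain L where "\<forall>z\<in>K \<times> {-1+\<eta>..1-\<eta>}. \<bar>case z of (c, t) \<Rightarrow> (deriv ^^ i) (f c) t\<bar> \<le> L"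
      by (auto simp: bounded_iff)
    then show ?thesis by (intro exI[of _ "max L 0"]) (auto simp: le_max_iff_disj)
  qed
  show ?thesis
  proof (induction n)
    case 0 show ?case using one[of 0] by simp
  next
    case (Suc n)
  from Suc obtain L where L: "L \<ge> 0" "\<forall>i\<le>n. \<forall>c\<in>K. \<forall>t\<in>{-1+\<eta>..1-\<eta>}. \<bar>(deriv ^^ i) (f c) t\<bar> \<le> L" by blast
  from one[of "Suc n"] obtain L' where L': "L' \<ge> 0" "\<forall>c\<in>K. \<forall>t\<in>{-1+\<eta>..1-\<eta>}. \<bar>(deriv ^^ Suc n) (f c) t\<bar> \<le> L'" by blast
  show ?case
  proof (intro exI[of _ "max L L'"] conjI allI impI ballI)
    fix i c t assume "i \<le> Suc n" "c \<in> K" "t \<in> {-1+\<eta>..1-\<eta>}"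
    then show "\<bar>(deriv ^^ i) (f c) t\<bar> \<le> max L L'"
      using L L' by (cases "i = Suc n") (auto simp: le_max_iff_disj simp del: funpow.simps)
  qed (use L in simp)
  qed
qed

lemma riccatiD:
  assumes "riccati c \<nu> b" "t \<in> {-1<..<1}"
  shows "\<nu> * deriv b t + b t * b t / 2 = P c t / (1 - t * t)\<^sup>2"
proof -
  have "(1 - t * t)\<^sup>2 * (\<nu> * deriv b t + b t * b t / 2) = P c t"
    using assms by (simp add: riccati_def)
  then show ?thesis using one_minus_sq_pos[OF assms(2)] by (simp add: eq_divide_eq mult.commute)
qed

lemma euler_profile_sq:
  assumes "c \<in> positive_params" "t \<in> {-1<..<1}"
  shows "euler_profile c t * euler_profile c t / 2 = P c t / (1 - t * t)\<^sup>2" "euler_profile c t > 0"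
proof -
  have "P c t > 0" using assms by (auto simp: positive_params_def)
  then have "sqrt (2 * P c t) * sqrt (2 * P c t) = 2 * P c t" "sqrt (2 * P c t) > 0" by simp_all
  moreover have "1 - t * t > 0" by (rule one_minus_sq_pos[OF assms(2)])
  moreover have "(q * inverse w) * (q * inverse w) / 2 = p / w\<^sup>2" if "q * q = 2 * p" "w > 0" for q w p :: real
  proof -
    have "(q * inverse w) * (q * inverse w) / 2 = (q * q) / (2 * w\<^sup>2)"
      using that(2) by (simp add: power2_eq_square field_simps)
    then show ?thesis unfolding that(1) by simp
  qed
  ultimately show "euler_profile c t * euler_profile c t / 2 = P c t / (1 - t * t)\<^sup>2" "euler_profile c t > 0"
    unfolding euler_profile_def by (blast, simp)
qed

lemma riccati_rhs_bounds:
  assumes "t \<in> {-1<..<1}" "0 < \<kappa>" "\<kappa> \<le> P c t"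
  shows "\<kappa> \<le> P c t / (1 - t * t)\<^sup>2"
    and "P c t \<le> M \<Longrightarrow> 0 < \<eta> \<Longrightarrow> \<eta> \<le> 1 \<Longrightarrow> t \<in> {-1+\<eta>..1-\<eta>} \<Longrightarrow> P c t / (1 - t * t)\<^sup>2 \<le> M / \<eta>\<^sup>2"
proof -
  have p: "0 < 1 - t * t" by (rule one_minus_sq_pos[OF assms(1)])
  then have "(1 - t * t)\<^sup>2 \<le> 1" using abs_square_le_1[of "1 - t * t"] by auto
  then have "P c t / 1 \<le> P c t / (1 - t * t)\<^sup>2" using p assms by (intro divide_left_mono) auto
  then show "\<kappa> \<le> P c t / (1 - t * t)\<^sup>2" using assms by simp
  assume M: "P c t \<le> M" and \<eta>: "0 < \<eta>" "\<eta> \<le> 1" "t \<in> {-1+\<eta>..1-\<eta>}"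
  have "0 \<le> (1 - \<eta> - t) * (1 - \<eta> + t)" using \<eta> by (intro mult_nonneg_nonneg) auto
  moreover have "\<eta> * \<eta> \<le> \<eta> * 1" using \<eta> by (intro mult_left_mono) auto
  ultimately have "\<eta> \<le> 1 - t * t" by (simp add: algebra_simps)
  then have "\<eta>\<^sup>2 \<le> (1 - t * t)\<^sup>2" using \<eta> by (intro power_mono) auto
  then show "P c t / (1 - t * t)\<^sup>2 \<le> M / \<eta>\<^sup>2" using M assms \<eta> by (intro frac_le) auto
qed

lemma binomial_sum_bound:
  assumes "S \<subseteq> {..n}" "\<And>k. k \<in> S \<Longrightarrow> \<bar>u k\<bar> \<le> U" "\<And>k. k \<in> S \<Longrightarrow> \<bar>v k\<bar> \<le> V" "0 \<le> U" "0 \<le> V"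
  shows "\<bar>\<Sum>k\<in>S. real (n choose k) * u k * v k\<bar> \<le> 2 ^ n * (U * V)"
proof -
  have "\<bar>\<Sum>k\<in>S. real (n choose k) * u k * v k\<bar> \<le> (\<Sum>k\<in>S. real (n choose k) * (U * V))"
  proof (rule order_trans[OF sum_abs sum_mono])
    fix k assume k: "k \<in> S"
    have "\<bar>u k\<bar> * \<bar>v k\<bar> \<le> U * V" by (intro mult_mono assms k) (auto simp: assms)
    then show "\<bar>real (n choose k) * u k * v k\<bar> \<le> real (n choose k) * (U * V)"
      by (simp add: abs_mult mult.assoc mult_left_mono)
  qed
  also have "\<dots> \<le> (\<Sum>k\<le>n. real (n choose k) * (U * V))"
    by (rule sum_mono2) (use assms in auto)
  also have "\<dots> = real (\<Sum>k\<le>n. n choose k) * (U * V)" by (simp add: sum_distrib_right)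
  also have "\<dots> = 2 ^ n * (U * V)" by (simp add: choose_row_sum)
  finally show ?thesis .
qed

text \<open>
  The quantity to be shown \<open>O(\<nu>)\<close> together with all its derivatives.
\<close>

definition deviation :: "real^3 \<Rightarrow> (real \<Rightarrow> real) \<Rightarrow> real \<Rightarrow> real" where
  "deviation c b t = b t - euler_profile c t"

lemma smooth_euler_profile: "c \<in> positive_params \<Longrightarrow> smooth (euler_profile c)"
  by (rule jointly_smooth_imp_smooth[OF jointly_smooth_euler_profile])

lemma smooth_deviation: "c \<in> positive_params \<Longrightarrow> smooth b \<Longrightarrow> smooth (deviation c b)"
  unfolding deviation_def[abs_def] by (intro smooth_diff smooth_euler_profile)

text \<open>
  Subtracting the equations for \<open>b\<close> and \<open>\<beta>\<close> gives \<open>\<nu> E' = - \<beta> E - E\<^sup>2 / 2 - \<nu> \<beta>'\<close>, which is differentiated \<open>j\<close> times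
  by the Leibniz rule.
\<close>

lemma deviation_ode:
  assumes c: "c \<in> positive_params" and b: "smooth b" and r: "riccati c \<nu> b" and t: "t \<in> {-1<..<1}"
  defines "E \<equiv> deviation c b" and "\<beta> \<equiv> euler_profile c"
  shows "\<nu> * (deriv ^^ Suc j) E t = - (\<Sum>k\<le>j. real (j choose k) * (deriv ^^ k) \<beta> t * (deriv ^^ (j - k)) E t)
     - 1/2 * (\<Sum>k\<le>j. real (j choose k) * (deriv ^^ k) E t * (deriv ^^ (j - k)) E t) - \<nu> * (deriv ^^ Suc j) \<beta> t"
proof -
  have \<beta>: "smooth \<beta>" unfolding \<beta>_def by (rule smooth_euler_profile[OF c])
  have E: "smooth E" unfolding E_def by (rule smooth_deviation[OF c b])
  have eq: "- 1 * (\<beta> s * E s) - 1/2 * (E s * E s) - \<nu> * deriv \<beta> s = \<nu> * deriv E s" if s: "s \<in> {-1<..<1}" for s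
  proof -
    have "deriv E s = deriv b s - deriv \<beta> s"
      using higher_deriv_diff[OF b \<beta> s, of 1] by (simp add: E_def deviation_def[abs_def] \<beta>_def)
    moreover have "\<nu> * deriv b s = \<beta> s * \<beta> s / 2 - b s * b s / 2"
      using riccatiD[OF r s] euler_profile_sq(1)[OF c s] by (simp add: \<beta>_def)
    ultimately have "\<nu> * deriv E s = \<beta> s * \<beta> s / 2 - b s * b s / 2 - \<nu> * deriv \<beta> s"
      by (simp add: right_diff_distrib)
    then show ?thesis by (simp add: E_def deviation_def \<beta>_def algebra_simps)
  qed
  note sm = smooth_mult[OF \<beta> E] smooth_mult[OF E E] smooth_deriv[OF \<beta>] smooth_deriv[OF E]
  have "\<nu> * (deriv ^^ Suc j) E t = (deriv ^^ j) (\<lambda>s. \<nu> * deriv E s) t"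
    by (simp only: higher_deriv_cmult[OF sm(4) t] higher_deriv_deriv)
  also have "\<dots> = (deriv ^^ j) (\<lambda>s. - 1 * (\<beta> s * E s) - 1/2 * (E s * E s) - \<nu> * deriv \<beta> s) t"
    by (rule higher_deriv_cong[symmetric, OF smooth_cmult[OF sm(4)] eq[symmetric] t]) 
  also have "\<dots> = - 1 * (deriv ^^ j) (\<lambda>s. \<beta> s * E s) t - 1/2 * (deriv ^^ j) (\<lambda>s. E s * E s) t - \<nu> * (deriv ^^ j) (deriv \<beta>) t"
    by (simp only: higher_deriv_diff higher_deriv_cmult smooth_diff smooth_cmult sm t)
  finally show ?thesis
    by (simp only: higher_deriv_mult[OF \<beta> E t] higher_deriv_mult[OF E E t] higher_deriv_deriv)
qed

text \<open>
  To the right of a point where it is nonnegative, a solution is attracted by \<open>+\<beta>\<close>. The sign condition on an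
  open interval includes \<open>x1 = -1\<close>, the case of a globally positive solution.
\<close>

definition right_branch :: "(real^3) set \<Rightarrow> real^3 \<Rightarrow> real \<Rightarrow> (real \<Rightarrow> real) \<Rightarrow> real \<Rightarrow> bool" where
  "right_branch K c \<nu> b x1 \<longleftrightarrow> c \<in> K \<and> 0 < \<nu> \<and> \<nu> \<le> 1 \<and> smooth b \<and> riccati c \<nu> b \<and> -1 \<le> x1 \<and> (\<forall>y\<in>{x1<..<1}. 0 \<le> b y)"

lemma right_branch_bounds:
  assumes K: "compact K" "K \<subseteq> positive_params" and \<eta>: "0 < \<eta>" "\<eta> \<le> 1"
  shows "\<exists>k>0. \<exists>B. \<forall>c \<nu> b x1 x. right_branch K c \<nu> b x1 \<longrightarrow> x1 + \<eta> \<le> x \<longrightarrow> x \<le> 1 - \<eta> \<longrightarrow> k \<le> b x \<and> b x \<le> B"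
proof -
  obtain \<kappa> M where \<kappa>: "\<kappa> > 0" "M > 0" "\<forall>c\<in>K. \<forall>t\<in>{-1..1}. \<kappa> \<le> P c t \<and> P c t \<le> M"
    using P_bounds[OF K] by blast
  \<comment> \<open>The last entry is the distance \<open>\<eta> / 2\<close> times \<open>\<kappa>\<close>, halved: half of the distance to \<open>x1\<close> is spent on
    leaving the end point, where \<open>b\<close> is not controlled, and the other half on reaching the level \<open>k\<close>.\<close>
  define k where "k = min 1 (min \<kappa> (\<eta> * \<kappa> / 4))"
  have k: "k > 0" "k * k \<le> \<kappa>" "2 * k \<le> \<eta> / 2 * \<kappa>"
  proof -
    show "k > 0" using \<kappa> \<eta> by (simp add: k_def)
    moreover have k1: "k \<le> 1" "k \<le> \<kappa>" "k \<le> \<eta> * \<kappa> / 4" by (simp_all add: k_def)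
    ultimately have "k * k \<le> 1 * \<kappa>" by (intro mult_mono) auto
    then show "k * k \<le> \<kappa>" by simp
    show "2 * k \<le> \<eta> / 2 * \<kappa>" using k1(3) by simp
  qed
  \<comment> \<open>\<open>riccati_bound\<close> looks at a neighbourhood of radius \<open>\<eta> / 2\<close>, which stays away from the poles.\<close>
  define B where "B = sqrt (4 * (M / (\<eta> / 2)\<^sup>2))"
  have B: "B > 0" "B * B = 4 * (M / (\<eta> / 2)\<^sup>2)" using \<kappa> \<eta> by (simp_all add: B_def)
  show ?thesis
  proof (rule exI[of _ k], rule conjI[OF k(1)], rule exI[of _ "max B (4 / (\<eta> / 2))"], intro allI impI conjI)
    fix c \<nu> b x1 x assume rb: "right_branch K c \<nu> b x1" and x: "x1 + \<eta> \<le> x" "x \<le> 1 - \<eta>"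
    note rb' = rb[unfolded right_branch_def]
    have PP: "\<kappa> \<le> P c t" "P c t \<le> M" if "t \<in> {-1<..<1}" for t
      using \<kappa>(3) rb' that by auto
    have sub: "y \<in> {-1<..<1}" if "y \<in> {x1 + \<eta> / 2..x}" for y using that rb' x \<eta> by auto
    show "k \<le> b x"
    proof (rule riccati_lower_bound[of "x1 + \<eta> / 2" "\<eta> / 2" x \<nu> k b "deriv b" "\<lambda>t. P c t / (1 - t * t)\<^sup>2" \<kappa>])
      fix y assume y: "y \<in> {x1 + \<eta> / 2..x}"
      show "(b has_real_derivative deriv b y) (at y)" using smooth_DERIV sub[OF y] rb' by blast
      show "\<nu> * deriv b y + b y * b y / 2 = P c y / (1 - y * y)\<^sup>2" using riccatiD sub[OF y] rb' by blast
      show "\<kappa> \<le> P c y / (1 - y * y)\<^sup>2" using riccati_rhs_bounds(1)[OF sub[OF y] \<kappa>(1) PP(1)[OF sub[OF y]]] .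
      show "0 \<le> b y" using rb' y x \<eta> by auto
    qed (use rb' x \<eta> k in auto)
    have "x - \<eta> / 2 \<le> y \<Longrightarrow> y \<le> x + \<eta> / 2 \<Longrightarrow> y \<in> {-1+\<eta>/2..1-\<eta>/2} \<and> y \<in> {-1<..<1}" for y
      using rb' x \<eta> by auto
    then have sub2: "y \<in> {-1+\<eta>/2..1-\<eta>/2}" "y \<in> {-1<..<1}" if "y \<in> {x - \<eta> / 2..x + \<eta> / 2}" for y using that by auto
    have "\<bar>b x\<bar> \<le> max B (4 / (\<eta> / 2))"
    proof (rule riccati_bound[of \<nu> "\<eta> / 2" B x b "deriv b" "\<lambda>t. P c t / (1 - t * t)\<^sup>2"])
      fix y assume y: "y \<in> {x - \<eta> / 2..x + \<eta> / 2}"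
      show "(b has_real_derivative deriv b y) (at y)" using smooth_DERIV sub2(2)[OF y] rb' by blast
      show "\<nu> * deriv b y + b y * b y / 2 = P c y / (1 - y * y)\<^sup>2" using riccatiD sub2(2)[OF y] rb' by blast
      have "P c y / (1 - y * y)\<^sup>2 \<le> M / (\<eta> / 2)\<^sup>2"
        by (rule riccati_rhs_bounds(2)[OF sub2(2)[OF y] \<kappa>(1)]) (use PP sub2[OF y] \<eta> in auto)
      then show "4 * (P c y / (1 - y * y)\<^sup>2) \<le> B * B" unfolding B(2) by simp
    qed (use rb' \<eta> B in auto)
    then show "b x \<le> max B (4 / (\<eta> / 2))" by simp
  qed
qed

text \<open>
  Induction on the order of the derivative \<open>E\<^sub>j\<close> of the deviation \<open>E\<close>, at each step moving away from \<open>x1\<close> and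
  from the poles by half of the distance \<open>\<eta>\<close>. Two facts are needed for \<open>fast_decay_bound\<close>. First, \<open>E\<^sub>j\<close> is
  bounded: for \<open>j = 0\<close> since \<open>b\<close> is, and for \<open>j > 0\<close> since the equation of order \<open>j - 1\<close> expresses \<open>\<nu> E\<^sub>j\<close> by
  quantities that are \<open>O(\<nu>)\<close> by induction. Second, \<open>\<nu> E\<^sub>j' = - A E\<^sub>j + O(\<nu>)\<close> with \<open>A\<close> bounded below: for \<open>j = 0\<close> with
  \<open>A = (b + \<beta>) / 2\<close>, and for \<open>j > 0\<close> with \<open>A = \<beta> + E = b\<close>, since the quadratic term contributes \<open>E E\<^sub>j\<close> twice and
  all other terms contain lower derivatives only.
\<close>

lemma deviation_estimate:
  assumes K: "compact K" "K \<subseteq> positive_params"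
  shows "0 < \<eta> \<Longrightarrow> \<eta> \<le> 1 \<Longrightarrow> \<exists>C\<ge>0. \<forall>c \<nu> b x1 x. right_branch K c \<nu> b x1 \<longrightarrow> x1 + \<eta> \<le> x \<longrightarrow> x \<le> 1 - \<eta> \<longrightarrow>
     \<bar>(deriv ^^ j) (deviation c b) x\<bar> \<le> C * \<nu>"
proof (induction j arbitrary: \<eta> rule: less_induct)
  case (less j)
  define \<delta> where "\<delta> = \<eta> / 2"
  have \<delta>: "0 < \<delta>" "\<delta> \<le> 1" using less.prems by (simp_all add: \<delta>_def)
  define R where "R c \<nu> b x1 y \<longleftrightarrow> right_branch K c \<nu> b x1 \<and> x1 + \<delta> \<le> y \<and> y \<le> 1 - \<delta>" for c \<nu> b x1 y
  obtain k B where k: "k > 0" and kB': "\<forall>c \<nu> b x1 y. right_branch K c \<nu> b x1 \<longrightarrow> x1 + \<delta> \<le> y \<longrightarrow> y \<le> 1 - \<delta> \<longrightarrow> k \<le> b y \<and> b y \<le> B"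
    using right_branch_bounds[OF K \<delta>] by (elim exE conjE) (rule that)
  have kB: "k \<le> b y \<and> b y \<le> B" if "R c \<nu> b x1 y" for c \<nu> b x1 y
    using kB'[rule_format, of c \<nu> b x1 y] that unfolding R_def by simp
  obtain L where L: "L \<ge> 0" and "\<forall>i\<le>Suc j. \<forall>c\<in>K. \<forall>t\<in>{-1+\<delta>..1-\<delta>}. \<bar>(deriv ^^ i) (euler_profile c) t\<bar> \<le> L"
    using jointly_smooth_bounded[OF jointly_smooth_euler_profile K \<delta>(1), of "Suc j"] by (elim exE conjE) (rule that)
  note L' = this(2)[rule_format]
  have "\<exists>C. i < j \<longrightarrow> C \<ge> 0 \<and> (\<forall>c \<nu> b x1 y. R c \<nu> b x1 y \<longrightarrow> \<bar>(deriv ^^ i) (deviation c b) y\<bar> \<le> C * \<nu>)" for i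
  proof (cases "i < j")
    case True
    from less.IH[OF this \<delta>] show ?thesis
      unfolding R_def by (elim ex_forward conjE) (intro conjI allI impI; (simp; fail | blast))
  qed simp
  then have "\<forall>i. \<exists>C. i < j \<longrightarrow> C \<ge> 0 \<and> (\<forall>c \<nu> b x1 y. R c \<nu> b x1 y \<longrightarrow> \<bar>(deriv ^^ i) (deviation c b) y\<bar> \<le> C * \<nu>)" ..
  then obtain Cs where Cs: "\<forall>i. i < j \<longrightarrow> Cs i \<ge> 0 \<and> (\<forall>c \<nu> b x1 y. R c \<nu> b x1 y \<longrightarrow> \<bar>(deriv ^^ i) (deviation c b) y\<bar> \<le> Cs i * \<nu>)"
    by (rule choice[THEN exE])
  define C where "C = (\<Sum>i<j. Cs i)"
  have C: "C \<ge> 0" unfolding C_def by (rule sum_nonneg) (use Cs in auto)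
  have R: "c \<in> K" "c \<in> positive_params" "0 < \<nu>" "\<nu> \<le> 1" "smooth b" "riccati c \<nu> b" "-1 \<le> x1" "y \<in> {-1+\<delta>..1-\<delta>}" "y \<in> {-1<..<1}"
    if "R c \<nu> b x1 y" for c \<nu> b x1 y
    using that K(2) \<delta> unfolding R_def right_branch_def by auto
  have low: "\<bar>(deriv ^^ i) (deviation c b) y\<bar> \<le> C * \<nu>" if "i < j" "R c \<nu> b x1 y" for i c \<nu> b x1 y
  proof -
    have "\<bar>(deriv ^^ i) (deviation c b) y\<bar> \<le> Cs i * \<nu>" using Cs that by blast
    also have "\<dots> \<le> C * \<nu>"
      unfolding C_def by (intro mult_right_mono member_le_sum) (use that Cs R(3)[OF that(2)] in auto)
    finally show ?thesis .
  qed
  have CC: "C * \<nu> * (C * \<nu>) \<le> C * C * \<nu>" if "0 < \<nu>" "\<nu> \<le> 1" for \<nu>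
  proof -
    have "C * C * \<nu> * \<nu> \<le> C * C * \<nu> * 1" using that C by (intro mult_left_mono) auto
    then show ?thesis by (simp add: mult_ac)
  qed
  \<comment> \<open>The bound at the starting point of the decay.\<close>
  have "\<exists>M. \<forall>c \<nu> b x1 y. R c \<nu> b x1 y \<longrightarrow> \<bar>(deriv ^^ j) (deviation c b) y\<bar> \<le> M"
  proof (cases j)
    case 0
    show ?thesis
    proof (intro exI[of _ "max B 0 + L"] allI impI)
      fix c \<nu> b x1 y assume r: "R c \<nu> b x1 y"
      have "\<bar>euler_profile c y\<bar> \<le> L" using L'[of 0 c y] R[OF r] by simp
      then show "\<bar>(deriv ^^ j) (deviation c b) y\<bar> \<le> max B 0 + L"
        using kB[OF r, THEN conjunct1] kB[OF r, THEN conjunct2] k by (simp add: 0 deviation_def)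
    qed
  next
    case (Suc i)
    define M where "M = 2 ^ i * (L * C) + 1/2 * (2 ^ i * (C * C)) + L"
    show ?thesis
    proof (intro exI[of _ M] allI impI)
      fix c \<nu> b x1 y assume r: "R c \<nu> b x1 y"
      note r' = R[OF r]
      have l: "\<bar>(deriv ^^ l) (deviation c b) y\<bar> \<le> C * \<nu>" if "l \<le> i" for l
        by (rule low[OF _ r]) (use that Suc in simp)
      have Cn: "0 \<le> C * \<nu>" using C r' by simp
      have 1: "\<bar>\<Sum>l\<le>i. real (i choose l) * (deriv ^^ l) (euler_profile c) y * (deriv ^^ (i - l)) (deviation c b) y\<bar> \<le> 2 ^ i * (L * (C * \<nu>))"
        by (rule binomial_sum_bound) (use l L' L Cn r' Suc in auto)
      have "\<bar>\<Sum>l\<le>i. real (i choose l) * (deriv ^^ l) (deviation c b) y * (deriv ^^ (i - l)) (deviation c b) y\<bar> \<le> 2 ^ i * (C * \<nu> * (C * \<nu>))"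
        by (rule binomial_sum_bound) (use l Cn in auto)
      also have "\<dots> \<le> 2 ^ i * (C * C * \<nu>)" using CC[OF r'(3,4)] by simp
      finally have 2: "\<bar>\<Sum>l\<le>i. real (i choose l) * (deriv ^^ l) (deviation c b) y * (deriv ^^ (i - l)) (deviation c b) y\<bar> \<le> 2 ^ i * (C * C * \<nu>)" .
      have "\<bar>(deriv ^^ Suc i) (euler_profile c) y\<bar> \<le> L" using L'[of "Suc i"] r' Suc by simp
      then have "\<nu> * \<bar>(deriv ^^ Suc i) (euler_profile c) y\<bar> \<le> \<nu> * L" using r' by (intro mult_left_mono) auto
      then have 3: "\<bar>\<nu> * (deriv ^^ Suc i) (euler_profile c) y\<bar> \<le> \<nu> * L" using r'(3) by (simp add: abs_mult del: funpow.simps)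
      have "\<bar>\<nu> * (deriv ^^ Suc i) (deviation c b) y\<bar> \<le> \<nu> * M"
        unfolding deviation_ode[OF r'(2,5,6,9)] M_def
        using 1 2 3 by (simp add: algebra_simps abs_le_iff del: funpow.simps) 
      then show "\<bar>(deriv ^^ j) (deviation c b) y\<bar> \<le> M" using r'(3) by (simp add: Suc abs_mult del: funpow.simps)
    qed
  qed
  then obtain M where "\<forall>c \<nu> b x1 y. R c \<nu> b x1 y \<longrightarrow> \<bar>(deriv ^^ j) (deviation c b) y\<bar> \<le> M" ..
  note M = this[rule_format]
  \<comment> \<open>The damping \<open>A\<close> may depend on the solution and on the point; only its lower bound \<open>k/2\<close> matters.\<close>
  have "\<exists>G. \<forall>c \<nu> b x1 y. R c \<nu> b x1 y \<longrightarrow> (\<exists>A\<ge>k/2.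
     \<bar>\<nu> * (deriv ^^ Suc j) (deviation c b) y + A * (deriv ^^ j) (deviation c b) y\<bar> \<le> G * \<nu>)"
  proof (cases j)
    case 0
    show ?thesis
    proof (rule exI[of _ L], intro allI impI)
      fix c \<nu> b x1 y assume r: "R c \<nu> b x1 y"
      note r' = R[OF r]
      have "\<bar>(deriv ^^ Suc 0) (euler_profile c) y\<bar> \<le> L" using L'[of "Suc 0"] r' by simp
      then have "\<nu> * \<bar>(deriv ^^ Suc 0) (euler_profile c) y\<bar> \<le> \<nu> * L" using r' by (intro mult_left_mono) auto
      then have 3: "\<bar>\<nu> * deriv (euler_profile c) y\<bar> \<le> L * \<nu>" using r'(3) by (simp add: abs_mult mult.commute)
      have "\<nu> * deriv (deviation c b) y + (b y + euler_profile c y) / 2 * deviation c b y = - (\<nu> * deriv (euler_profile c) y)"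
        using deviation_ode[OF r'(2,5,6,9), of 0] by (simp add: deviation_def field_simps)
      then show "\<exists>A\<ge>k/2. \<bar>\<nu> * (deriv ^^ Suc j) (deviation c b) y + A * (deriv ^^ j) (deviation c b) y\<bar> \<le> L * \<nu>"
        using 3 kB[OF r] euler_profile_sq(2)[OF r'(2,9)]
        by (intro exI[of _ "(b y + euler_profile c y) / 2"]) (simp add: 0)
    qed
  next
    case (Suc i)
    define G where "G = 2 ^ j * (L * C) + 1/2 * (2 ^ j * (C * C)) + L"
    show ?thesis
    proof (rule exI[of _ G], intro allI impI)
      fix c \<nu> b x1 y assume r: "R c \<nu> b x1 y"
      note r' = R[OF r]
      let ?E = "\<lambda>l. (deriv ^^ l) (deviation c b) y" and ?b = "\<lambda>l. (deriv ^^ l) (euler_profile c) y"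
      have l: "\<bar>?E l\<bar> \<le> C * \<nu>" if "l < j" for l
        by (rule low[OF that r])
      have Cn: "0 \<le> C * \<nu>" using C r' by simp
      have 1: "\<bar>\<Sum>l\<in>{1..j}. real (j choose l) * ?b l * ?E (j - l)\<bar> \<le> 2 ^ j * (L * (C * \<nu>))"
        by (rule binomial_sum_bound) (use l L' L Cn r' in auto)
      have "\<bar>\<Sum>l\<in>{1..<j}. real (j choose l) * ?E l * ?E (j - l)\<bar> \<le> 2 ^ j * (C * \<nu> * (C * \<nu>))"
        by (rule binomial_sum_bound) (use l Cn in auto)
      also have "\<dots> \<le> 2 ^ j * (C * C * \<nu>)" using CC[OF r'(3,4)] by simp
      finally have 2: "\<bar>\<Sum>l\<in>{1..<j}. real (j choose l) * ?E l * ?E (j - l)\<bar> \<le> 2 ^ j * (C * C * \<nu>)" .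
      have "\<bar>?b (Suc j)\<bar> \<le> L" using L'[of "Suc j"] r' by simp
      then have "\<nu> * \<bar>?b (Suc j)\<bar> \<le> \<nu> * L" using r' by (intro mult_left_mono) auto
      then have 3: "\<bar>\<nu> * ?b (Suc j)\<bar> \<le> \<nu> * L" using r'(3) by (simp add: abs_mult del: funpow.simps)
      have s1: "{..j} = insert 0 {1..j}" and s2: "{..j} = insert 0 (insert j {1..<j})" using Suc by auto
      have e1: "(\<Sum>l\<le>j. real (j choose l) * ?b l * ?E (j - l)) = ?b 0 * ?E j + (\<Sum>l\<in>{1..j}. real (j choose l) * ?b l * ?E (j - l))"
        unfolding s1 by (subst sum.insert) auto
      have e2: "(\<Sum>l\<le>j. real (j choose l) * ?E l * ?E (j - l)) = 2 * (?E 0 * ?E j) + (\<Sum>l\<in>{1..<j}. real (j choose l) * ?E l * ?E (j - l))"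
        unfolding s2 using Suc by (subst sum.insert; (subst sum.insert)?) (auto simp: algebra_simps simp del: funpow.simps) 
      have "\<nu> * ?E (Suc j) + b y * ?E j = - (\<Sum>l\<in>{1..j}. real (j choose l) * ?b l * ?E (j - l))
          - 1/2 * (\<Sum>l\<in>{1..<j}. real (j choose l) * ?E l * ?E (j - l)) - \<nu> * ?b (Suc j)"
        unfolding deviation_ode[OF r'(2,5,6,9)] e1 e2
        by (simp add: deviation_def algebra_simps del: funpow.simps add: funpow_0)
      then have "\<bar>\<nu> * ?E (Suc j) + b y * ?E j\<bar> \<le> G * \<nu>"
        unfolding G_def using 1 2 3 by (simp add: algebra_simps abs_le_iff del: funpow.simps) 
      then show "\<exists>A\<ge>k/2. \<bar>\<nu> * ?E (Suc j) + A * ?E j\<bar> \<le> G * \<nu>"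
        using kB[OF r] k by (intro exI[of _ "b y"]) auto
    qed
  qed
  then obtain G where "\<forall>c \<nu> b x1 y. R c \<nu> b x1 y \<longrightarrow> (\<exists>A\<ge>k/2.
     \<bar>\<nu> * (deriv ^^ Suc j) (deviation c b) y + A * (deriv ^^ j) (deviation c b) y\<bar> \<le> G * \<nu>)" ..
  note G = this[rule_format]
  define C' where "C' = sqrt ((G / (k/2))\<^sup>2 + 2 * M\<^sup>2 / ((k/2) * \<delta>)\<^sup>2)"
  show ?case
  proof (intro exI[of _ C'] conjI allI impI)
    show "0 \<le> C'" by (simp add: C'_def)
    fix c \<nu> b x1 x assume rb: "right_branch K c \<nu> b x1" and x: "x1 + \<eta> \<le> x" "x \<le> 1 - \<eta>"
    have r: "R c \<nu> b x1 y" if "y \<in> {x - \<delta>..x}" for y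
      unfolding R_def using rb x that \<delta> by (auto simp: \<delta>_def)
    have "x \<in> {x - \<delta>..x}" using \<delta> by simp
    note r' = R[OF r[OF this]]
    let ?E = "\<lambda>l. (deriv ^^ l) (deviation c b)"
    have "\<forall>y\<in>{x - \<delta>..x}. \<exists>A. A \<ge> k / 2 \<and> \<bar>\<nu> * ?E (Suc j) y + A * ?E j y\<bar> \<le> G * \<nu>"
      using G[OF r] by blast
    then obtain A where "\<forall>y\<in>{x - \<delta>..x}. A y \<ge> k / 2 \<and> \<bar>\<nu> * ?E (Suc j) y + A y * ?E j y\<bar> \<le> G * \<nu>"
      by (rule bchoice[THEN exE])
    note A = this[rule_format]
    show "\<bar>?E j x\<bar> \<le> C' * \<nu>"
      unfolding C'_def
    proof (rule fast_decay_bound[of "x - \<delta>" \<delta> x \<nu> "k/2" "?E j" "?E (Suc j)" A "\<lambda>y. \<nu> * ?E (Suc j) y + A y * ?E j y"])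
      fix y assume y: "y \<in> {x - \<delta>..x}"
      show "(?E j has_real_derivative ?E (Suc j) y) (at y)"
        by (rule smooth_has_derivative[OF smooth_deviation[OF r'(2,5)] R(9)[OF r[OF y]]])
    qed (use A k \<delta> r' M[OF r] in auto)
  qed
qed

section \<open>Hypergeometric series\<close>

text \<open>
  The Taylor coefficients of the Gauss hypergeometric function with parameters \<open>A\<close>, \<open>B\<close>, \<open>\<gamma>\<close>, where \<open>\<sigma> = A + B\<close>
  and \<open>\<tau> = A B\<close>. Written in \<open>\<sigma>\<close> and \<open>\<tau>\<close> the coefficients are visibly nonnegative, although \<open>A\<close> and \<open>B\<close> may be a
  pair of complex conjugates.
\<close>

primrec hypgeo_coeff :: "real \<Rightarrow> real \<Rightarrow> real \<Rightarrow> nat \<Rightarrow> real" where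
  "hypgeo_coeff \<sigma> \<tau> \<gamma> 0 = 1"
| "hypgeo_coeff \<sigma> \<tau> \<gamma> (Suc n) = ((real n)\<^sup>2 + \<sigma> * real n + \<tau>) / ((real n + 1) * (real n + \<gamma>)) * hypgeo_coeff \<sigma> \<tau> \<gamma> n"

definition hypgeo :: "real \<Rightarrow> real \<Rightarrow> real \<Rightarrow> real \<Rightarrow> real" where
  "hypgeo \<sigma> \<tau> \<gamma> y = (\<Sum>n. hypgeo_coeff \<sigma> \<tau> \<gamma> n * y ^ n)"

definition hypgeo' :: "real \<Rightarrow> real \<Rightarrow> real \<Rightarrow> real \<Rightarrow> real" where
  "hypgeo' \<sigma> \<tau> \<gamma> y = (\<Sum>n. diffs (hypgeo_coeff \<sigma> \<tau> \<gamma>) n * y ^ n)"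

definition hypgeo'' :: "real \<Rightarrow> real \<Rightarrow> real \<Rightarrow> real \<Rightarrow> real" where
  "hypgeo'' \<sigma> \<tau> \<gamma> y = (\<Sum>n. diffs (diffs (hypgeo_coeff \<sigma> \<tau> \<gamma>)) n * y ^ n)"

lemma hypgeo_coeff_nonneg: "0 \<le> \<sigma> \<Longrightarrow> 0 \<le> \<tau> \<Longrightarrow> 1 \<le> \<gamma> \<Longrightarrow> 0 \<le> hypgeo_coeff \<sigma> \<tau> \<gamma> n"
  by (induction n) auto

text \<open>
  The majorant for all parameters near a given one; it is itself a series of the same kind and hence converges
  for \<open>|y| < 1\<close>.
\<close>

lemma hypgeo_coeff_mono:
  assumes "0 \<le> \<sigma>" "\<sigma> \<le> S" "0 \<le> \<tau>" "\<tau> \<le> T" "1 \<le> \<gamma>"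
  shows "hypgeo_coeff \<sigma> \<tau> \<gamma> n \<le> hypgeo_coeff S T 1 n"
proof (induction n)
  case (Suc n)
  have "((real n)\<^sup>2 + \<sigma> * real n + \<tau>) / ((real n + 1) * (real n + \<gamma>)) \<le> ((real n)\<^sup>2 + S * real n + T) / ((real n + 1) * (real n + 1))"
    by (intro frac_le add_mono mult_right_mono mult_left_mono) (use assms in auto)
  then show ?case unfolding hypgeo_coeff.simps
    by (intro mult_mono Suc hypgeo_coeff_nonneg divide_nonneg_nonneg) (use assms in auto)
qed simp

lemma summable_hypgeo_coeff:
  assumes "0 \<le> \<sigma>" "0 \<le> \<tau>" "1 \<le> \<gamma>" "norm y < 1"
  shows "summable (\<lambda>n. hypgeo_coeff \<sigma> \<tau> \<gamma> n * y ^ n)"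
proof -
  \<comment> \<open>The ratio of consecutive coefficients tends to \<open>1\<close>, so any number strictly between \<open>|y|\<close> and \<open>1\<close> works.\<close>
  define q where "q = (1 + norm y) / 2"
  have q: "norm y < q" "q < 1" using assms(4) by (auto simp: q_def)
  have "(\<lambda>n. ((real n)\<^sup>2 + \<sigma> * real n + \<tau>) / ((real n + 1) * (real n + \<gamma>)) * norm y) \<longlonglongrightarrow> 1 * norm y"
  proof (intro tendsto_mult tendsto_const)
    show "(\<lambda>n. ((real n)\<^sup>2 + \<sigma> * real n + \<tau>) / ((real n + 1) * (real n + \<gamma>))) \<longlonglongrightarrow> 1"
      by real_asymp
  qed
  then have "\<forall>\<^sub>F n in sequentially. ((real n)\<^sup>2 + \<sigma> * real n + \<tau>) / ((real n + 1) * (real n + \<gamma>)) * norm y < q"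
    by (rule order_tendstoD) (use q in simp)
  then obtain m where m: "\<forall>n\<ge>m. ((real n)\<^sup>2 + \<sigma> * real n + \<tau>) / ((real n + 1) * (real n + \<gamma>)) * norm y < q"
    by (auto simp: eventually_sequentially)
  show ?thesis
  proof (rule summable_ratio_test[OF q(2)])
    fix n assume n: "m \<le> n"
    have pos: "((real n)\<^sup>2 + \<sigma> * real n + \<tau>) / ((real n + 1) * (real n + \<gamma>)) \<ge> 0" using assms by auto
    have "norm (hypgeo_coeff \<sigma> \<tau> \<gamma> (Suc n) * y ^ Suc n) =
       (((real n)\<^sup>2 + \<sigma> * real n + \<tau>) / ((real n + 1) * (real n + \<gamma>)) * norm y) * norm (hypgeo_coeff \<sigma> \<tau> \<gamma> n * y ^ n)"
      unfolding hypgeo_coeff.simps power_Suc norm_mult real_norm_def abs_mult abs_of_nonneg[OF pos] by (simp only: mult_ac)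
    also have "\<dots> \<le> q * norm (hypgeo_coeff \<sigma> \<tau> \<gamma> n * y ^ n)"
      by (intro mult_right_mono) (use m n in auto)
    finally show "norm (hypgeo_coeff \<sigma> \<tau> \<gamma> (Suc n) * y ^ Suc n) \<le> q * norm (hypgeo_coeff \<sigma> \<tau> \<gamma> n * y ^ n)" .
  qed
qed

lemma summable_diffs:
  fixes a :: "nat \<Rightarrow> real"
  assumes "\<And>y. norm y < 1 \<Longrightarrow> summable (\<lambda>n. a n * y ^ n)" "norm y < 1"
  shows "summable (\<lambda>n. diffs a n * y ^ n)"
  by (rule termdiff_converges[OF assms(2,1)])

context
  fixes \<sigma> \<tau> \<gamma> :: real
  assumes par: "0 \<le> \<sigma>" "0 \<le> \<tau>" "1 \<le> \<gamma>"
begin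

lemma summable_hypgeo_coeff_diffs: "norm y < 1 \<Longrightarrow> summable (\<lambda>n. diffs (hypgeo_coeff \<sigma> \<tau> \<gamma>) n * y ^ n)"
  by (rule summable_diffs[OF summable_hypgeo_coeff[OF par]])

lemma hypgeo_has_derivative: "norm y < 1 \<Longrightarrow> (hypgeo \<sigma> \<tau> \<gamma> has_real_derivative hypgeo' \<sigma> \<tau> \<gamma> y) (at y)"
  unfolding hypgeo_def[abs_def] hypgeo'_def by (rule termdiffs_strong'[OF summable_hypgeo_coeff[OF par]])

lemma hypgeo'_has_derivative: "norm y < 1 \<Longrightarrow> (hypgeo' \<sigma> \<tau> \<gamma> has_real_derivative hypgeo'' \<sigma> \<tau> \<gamma> y) (at y)"
  unfolding hypgeo'_def[abs_def] hypgeo''_def by (rule termdiffs_strong'[OF summable_hypgeo_coeff_diffs])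

lemma hypgeo_ge_1: "0 \<le> y \<Longrightarrow> y < 1 \<Longrightarrow> 1 \<le> hypgeo \<sigma> \<tau> \<gamma> y"
  using sum_le_suminf[OF summable_hypgeo_coeff[OF par], of y "{0}"] hypgeo_coeff_nonneg[OF par] by (simp add: hypgeo_def)

lemma hypgeo'_pos: "0 < \<tau> \<Longrightarrow> 0 \<le> y \<Longrightarrow> y < 1 \<Longrightarrow> 0 < hypgeo' \<sigma> \<tau> \<gamma> y"
proof -
  assume a: "0 < \<tau>" "0 \<le> y" "y < 1"
  have "diffs (hypgeo_coeff \<sigma> \<tau> \<gamma>) 0 \<le> hypgeo' \<sigma> \<tau> \<gamma> y"
    using sum_le_suminf[OF summable_hypgeo_coeff_diffs, of y "{0}"] hypgeo_coeff_nonneg[OF par] a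
    by (simp add: hypgeo'_def diffs_def del: hypgeo_coeff.simps)
  moreover have "diffs (hypgeo_coeff \<sigma> \<tau> \<gamma>) 0 > 0" using a par by (simp add: diffs_def)
  ultimately show ?thesis by simp
qed

text \<open>
  The recursion for the coefficients, read as an identity of power series: multiplication by \<open>n\<close> of the
  coefficients is the operator \<open>y d/dy\<close>.
\<close>

lemma hypgeo_ode:
  assumes y: "norm y < 1"
  shows "y * (1 - y) * hypgeo'' \<sigma> \<tau> \<gamma> y + (\<gamma> - (\<sigma> + 1) * y) * hypgeo' \<sigma> \<tau> \<gamma> y - \<tau> * hypgeo \<sigma> \<tau> \<gamma> y = 0"
proof -
  define a where "a = hypgeo_coeff \<sigma> \<tau> \<gamma>"
  define F F' F'' where "F = hypgeo \<sigma> \<tau> \<gamma> y" and "F' = hypgeo' \<sigma> \<tau> \<gamma> y" and "F'' = hypgeo'' \<sigma> \<tau> \<gamma> y"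
  have shift: "(\<lambda>n. real n * c n * y ^ n) sums (y * s)" if "(\<lambda>n. diffs c n * y ^ n) sums s" for c s
  proof -
    have "(\<lambda>n. of_nat n * c n * y ^ (n - Suc 0)) sums s"
      using diffs_equiv[OF sums_summable[OF that]] that by (simp add: sums_iff)
    then have "(\<lambda>n. y * (of_nat n * c n * y ^ (n - Suc 0))) sums (y * s)" by (rule sums_mult)
    moreover have "y * (of_nat n * c n * y ^ (n - Suc 0)) = real n * c n * y ^ n" for n
      by (cases n) auto
    ultimately show ?thesis by simp
  qed
  have s0: "(\<lambda>n. a n * y ^ n) sums F"
    unfolding a_def F_def hypgeo_def using summable_sums[OF summable_hypgeo_coeff[OF par y]] .
  have s1: "(\<lambda>n. diffs a n * y ^ n) sums F'"
    unfolding a_def F'_def hypgeo'_def using summable_sums[OF summable_hypgeo_coeff_diffs[OF y]] .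
  have s2: "(\<lambda>n. diffs (diffs a) n * y ^ n) sums F''"
    unfolding a_def F''_def hypgeo''_def using summable_sums[OF summable_diffs[OF summable_hypgeo_coeff_diffs y]] .
  have t1: "(\<lambda>n. real n * a n * y ^ n) sums (y * F')" by (rule shift[OF s1])
  have t2: "(\<lambda>n. real n * diffs a n * y ^ n) sums (y * F'')" by (rule shift[OF s2])
  have "(\<lambda>n. diffs (\<lambda>n. real n * a n) n * y ^ n) sums (F' + y * F'')"
    using sums_add[OF s1 t2] by (simp add: diffs_def algebra_simps)
  then have t3: "(\<lambda>n. real n * (real n * a n) * y ^ n) sums (y * (F' + y * F''))" by (rule shift)
  have "(\<lambda>n. real n * diffs a n * y ^ n + \<gamma> * (diffs a n * y ^ n)) sums (y * F'' + \<gamma> * F')"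
    by (intro sums_add sums_mult t2 s1)
  moreover have "(\<lambda>n. real n * (real n * a n) * y ^ n + \<sigma> * (real n * a n * y ^ n) + \<tau> * (a n * y ^ n)) sums
     (y * (F' + y * F'') + \<sigma> * (y * F') + \<tau> * F)"
    by (intro sums_add sums_mult t3 t1 s0)
  moreover have "real n * diffs a n * y ^ n + \<gamma> * (diffs a n * y ^ n) =
     real n * (real n * a n) * y ^ n + \<sigma> * (real n * a n * y ^ n) + \<tau> * (a n * y ^ n)" for n
  proof -
    have "(real n + \<gamma>) * diffs a n = ((real n)\<^sup>2 + \<sigma> * real n + \<tau>) * a n"
    proof -
      have nz: "real n + 1 \<noteq> 0" "real n + \<gamma> \<noteq> 0" using par by auto
      have "(k + \<gamma>) * ((k + 1) * (w / ((k + 1) * (k + \<gamma>)) * z)) = w * z" if "k + 1 \<noteq> 0" "k + \<gamma> \<noteq> 0" for k w z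
        using that by simp
      from this[OF nz] show ?thesis by (simp add: diffs_def a_def add.commute)
    qed
    then have "(real n + \<gamma>) * diffs a n * y ^ n = ((real n)\<^sup>2 + \<sigma> * real n + \<tau>) * a n * y ^ n" by simp
    then show ?thesis by (simp add: algebra_simps power2_eq_square)
  qed
  ultimately have "y * F'' + \<gamma> * F' = y * (F' + y * F'') + \<sigma> * (y * F') + \<tau> * F"
    using sums_unique2 by force
  then show ?thesis unfolding F_def F'_def F''_def by (simp add: algebra_simps)
qed

end

definition hypgeo_dom :: "(real \<times> real \<times> real \<times> real) set" where
  "hypgeo_dom = {(\<sigma>, \<tau>, \<gamma>, y). 0 \<le> \<sigma> \<and> 0 \<le> \<tau> \<and> 1 \<le> \<gamma> \<and> \<bar>y\<bar> < 1}"

lemma continuous_on_hypgeo_coeff: "continuous_on hypgeo_dom (\<lambda>(\<sigma>, \<tau>, \<gamma>, y). hypgeo_coeff \<sigma> \<tau> \<gamma> n)"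
proof (induction n)
  case (Suc n)
  have "real n + fst (snd (snd p)) \<noteq> 0" if "p \<in> hypgeo_dom" for p
    using that by (auto simp: hypgeo_dom_def)
  then show ?case using Suc
    by (auto simp: case_prod_beta intro!: continuous_intros)
qed (simp add: case_prod_beta)

text \<open>
  Near each point the series is dominated, uniformly, by the one with slightly larger \<open>\<sigma>\<close>, \<open>\<tau>\<close> and \<open>|y|\<close> and with
  \<open>\<gamma> = 1\<close>.
\<close>

lemma continuous_on_power_series_family:
  fixes a :: "nat \<Rightarrow> real \<Rightarrow> real \<Rightarrow> real \<Rightarrow> real"
  assumes cont: "\<And>n. continuous_on hypgeo_dom (\<lambda>(\<sigma>, \<tau>, \<gamma>, y). a n \<sigma> \<tau> \<gamma>)"
    and bound: "\<And>n \<sigma> \<tau> \<gamma> S T. 0 \<le> \<sigma> \<Longrightarrow> \<sigma> \<le> S \<Longrightarrow> 0 \<le> \<tau> \<Longrightarrow> \<tau> \<le> T \<Longrightarrow> 1 \<le> \<gamma> \<Longrightarrow> \<bar>a n \<sigma> \<tau> \<gamma>\<bar> \<le> a n S T 1"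
    and summ: "\<And>S T r. 0 \<le> S \<Longrightarrow> 0 \<le> T \<Longrightarrow> norm r < 1 \<Longrightarrow> summable (\<lambda>n. a n S T 1 * r ^ n)"
  shows "continuous_on hypgeo_dom (\<lambda>(\<sigma>, \<tau>, \<gamma>, y). \<Sum>n. a n \<sigma> \<tau> \<gamma> * y ^ n)"
  unfolding continuous_on_eq_continuous_within
proof
  fix p assume p: "p \<in> hypgeo_dom"
  obtain \<sigma>0 \<tau>0 \<gamma>0 y0 where p0: "p = (\<sigma>0, \<tau>0, \<gamma>0, y0)" by (cases p)
  define r where "r = (1 + \<bar>y0\<bar>) / 2"
  have r: "\<bar>y0\<bar> < r" "r < 1" "0 \<le> r" using p by (auto simp: p0 hypgeo_dom_def r_def)
  \<comment> \<open>A neighbourhood on which one majorant serves all parameters.\<close>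
  define U where "U = {..<\<sigma>0 + 1} \<times> {..<\<tau>0 + 1} \<times> (UNIV :: real set) \<times> {-r<..<r}"
  have U: "open U" "p \<in> U" using r by (auto simp: U_def p0 intro!: open_Times)
  have "uniform_limit (hypgeo_dom \<inter> U) (\<lambda>n q. \<Sum>i<n. (\<lambda>(\<sigma>, \<tau>, \<gamma>, y). a i \<sigma> \<tau> \<gamma> * y ^ i) q)
     (\<lambda>q. \<Sum>i. (\<lambda>(\<sigma>, \<tau>, \<gamma>, y). a i \<sigma> \<tau> \<gamma> * y ^ i) q) sequentially"
  proof (rule Weierstrass_m_test)
    show "summable (\<lambda>n. a n (\<sigma>0 + 1) (\<tau>0 + 1) 1 * r ^ n)"
      by (rule summ) (use p r in \<open>auto simp: p0 hypgeo_dom_def\<close>)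
    fix n q assume q: "q \<in> hypgeo_dom \<inter> U"
    obtain \<sigma> \<tau> \<gamma> y where q0: "q = (\<sigma>, \<tau>, \<gamma>, y)" by (cases q)
    have b: "\<bar>a n \<sigma> \<tau> \<gamma>\<bar> \<le> a n (\<sigma>0 + 1) (\<tau>0 + 1) 1"
      by (rule bound) (use q in \<open>auto simp: q0 hypgeo_dom_def U_def\<close>)
    have "\<bar>y\<bar> ^ n \<le> r ^ n" by (rule power_mono) (use q in \<open>auto simp: q0 U_def\<close>)
    then have "\<bar>a n \<sigma> \<tau> \<gamma>\<bar> * \<bar>y\<bar> ^ n \<le> a n (\<sigma>0 + 1) (\<tau>0 + 1) 1 * r ^ n"
      by (intro mult_mono b) (use b in auto)
    then show "norm ((\<lambda>(\<sigma>, \<tau>, \<gamma>, y). a n \<sigma> \<tau> \<gamma> * y ^ n) q) \<le> a n (\<sigma>0 + 1) (\<tau>0 + 1) 1 * r ^ n"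
      by (simp add: q0 abs_mult power_abs)
  qed
  then have "continuous_on (hypgeo_dom \<inter> U) (\<lambda>q. \<Sum>i. (\<lambda>(\<sigma>, \<tau>, \<gamma>, y). a i \<sigma> \<tau> \<gamma> * y ^ i) q)"
  proof (rule uniform_limit_theorem[rotated])
    have "continuous_on (hypgeo_dom \<inter> U) (\<lambda>q. \<Sum>i<n. (\<lambda>(\<sigma>, \<tau>, \<gamma>, y). a i \<sigma> \<tau> \<gamma> * y ^ i) q)" for n
    proof (intro continuous_on_sum)
      fix i
      have "continuous_on (hypgeo_dom \<inter> U) (\<lambda>(\<sigma>, \<tau>, \<gamma>, y). a i \<sigma> \<tau> \<gamma>)"
        by (rule continuous_on_subset[OF cont]) auto
      then show "continuous_on (hypgeo_dom \<inter> U) (\<lambda>(\<sigma>, \<tau>, \<gamma>, y). a i \<sigma> \<tau> \<gamma> * y ^ i)"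
        by (auto simp: case_prod_beta intro!: continuous_intros)
    qed
    then show "\<forall>\<^sub>F n in sequentially. continuous_on (hypgeo_dom \<inter> U) (\<lambda>q. \<Sum>i<n. (\<lambda>(\<sigma>, \<tau>, \<gamma>, y). a i \<sigma> \<tau> \<gamma> * y ^ i) q)"
      by simp
  qed simp
  then have "continuous (at p within (hypgeo_dom \<inter> U)) (\<lambda>q. \<Sum>i. (\<lambda>(\<sigma>, \<tau>, \<gamma>, y). a i \<sigma> \<tau> \<gamma> * y ^ i) q)"
    using p U by (simp add: continuous_on_eq_continuous_within)
  moreover have "(\<lambda>q. \<Sum>i. (\<lambda>(\<sigma>, \<tau>, \<gamma>, y). a i \<sigma> \<tau> \<gamma> * y ^ i) q) = (\<lambda>(\<sigma>, \<tau>, \<gamma>, y). \<Sum>n. a n \<sigma> \<tau> \<gamma> * y ^ n)"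
    by (simp add: fun_eq_iff)
  ultimately have "continuous (at p within (hypgeo_dom \<inter> U)) (\<lambda>(\<sigma>, \<tau>, \<gamma>, y). \<Sum>n. a n \<sigma> \<tau> \<gamma> * y ^ n)"
    by simp
  moreover have "at p within (hypgeo_dom \<inter> U) = at p within hypgeo_dom"
    by (rule at_within_nhd[OF U(2,1)]) auto
  ultimately show "continuous (at p within hypgeo_dom) (\<lambda>(\<sigma>, \<tau>, \<gamma>, y). \<Sum>n. a n \<sigma> \<tau> \<gamma> * y ^ n)" by simp
qed

lemma continuous_on_hypgeo: "continuous_on hypgeo_dom (\<lambda>(\<sigma>, \<tau>, \<gamma>, y). hypgeo \<sigma> \<tau> \<gamma> y)"
  unfolding hypgeo_def
  by (rule continuous_on_power_series_family[OF continuous_on_hypgeo_coeff])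
     (use hypgeo_coeff_nonneg hypgeo_coeff_mono summable_hypgeo_coeff in auto)

lemma continuous_on_hypgeo': "continuous_on hypgeo_dom (\<lambda>(\<sigma>, \<tau>, \<gamma>, y). hypgeo' \<sigma> \<tau> \<gamma> y)"
  unfolding hypgeo'_def
proof (rule continuous_on_power_series_family[of "\<lambda>n \<sigma> \<tau> \<gamma>. diffs (hypgeo_coeff \<sigma> \<tau> \<gamma>) n"])
  show "continuous_on hypgeo_dom (\<lambda>(\<sigma>, \<tau>, \<gamma>, y). diffs (hypgeo_coeff \<sigma> \<tau> \<gamma>) n)" for n
    using continuous_on_hypgeo_coeff[of "Suc n"]
    by (auto simp: diffs_def case_prod_beta simp del: hypgeo_coeff.simps intro!: continuous_on_mult continuous_on_const)
  show "\<bar>diffs (hypgeo_coeff \<sigma> \<tau> \<gamma>) n\<bar> \<le> diffs (hypgeo_coeff S T 1) n"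
    if "0 \<le> \<sigma>" "\<sigma> \<le> S" "0 \<le> \<tau>" "\<tau> \<le> T" "1 \<le> \<gamma>" for n \<sigma> \<tau> \<gamma> S T
    using hypgeo_coeff_nonneg[OF that(1,3,5), of "Suc n"] hypgeo_coeff_mono[OF that, of "Suc n"]
    by (simp add: diffs_def abs_mult mult_left_mono del: hypgeo_coeff.simps)
  show "summable (\<lambda>n. diffs (hypgeo_coeff S T 1) n * r ^ n)" if "0 \<le> S" "0 \<le> T" "norm r < 1" for S T r
    by (rule summable_hypgeo_coeff_diffs) (use that in auto)
qed

section \<open>Explicit solutions of the Riccati equation\<close>

text \<open>
  Slightly more than the interior of \<open>J \<nu>\<close>: only the inequality for \<open>c\<^sub>3\<close> is strict. It makes the solutions
  \<open>w_plus\<close> and \<open>w_minus\<close> below strictly monotone.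
\<close>

definition admissible :: "real^3 \<Rightarrow> real \<Rightarrow> bool" where
  "admissible c \<nu> \<longleftrightarrow> 0 < \<nu> \<and> - \<nu>\<^sup>2 \<le> c $ 1 \<and> - \<nu>\<^sup>2 \<le> c $ 2 \<and> c3_bar (c $ 1) (c $ 2) \<nu> < c $ 3"

abbreviation root1 :: "real^3 \<Rightarrow> real \<Rightarrow> real" where "root1 c \<nu> \<equiv> sqrt (\<nu>\<^sup>2 + c $ 1)"
abbreviation root2 :: "real^3 \<Rightarrow> real \<Rightarrow> real" where "root2 c \<nu> \<equiv> sqrt (\<nu>\<^sup>2 + c $ 2)"

text \<open>
  The substitution \<open>b = 2 \<nu> w' / w\<close> linearises the Riccati equation to
  \<open>2 \<nu>\<^sup>2 (1 - x\<^sup>2)\<^sup>2 w'' = P\<^sub>c w\<close>, a Fuchsian equation with singular points \<open>-1\<close>, \<open>1\<close>, \<open>\<infinity>\<close>. Dividing \<open>w\<close> by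
  \<open>(1 + x)\<^sup>\<alpha> (1 - x)\<^sup>\<alpha>'\<close>, where \<open>\<alpha>\<close> and \<open>\<alpha>'\<close> are the larger exponents at the two poles, leaves a hypergeometric
  equation in \<open>y = (1 + x) / 2\<close>. These are the sum and the product of its parameters; the product is positive
  precisely because \<open>c\<^sub>3\<close> exceeds \<open>c3_bar\<close>.
\<close>

definition par_sum :: "real^3 \<Rightarrow> real \<Rightarrow> real" where
  "par_sum c \<nu> = 1 + (root1 c \<nu> / \<nu> + root2 c \<nu> / \<nu>)"

definition par_prod :: "real^3 \<Rightarrow> real \<Rightarrow> real" where
  "par_prod c \<nu> = (c $ 3 - c3_bar (c $ 1) (c $ 2) \<nu>) / (2 * \<nu>\<^sup>2)"

text \<open>
  The solution that is regular at \<open>x = -1\<close>, and its mirror image, regular at \<open>x = 1\<close>. The primed functions are their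
  derivatives.
\<close>

definition w_plus :: "real^3 \<Rightarrow> real \<Rightarrow> real \<Rightarrow> real" where
  "w_plus c \<nu> x = hypgeo (par_sum c \<nu>) (par_prod c \<nu>) (1 + root1 c \<nu> / \<nu>) ((1 + x) / 2)"

definition w_plus' :: "real^3 \<Rightarrow> real \<Rightarrow> real \<Rightarrow> real" where
  "w_plus' c \<nu> x = hypgeo' (par_sum c \<nu>) (par_prod c \<nu>) (1 + root1 c \<nu> / \<nu>) ((1 + x) / 2) / 2"

definition w_minus :: "real^3 \<Rightarrow> real \<Rightarrow> real \<Rightarrow> real" where
  "w_minus c \<nu> x = hypgeo (par_sum c \<nu>) (par_prod c \<nu>) (1 + root2 c \<nu> / \<nu>) ((1 - x) / 2)"

definition w_minus' :: "real^3 \<Rightarrow> real \<Rightarrow> real \<Rightarrow> real" where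
  "w_minus' c \<nu> x = - hypgeo' (par_sum c \<nu>) (par_prod c \<nu>) (1 + root2 c \<nu> / \<nu>) ((1 - x) / 2) / 2"

text \<open>
  The contribution \<open>2 \<nu> (\<alpha> / (1 + x) - \<alpha>' / (1 - x))\<close> of the factor \<open>(1 + x)\<^sup>\<alpha> (1 - x)\<^sup>\<alpha>'\<close> to \<open>2 \<nu> w' / w\<close>. By itself it
  is the solution for \<open>c\<^sub>3 = c3_bar\<close>, on the boundary of \<open>J \<nu>\<close>.
\<close>

definition boundary_profile :: "real^3 \<Rightarrow> real \<Rightarrow> real \<Rightarrow> real" where
  "boundary_profile c \<nu> x = (\<nu> + root1 c \<nu>) * inverse (1 + x) - (\<nu> + root2 c \<nu>) * inverse (1 - x)"

text \<open>
  The general positive solution \<open>l w\<^sub>+ + m w\<^sub>-\<close> of the linear equation, with its common factor accounted for by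
  \<open>boundary_profile\<close>.
\<close>

definition profile :: "real \<Rightarrow> real \<Rightarrow> real^3 \<Rightarrow> real \<Rightarrow> real \<Rightarrow> real" where
  "profile l m c \<nu> x = boundary_profile c \<nu> x +
     2 * \<nu> * ((l * w_plus' c \<nu> x + m * w_minus' c \<nu> x) * inverse (l * w_plus c \<nu> x + m * w_minus c \<nu> x))"

lemma admissible_params:
  assumes "admissible c \<nu>"
  shows "0 \<le> par_sum c \<nu>" "0 < par_prod c \<nu>" "0 \<le> par_prod c \<nu>" "1 \<le> 1 + root1 c \<nu> / \<nu>" "1 \<le> 1 + root2 c \<nu> / \<nu>"
  using assms by (auto simp: admissible_def par_sum_def par_prod_def)

text \<open>
  The hypergeometric equation in the variable \<open>x\<close>. It is symmetric under the exchange of the poles, so that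
  \<open>w_plus\<close> and \<open>w_minus\<close> solve the same equation and may be combined.
\<close>

definition linear_ode :: "real^3 \<Rightarrow> real \<Rightarrow> real \<Rightarrow> real \<Rightarrow> real \<Rightarrow> real \<Rightarrow> bool" where
  "linear_ode c \<nu> x w w' w'' \<longleftrightarrow> (1 - x * x) * w'' +
     (root1 c \<nu> / \<nu> - root2 c \<nu> / \<nu> - (2 + (root1 c \<nu> / \<nu> + root2 c \<nu> / \<nu>)) * x) * w' - par_prod c \<nu> * w = 0"

lemma hypgeo_ode_reparam:
  fixes x a1 a2 T F F' F'' :: real
  shows "(1 + x) / 2 * (1 - (1 + x) / 2) * F'' + (1 + a1 - (1 + (a1 + a2) + 1) * ((1 + x) / 2)) * F' - T * F = 0 \<Longrightarrow>
      (1 - x * x) * (F'' / 4) + (a1 - a2 - (2 + (a1 + a2)) * x) * (F' / 2) - T * F = 0"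
    and "(1 - x) / 2 * (1 - (1 - x) / 2) * F'' + (1 + a2 - (1 + (a1 + a2) + 1) * ((1 - x) / 2)) * F' - T * F = 0 \<Longrightarrow>
      (1 - x * x) * (F'' / 4) + (a1 - a2 - (2 + (a1 + a2)) * x) * (- F' / 2) - T * F = 0"
  by (simp_all add: field_simps)

lemma w_plus_ode:
  assumes a: "admissible c \<nu>" and x: "x \<in> {-1<..<1}"
  shows "(w_plus c \<nu> has_real_derivative w_plus' c \<nu> x) (at x)"
    "\<exists>w''. (w_plus' c \<nu> has_real_derivative w'') (at x) \<and> linear_ode c \<nu> x (w_plus c \<nu> x) (w_plus' c \<nu> x) w''"
    "1 \<le> w_plus c \<nu> x" "0 < w_plus' c \<nu> x"
proof -
  note par = admissible_params[OF a]
  let ?y = "(1 + x) / 2"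
  have y: "norm ?y < 1" "0 \<le> ?y" "?y < 1" using x by (auto simp: abs_less_iff)
  have dy: "((\<lambda>x. (1 + x) / 2) has_real_derivative 1/2) (at x)" by (auto intro!: derivative_eq_intros)
  show "(w_plus c \<nu> has_real_derivative w_plus' c \<nu> x) (at x)"
    using DERIV_chain2[OF hypgeo_has_derivative[OF par(1,3,4) y(1)] dy] by (simp add: w_plus_def[abs_def] w_plus'_def)
  let ?w2 = "hypgeo'' (par_sum c \<nu>) (par_prod c \<nu>) (1 + root1 c \<nu> / \<nu>) ?y / 4"
  have "(w_plus' c \<nu> has_real_derivative ?w2) (at x)"
    using DERIV_cdivide[OF DERIV_chain2[OF hypgeo'_has_derivative[OF par(1,3,4) y(1)] dy], of 2] by (simp add: w_plus'_def[abs_def])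
  moreover have "linear_ode c \<nu> x (w_plus c \<nu> x) (w_plus' c \<nu> x) ?w2"
    using hypgeo_ode[OF par(1,3,4) y(1)]
    unfolding linear_ode_def w_plus_def w_plus'_def par_sum_def
    by (rule hypgeo_ode_reparam(1))
  ultimately show "\<exists>w''. (w_plus' c \<nu> has_real_derivative w'') (at x) \<and> linear_ode c \<nu> x (w_plus c \<nu> x) (w_plus' c \<nu> x) w''"
    by blast
  show "1 \<le> w_plus c \<nu> x" unfolding w_plus_def by (rule hypgeo_ge_1[OF par(1,3,4) y(2,3)])
  show "0 < w_plus' c \<nu> x" unfolding w_plus'_def using hypgeo'_pos[OF par(1,3,4,2) y(2,3)] by simp
qed

lemma w_minus_ode:
  assumes a: "admissible c \<nu>" and x: "x \<in> {-1<..<1}"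
  shows "(w_minus c \<nu> has_real_derivative w_minus' c \<nu> x) (at x)"
    "\<exists>w''. (w_minus' c \<nu> has_real_derivative w'') (at x) \<and> linear_ode c \<nu> x (w_minus c \<nu> x) (w_minus' c \<nu> x) w''"
    "1 \<le> w_minus c \<nu> x" "w_minus' c \<nu> x < 0"
proof -
  note par = admissible_params[OF a]
  let ?y = "(1 - x) / 2"
  have y: "norm ?y < 1" "0 \<le> ?y" "?y < 1" using x by (auto simp: abs_less_iff)
  have dy: "((\<lambda>x. (1 - x) / 2) has_real_derivative -1/2) (at x)" by (auto intro!: derivative_eq_intros)
  show "(w_minus c \<nu> has_real_derivative w_minus' c \<nu> x) (at x)"
    using DERIV_chain2[OF hypgeo_has_derivative[OF par(1,3,5) y(1)] dy] by (simp add: w_minus_def[abs_def] w_minus'_def)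
  let ?w2 = "hypgeo'' (par_sum c \<nu>) (par_prod c \<nu>) (1 + root2 c \<nu> / \<nu>) ?y / 4"
  have "(w_minus' c \<nu> has_real_derivative ?w2) (at x)"
    using DERIV_cdivide[OF DERIV_minus[OF DERIV_chain2[OF hypgeo'_has_derivative[OF par(1,3,5) y(1)] dy]], of 2] by (simp add: w_minus'_def[abs_def])
  moreover have "linear_ode c \<nu> x (w_minus c \<nu> x) (w_minus' c \<nu> x) ?w2"
    using hypgeo_ode[OF par(1,3,5) y(1)]
    unfolding linear_ode_def w_minus_def w_minus'_def par_sum_def
    by (rule hypgeo_ode_reparam(2))
  ultimately show "\<exists>w''. (w_minus' c \<nu> has_real_derivative w'') (at x) \<and> linear_ode c \<nu> x (w_minus c \<nu> x) (w_minus' c \<nu> x) w''"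
    by blast
  show "1 \<le> w_minus c \<nu> x" unfolding w_minus_def by (rule hypgeo_ge_1[OF par(1,3,5) y(2,3)])
  show "w_minus' c \<nu> x < 0" unfolding w_minus'_def using hypgeo'_pos[OF par(1,3,5,2) y(2,3)] by simp
qed

definition weights :: "real \<Rightarrow> real \<Rightarrow> bool" where
  "weights l m \<longleftrightarrow> 0 \<le> l \<and> 0 \<le> m \<and> 0 < l + m"

lemma combination_pos:
  assumes a: "admissible c \<nu>" and x: "x \<in> {-1<..<1}" and w: "weights l m"
  shows "0 < l * w_plus c \<nu> x + m * w_minus c \<nu> x"
proof -
  have "l * 1 + m * 1 \<le> l * w_plus c \<nu> x + m * w_minus c \<nu> x"
    by (intro add_mono mult_left_mono w_plus_ode(3)[OF a x] w_minus_ode(3)[OF a x]) (use w in \<open>auto simp: weights_def\<close>)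
  then show ?thesis using w by (simp add: weights_def)
qed

text \<open>
  The Riccati equation holds with \<open>P\<^sub>c\<close> replaced by the polynomial for \<open>c\<^sub>3 = c3_bar\<close>; the defect is
  \<open>(c\<^sub>3 - c3_bar) (1 - x\<^sup>2)\<close>, which is \<open>2 \<nu>\<^sup>2 par_prod (1 - x\<^sup>2)\<close>.
\<close>

lemma boundary_profile_riccati:
  assumes a: "admissible c \<nu>" and x: "x \<in> {-1<..<1}"
  shows "\<exists>d. (boundary_profile c \<nu> has_real_derivative d) (at x) \<and>
    (1 - x * x)\<^sup>2 * (\<nu> * d + boundary_profile c \<nu> x * boundary_profile c \<nu> x / 2) = P c x - 2 * \<nu>\<^sup>2 * par_prod c \<nu> * (1 - x * x)"
proof (intro exI conjI)
  define s t p q where "s = root1 c \<nu>" and "t = root2 c \<nu>" and "p = inverse (1 + x)" and "q = inverse (1 - x)"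
  have pq: "p * (1 + x) = 1" "q * (1 - x) = 1" using x by (auto simp: p_def q_def)
  have st: "s * s = \<nu>\<^sup>2 + c $ 1" "t * t = \<nu>\<^sup>2 + c $ 2"
    using a by (auto simp: s_def t_def admissible_def)
  have nz: "\<nu> \<noteq> 0" using a by (simp add: admissible_def)
  show "(boundary_profile c \<nu> has_real_derivative - ((\<nu> + s) * (p * p)) - (\<nu> + t) * (q * q)) (at x)"
    unfolding boundary_profile_def[abs_def] s_def t_def p_def q_def using x
    by (auto intro!: derivative_eq_intros)
  have tau: "2 * \<nu>\<^sup>2 * par_prod c \<nu> = c $ 3 + 1/2 * (s + t) * (s + t + 2 * \<nu>)"
    using nz by (simp add: par_prod_def c3_bar_def s_def t_def)
  have L: "boundary_profile c \<nu> x = (\<nu> + s) * p - (\<nu> + t) * q" by (simp add: boundary_profile_def s_def t_def p_def q_def)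
  have e: "(1 - x * x) * p = 1 - x" "(1 - x * x) * q = 1 + x" using pq by algebra+
  have gen: "r\<^sup>2 * (n * (- (a * (p * p)) - b * (q * q)) + (a * p - b * q) * (a * p - b * q) / 2) =
      n * (- (a * ((r * p) * (r * p))) - b * ((r * q) * (r * q))) + (a * (r * p) - b * (r * q)) * (a * (r * p) - b * (r * q)) / 2"
    for r n a b p q :: real
    by (simp add: field_simps power2_eq_square)
  have c12: "c $ 1 = s * s - \<nu>\<^sup>2" "c $ 2 = t * t - \<nu>\<^sup>2" using st by simp_all
  have "(1 - x * x)\<^sup>2 * (\<nu> * (- ((\<nu> + s) * (p * p)) - (\<nu> + t) * (q * q)) + ((\<nu> + s) * p - (\<nu> + t) * q) * ((\<nu> + s) * p - (\<nu> + t) * q) / 2)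
    = P c x - (c $ 3 + 1/2 * (s + t) * (s + t + 2 * \<nu>)) * (1 - x * x)"
    unfolding gen e P_def c12 by (simp add: field_simps power2_eq_square)
  then show "(1 - x * x)\<^sup>2 * (\<nu> * (- ((\<nu> + s) * (p * p)) - (\<nu> + t) * (q * q)) + boundary_profile c \<nu> x * boundary_profile c \<nu> x / 2)
     = P c x - 2 * \<nu>\<^sup>2 * par_prod c \<nu> * (1 - x * x)"
    unfolding L tau .
qed

text \<open>
  The Riccati equation for the profile. With \<open>g = l w\<^sub>+ + m w\<^sub>-\<close> and \<open>b = A + 2 \<nu> g' / g\<close>, the squares of \<open>g' / g\<close> cancel
  in \<open>\<nu> b' + b\<^sup>2 / 2\<close>, and the remaining \<open>\<nu> g'' + A g'\<close> is supplied by the linear equation; it compensates the defect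
  of \<open>boundary_profile_riccati\<close>.
\<close>

lemma profile_has_derivative:
  assumes a: "admissible c \<nu>" and x: "x \<in> {-1<..<1}" and w: "weights l m"
  shows "(profile l m c \<nu> has_real_derivative
     (P c x * (inverse (1 - x * x) * inverse (1 - x * x)) - profile l m c \<nu> x * profile l m c \<nu> x * (1/2)) * inverse \<nu>) (at x)"
proof -
  obtain d where d: "(boundary_profile c \<nu> has_real_derivative d) (at x)"
    "(1 - x * x)\<^sup>2 * (\<nu> * d + boundary_profile c \<nu> x * boundary_profile c \<nu> x / 2) = P c x - 2 * \<nu>\<^sup>2 * par_prod c \<nu> * (1 - x * x)"
    using boundary_profile_riccati[OF a x] by blast
  obtain wp where wp: "(w_plus' c \<nu> has_real_derivative wp) (at x)" "linear_ode c \<nu> x (w_plus c \<nu> x) (w_plus' c \<nu> x) wp"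
    using w_plus_ode(2)[OF a x] by blast
  obtain wm where wm: "(w_minus' c \<nu> has_real_derivative wm) (at x)" "linear_ode c \<nu> x (w_minus c \<nu> x) (w_minus' c \<nu> x) wm"
    using w_minus_ode(2)[OF a x] by blast
  define g g1 g2 where "g = l * w_plus c \<nu> x + m * w_minus c \<nu> x" and "g1 = l * w_plus' c \<nu> x + m * w_minus' c \<nu> x"
    and "g2 = l * wp + m * wm"
  have g: "g > 0" unfolding g_def by (rule combination_pos[OF a x w])
  have nu: "\<nu> > 0" using a by (simp add: admissible_def)
  have ode: "linear_ode c \<nu> x g g1 g2"
    using wp(2) wm(2) unfolding linear_ode_def g_def g1_def g2_def by algebra
  define A where "A = boundary_profile c \<nu> x"
  define D where "D = d + 2 * \<nu> * (g2 * inverse g - g1 * (g1 * (inverse g * inverse g)))"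
  have "(profile l m c \<nu> has_real_derivative D) (at x)"
    unfolding profile_def[abs_def] D_def
    using g unfolding g_def g1_def g2_def
    by (auto intro!: derivative_eq_intros d(1) wp(1) wm(1) w_plus_ode(1)[OF a x] w_minus_ode(1)[OF a x] simp: algebra_simps)
  moreover have "D = (P c x * (inverse (1 - x * x) * inverse (1 - x * x)) - profile l m c \<nu> x * profile l m c \<nu> x * (1/2)) * inverse \<nu>"
  proof -
    define r i z where "r = 1 - x * x" and "i = inverse r" and "z = inverse g"
    have ri: "r * i = 1" using one_minus_sq_pos[OF x] by (simp add: r_def i_def)
    have gz: "g * z = 1" using g by (simp add: z_def)
    have pr: "profile l m c \<nu> x = A + 2 * \<nu> * (g1 * z)"
      by (simp add: profile_def A_def g_def g1_def z_def)
    have Ar: "A * r = (root1 c \<nu> - root2 c \<nu>) - (2 * \<nu> + (root1 c \<nu> + root2 c \<nu>)) * x"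
    proof -
      have "inverse (1 + x) * (1 + x) = 1" "inverse (1 - x) * (1 - x) = 1" using x by auto
      then show ?thesis unfolding A_def boundary_profile_def r_def by algebra
    qed
    have "\<nu> * (root1 c \<nu> / \<nu> - root2 c \<nu> / \<nu> - (2 + (root1 c \<nu> / \<nu> + root2 c \<nu> / \<nu>)) * x) = A * r"
      unfolding Ar using nu by (simp add: field_simps)
    then have ode': "\<nu> * r * g2 + A * r * g1 = \<nu> * par_prod c \<nu> * g"
      using ode unfolding linear_ode_def r_def[symmetric] by algebra
    have d2: "r\<^sup>2 * (\<nu> * d + A * A / 2) = P c x - 2 * \<nu>\<^sup>2 * par_prod c \<nu> * r"
      using d(2) by (simp add: A_def r_def)
    have "r\<^sup>2 * (\<nu> * D + (A + 2 * \<nu> * (g1 * z)) * (A + 2 * \<nu> * (g1 * z)) / 2) = r\<^sup>2 * (\<nu> * d + A * A / 2) + 2 * \<nu> * r * z * (\<nu> * r * g2 + A * r * g1)"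
      unfolding D_def z_def[symmetric] by algebra
    also have "\<dots> = P c x" unfolding ode' d2 using gz by algebra
    finally have "r\<^sup>2 * (\<nu> * D + (A + 2 * \<nu> * (g1 * z)) * (A + 2 * \<nu> * (g1 * z)) / 2) = P c x" .
    then have "\<nu> * D + (A + 2 * \<nu> * (g1 * z)) * (A + 2 * \<nu> * (g1 * z)) / 2 = P c x * (i * i)"
    proof -
      have "X = p * (i * i)" if "r\<^sup>2 * X = p" for X p
      proof -
        have "p * (i * i) = (r * i)\<^sup>2 * X" unfolding that[symmetric] by (simp add: power2_eq_square mult_ac)
        then show ?thesis by (simp add: ri)
      qed
      from this[OF \<open>r\<^sup>2 * (\<nu> * D + (A + 2 * \<nu> * (g1 * z)) * (A + 2 * \<nu> * (g1 * z)) / 2) = P c x\<close>] show ?thesis .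
    qed
    then have "\<nu> * D = P c x * (i * i) - (A + 2 * \<nu> * (g1 * z)) * (A + 2 * \<nu> * (g1 * z)) * (1/2)" by simp
    moreover have "D = (\<nu> * D) * inverse \<nu>" using nu by simp
    ultimately show ?thesis unfolding pr r_def[symmetric] i_def[symmetric] by metis
  qed
  ultimately show ?thesis by simp
qed

lemma continuous_on_linear_solutions:
  fixes cc :: "'p::topological_space \<Rightarrow> real^3"
  assumes c: "continuous_on D cc" and n: "continuous_on D nn" and adm: "\<And>p. p \<in> D \<Longrightarrow> admissible (cc p) (nn p)"
  shows "continuous_on (D \<times> {-1<..<1}) (\<lambda>z. w_plus (cc (fst z)) (nn (fst z)) (snd z))"
    "continuous_on (D \<times> {-1<..<1}) (\<lambda>z. w_plus' (cc (fst z)) (nn (fst z)) (snd z))"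
    "continuous_on (D \<times> {-1<..<1}) (\<lambda>z. w_minus (cc (fst z)) (nn (fst z)) (snd z))"
    "continuous_on (D \<times> {-1<..<1}) (\<lambda>z. w_minus' (cc (fst z)) (nn (fst z)) (snd z))"
    "continuous_on (D \<times> {-1<..<1}) (\<lambda>z. boundary_profile (cc (fst z)) (nn (fst z)) (snd z))"
proof -
  let ?S = "D \<times> {-1<..<1::real}"
  have cf: "continuous_on ?S (\<lambda>z. cc (fst z))" and nf: "continuous_on ?S (\<lambda>z. nn (fst z))"
    by (rule continuous_on_compose2[OF c continuous_on_fst[OF continuous_on_id]], force,
        rule continuous_on_compose2[OF n continuous_on_fst[OF continuous_on_id]], force)
  have nz: "nn (fst z) \<noteq> 0" if "z \<in> ?S" for z
    using adm[of "fst z"] that by (auto simp: admissible_def)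
  have ps: "continuous_on ?S (\<lambda>z. par_sum (cc (fst z)) (nn (fst z)))"
    unfolding par_sum_def using nz by (intro continuous_intros cf nf) auto
  have pp: "continuous_on ?S (\<lambda>z. par_prod (cc (fst z)) (nn (fst z)))"
    unfolding par_prod_def c3_bar_def using nz by (intro continuous_intros cf nf) auto
  have g1: "continuous_on ?S (\<lambda>z. 1 + root1 (cc (fst z)) (nn (fst z)) / nn (fst z))"
    using nz by (intro continuous_intros cf nf) auto
  have g2: "continuous_on ?S (\<lambda>z. 1 + root2 (cc (fst z)) (nn (fst z)) / nn (fst z))"
    using nz by (intro continuous_intros cf nf) auto
  have y1: "continuous_on ?S (\<lambda>z. (1 + snd z) / 2)" and y2: "continuous_on ?S (\<lambda>z. (1 - snd z) / 2)"
    by (intro continuous_intros; simp)+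
  have m1: "continuous_on ?S (\<lambda>z. (par_sum (cc (fst z)) (nn (fst z)), par_prod (cc (fst z)) (nn (fst z)),
      1 + root1 (cc (fst z)) (nn (fst z)) / nn (fst z), (1 + snd z) / 2))"
    by (intro continuous_on_Pair ps pp g1 y1)
  have m2: "continuous_on ?S (\<lambda>z. (par_sum (cc (fst z)) (nn (fst z)), par_prod (cc (fst z)) (nn (fst z)),
      1 + root2 (cc (fst z)) (nn (fst z)) / nn (fst z), (1 - snd z) / 2))"
    by (intro continuous_on_Pair ps pp g2 y2)
  have i1: "(\<lambda>z. (par_sum (cc (fst z)) (nn (fst z)), par_prod (cc (fst z)) (nn (fst z)),
      1 + root1 (cc (fst z)) (nn (fst z)) / nn (fst z), (1 + snd z) / 2)) ` ?S \<subseteq> hypgeo_dom"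
    and i2: "(\<lambda>z. (par_sum (cc (fst z)) (nn (fst z)), par_prod (cc (fst z)) (nn (fst z)),
      1 + root2 (cc (fst z)) (nn (fst z)) / nn (fst z), (1 - snd z) / 2)) ` ?S \<subseteq> hypgeo_dom"
    using admissible_params[OF adm] by (auto simp: hypgeo_dom_def abs_less_iff)
  show "continuous_on ?S (\<lambda>z. w_plus (cc (fst z)) (nn (fst z)) (snd z))"
    using continuous_on_compose2[OF continuous_on_hypgeo m1 i1] by (simp add: w_plus_def)
  show "continuous_on ?S (\<lambda>z. w_plus' (cc (fst z)) (nn (fst z)) (snd z))"
    using continuous_on_divide[OF continuous_on_compose2[OF continuous_on_hypgeo' m1 i1] continuous_on_const, of 2] by (simp add: w_plus'_def)
  show "continuous_on ?S (\<lambda>z. w_minus (cc (fst z)) (nn (fst z)) (snd z))"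
    using continuous_on_compose2[OF continuous_on_hypgeo m2 i2] by (simp add: w_minus_def)
  show "continuous_on ?S (\<lambda>z. w_minus' (cc (fst z)) (nn (fst z)) (snd z))"
    using continuous_on_divide[OF continuous_on_minus[OF continuous_on_compose2[OF continuous_on_hypgeo' m2 i2]] continuous_on_const, of 2] by (simp add: w_minus'_def)
  show "continuous_on ?S (\<lambda>z. boundary_profile (cc (fst z)) (nn (fst z)) (snd z))"
    unfolding boundary_profile_def by (intro continuous_intros cf nf) auto
qed

lemma continuous_on_profile:
  fixes cc :: "'p::topological_space \<Rightarrow> real^3"
  assumes c: "continuous_on D cc" and n: "continuous_on D nn" and l: "continuous_on D l" and m: "continuous_on D m"
    and adm: "\<And>p. p \<in> D \<Longrightarrow> admissible (cc p) (nn p)" and w: "\<And>p. p \<in> D \<Longrightarrow> weights (l p) (m p)"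
  shows "continuous_on (D \<times> {-1<..<1}) (\<lambda>z. profile (l (fst z)) (m (fst z)) (cc (fst z)) (nn (fst z)) (snd z))"
proof -
  let ?S = "D \<times> {-1<..<1::real}"
  have lf: "continuous_on ?S (\<lambda>z. l (fst z))" and mf: "continuous_on ?S (\<lambda>z. m (fst z))" and nf: "continuous_on ?S (\<lambda>z. nn (fst z))"
    by (rule continuous_on_compose2[OF l continuous_on_fst[OF continuous_on_id]], force,
        rule continuous_on_compose2[OF m continuous_on_fst[OF continuous_on_id]], force,
        rule continuous_on_compose2[OF n continuous_on_fst[OF continuous_on_id]], force)
  have nz: "l (fst z) * w_plus (cc (fst z)) (nn (fst z)) (snd z) + m (fst z) * w_minus (cc (fst z)) (nn (fst z)) (snd z) \<noteq> 0"
    if "z \<in> ?S" for z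
    using combination_pos[OF adm _ w, of "fst z" "snd z"] that by (auto simp: less_imp_neq[symmetric])
  show ?thesis unfolding profile_def
    by (intro continuous_intros continuous_on_linear_solutions[OF c n adm] lf mf nf) (use nz in auto)
qed

text \<open>
  Joint continuity of the explicit formula is the start; the Riccati equation then gives one further derivative
  per induction step.
\<close>

lemma jointly_smooth_profile:
  fixes cc :: "'p::topological_space \<Rightarrow> real^3"
  assumes c: "continuous_on D cc" and n: "continuous_on D nn" and l: "continuous_on D l" and m: "continuous_on D m"
    and adm: "\<And>p. p \<in> D \<Longrightarrow> admissible (cc p) (nn p)" and w: "\<And>p. p \<in> D \<Longrightarrow> weights (l p) (m p)"
  shows "jointly_smooth D (\<lambda>p. profile (l p) (m p) (cc p) (nn p))"
  unfolding jointly_smooth_def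
proof
  let ?b = "\<lambda>p. profile (l p) (m p) (cc p) (nn p)"
  have cont: "continuous_on (D \<times> {-1<..<1}) (\<lambda>(p, x). ?b p x)"
    using continuous_on_profile[OF c n l m adm w] by (simp add: case_prod_beta)
  have nz: "nn p \<noteq> 0" if "p \<in> D" for p using adm[OF that] by (auto simp: admissible_def)
  have Pk: "jointly_Ck k D (\<lambda>p. P (cc p))" for k
    using jointly_smooth_reparam[OF jointly_smooth_P c, of UNIV] by (simp add: jointly_smooth_def)
  have q: "1 - x * x \<noteq> 0" if "x \<in> {-1<..<1}" for x :: real
    using one_minus_sq_pos[OF that] by linarith
  have "jointly_Ck k D (\<lambda>p x. 1 + (-1) * (x * x))" for k
    by (intro jointly_Ck_add jointly_Ck_mult jointly_Ck_ident jointly_Ck_param continuous_intros)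
  then have ik: "jointly_Ck k D (\<lambda>p x. inverse (1 - x * x))" for k
    using jointly_Ck_inverse[of k D "\<lambda>p x. 1 + (-1) * (x * x)"] q by simp
  fix k
  show "jointly_Ck k D ?b"
  proof (induction k)
    case 0 then show ?case using cont by simp
  next
    case (Suc k)
    have "jointly_Ck k D (\<lambda>p x. (P (cc p) x * (inverse (1 - x * x) * inverse (1 - x * x)) + (-1) * (?b p x * ?b p x * (1/2))) * inverse (nn p))"
      by (intro jointly_Ck_add jointly_Ck_mult Pk ik Suc jointly_Ck_param continuous_intros n) (use nz in auto)
    then have rhs: "jointly_Ck k D (\<lambda>p x. (P (cc p) x * (inverse (1 - x * x) * inverse (1 - x * x)) - ?b p x * ?b p x * (1/2)) * inverse (nn p))"
      by simp
    show ?case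
      by (rule jointly_Ck_SucI[OF cont _ rhs]) (rule profile_has_derivative[OF adm _ w])
  qed
qed

lemma smooth_profile:
  assumes "admissible c \<nu>" "weights l m" shows "smooth (profile l m c \<nu>)"
  using jointly_smooth_imp_smooth[OF jointly_smooth_profile[of "{0::real}" "\<lambda>_. c" "\<lambda>_. \<nu>" "\<lambda>_. l" "\<lambda>_. m"], of 0] assms
  by simp

lemma riccati_profile:
  assumes "admissible c \<nu>" "weights l m" shows "riccati c \<nu> (profile l m c \<nu>)"
  unfolding riccati_def
proof
  fix t :: real assume t: "t \<in> {-1<..<1}"
  let ?b = "profile l m c \<nu> t"
  have nu: "\<nu> \<noteq> 0" using assms by (auto simp: admissible_def)
  have r: "(1 - t * t) * inverse (1 - t * t) = 1" using one_minus_sq_pos[OF t] by simp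
  have d: "deriv (profile l m c \<nu>) t = (P c t * (inverse (1 - t * t) * inverse (1 - t * t)) - ?b * ?b * (1/2)) * inverse \<nu>"
    by (rule DERIV_imp_deriv[OF profile_has_derivative[OF assms(1) t assms(2)]])
  have "\<nu> * deriv (profile l m c \<nu>) t + ?b * ?b / 2 = P c t * (inverse (1 - t * t) * inverse (1 - t * t))"
  proof -
    have "\<nu> * (X * inverse \<nu>) = X" for X using nu by simp
    show ?thesis unfolding d \<open>\<And>X. \<nu> * (X * inverse \<nu>) = X\<close> by simp
  qed
  then have "(1 - t * t)\<^sup>2 * (\<nu> * deriv (profile l m c \<nu>) t + ?b * ?b / 2) = P c t * (((1 - t * t) * inverse (1 - t * t)) * ((1 - t * t) * inverse (1 - t * t)))"
    by (simp only: power2_eq_square mult_ac)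
  then show "(1 - t * t)\<^sup>2 * (\<nu> * deriv (profile l m c \<nu>) t + ?b * ?b / 2) = P c t" unfolding r by simp
qed

section \<open>Signs of the extremal profiles\<close>

text \<open>
  At a zero of \<open>b\<close> the equation gives \<open>b' > 0\<close>, since \<open>P\<^sub>c > 0\<close>.
\<close>

lemma riccati_sign:
  assumes b: "smooth b" and r: "riccati c \<nu> b" and c: "c \<in> positive_params" and nu: "0 < \<nu>"
    and yx: "-1 < y" "y < x" "x < 1" "0 \<le> b y"
  shows "0 < b x"
proof (rule barrier_pos[of y x "\<lambda>z. b z / (2 * \<nu>)" b "\<lambda>z. P c z / (1 - z * z)\<^sup>2 / \<nu>"])
  have I: "z \<in> {-1<..<1}" if "z \<in> {y..x}" for z using that yx by auto
  show "continuous_on {y..x} (\<lambda>z. b z / (2 * \<nu>))"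
  proof -
    have "{y..x} \<subseteq> {-1<..<1}" using I by blast
    from smooth_continuous_on[OF b this, of 0] show ?thesis
      using nu by (intro continuous_intros) auto
  qed
  fix z assume z: "z \<in> {y..x}"
  have "deriv b z = P c z / (1 - z * z)\<^sup>2 / \<nu> - b z / (2 * \<nu>) * b z"
  proof -
    have "deriv b z = (P c z / (1 - z * z)\<^sup>2 - b z * b z / 2) / \<nu>"
      using riccatiD[OF r I[OF z]] nu by (simp add: eq_divide_eq algebra_simps)
    then show ?thesis using nu by (simp add: diff_divide_distrib)
  qed
  then show "(b has_real_derivative P c z / (1 - z * z)\<^sup>2 / \<nu> - b z / (2 * \<nu>) * b z) (at z)"
    using smooth_DERIV[OF b I[OF z]] by simp
  have "P c z > 0" using c I[OF z] by (auto simp: positive_params_def)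
  then show "0 < P c z / (1 - z * z)\<^sup>2 / \<nu>"
    using nu one_minus_sq_pos[OF I[OF z]] by (intro divide_pos_pos zero_less_power)
qed (use yx in auto)

lemma weights_10: "weights 1 0" and weights_01: "weights 0 1" by (simp_all add: weights_def)

lemma profile_plus_ge:
  assumes "admissible c \<nu>" "x \<in> {-1<..<1}"
  shows "boundary_profile c \<nu> x < profile 1 0 c \<nu> x"
  using w_plus_ode(3,4)[OF assms] assms(1) by (simp add: profile_def admissible_def)

lemma profile_minus_le:
  assumes "admissible c \<nu>" "x \<in> {-1<..<1}"
  shows "profile 0 1 c \<nu> x < boundary_profile c \<nu> x"
  using w_minus_ode(3,4)[OF assms] assms(1) by (simp add: profile_def admissible_def mult_less_0_iff)

text \<open>
  Near the pole \<open>x = -1\<close> the first term of \<open>boundary_profile\<close> dominates, so that the profile is positive there, and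
  the sign propagates to the right.
\<close>

lemma profile_plus_pos:
  assumes a: "admissible c \<nu>" and c: "c \<in> positive_params" and x: "x \<in> {-1<..<1}"
  shows "0 < profile 1 0 c \<nu> x"
proof -
  have nu: "\<nu> > 0" "root1 c \<nu> \<ge> 0" "root2 c \<nu> \<ge> 0" using a by (auto simp: admissible_def)
  \<comment> \<open>The distance of the starting point to the pole: to the left of \<open>x\<close>, at most \<open>1\<close>, and so small that
    \<open>(\<nu> + root2) e \<le> \<nu> + root1\<close>.\<close>
  define e where "e = min (min ((x + 1) / 2) 1) ((\<nu> + root1 c \<nu>) / (\<nu> + root2 c \<nu>))"
  have "0 < (\<nu> + root1 c \<nu>) / (\<nu> + root2 c \<nu>)" using nu by (intro divide_pos_pos add_pos_nonneg)
  then have e: "0 < e" "e \<le> (x + 1) / 2" "e \<le> 1" "e \<le> (\<nu> + root1 c \<nu>) / (\<nu> + root2 c \<nu>)"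
    using x unfolding e_def
    by (simp, intro min.coboundedI1 min.cobounded1, intro min.coboundedI1 min.cobounded2, intro min.cobounded2)
  have "e * (\<nu> + root2 c \<nu>) \<le> (\<nu> + root1 c \<nu>) * 1" using e(4) nu by (simp add: le_divide_eq)
  also have "\<dots> \<le> (\<nu> + root1 c \<nu>) * (2 - e)" using e nu by (intro mult_left_mono) auto
  finally have "(\<nu> + root2 c \<nu>) / (2 - e) \<le> (\<nu> + root1 c \<nu>) / e"
    using e by (simp add: divide_simps mult_ac)
  then have "0 \<le> boundary_profile c \<nu> (e - 1)"
    using e by (simp add: boundary_profile_def field_simps)
  also have "\<dots> < profile 1 0 c \<nu> (e - 1)" by (rule profile_plus_ge[OF a]) (use e x in auto)
  finally have "0 \<le> profile 1 0 c \<nu> (e - 1)" by simp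
  from riccati_sign[OF smooth_profile[OF a weights_10] riccati_profile[OF a weights_10] c nu(1) _ _ _ this]
  show ?thesis using e x by auto
qed

text \<open>
  A nonnegative value would propagate to the pole \<open>x = 1\<close>, where \<open>boundary_profile\<close> is negative.
\<close>

lemma profile_minus_neg:
  assumes a: "admissible c \<nu>" and c: "c \<in> positive_params" and x: "x \<in> {-1<..<1}"
  shows "profile 0 1 c \<nu> x < 0"
proof (rule ccontr)
  assume "\<not> ?thesis"
  then have nn: "0 \<le> profile 0 1 c \<nu> x" by simp
  have nu: "\<nu> > 0" "root1 c \<nu> \<ge> 0" "root2 c \<nu> \<ge> 0" using a by (auto simp: admissible_def)
  define e where "e = min (min ((1 - x) / 2) 1) ((\<nu> + root2 c \<nu>) / (\<nu> + root1 c \<nu>))"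
  have "0 < (\<nu> + root2 c \<nu>) / (\<nu> + root1 c \<nu>)" using nu by (intro divide_pos_pos add_pos_nonneg)
  then have e: "0 < e" "e \<le> (1 - x) / 2" "e \<le> 1" "e \<le> (\<nu> + root2 c \<nu>) / (\<nu> + root1 c \<nu>)"
    using x unfolding e_def
    by (simp, intro min.coboundedI1 min.cobounded1, intro min.coboundedI1 min.cobounded2, intro min.cobounded2)
  have "e * (\<nu> + root1 c \<nu>) \<le> (\<nu> + root2 c \<nu>) * 1" using e(4) nu by (simp add: le_divide_eq)
  also have "\<dots> \<le> (\<nu> + root2 c \<nu>) * (2 - e)" using e nu by (intro mult_left_mono) auto
  finally have "(\<nu> + root1 c \<nu>) / (2 - e) \<le> (\<nu> + root2 c \<nu>) / e"
    using e by (simp add: divide_simps mult_ac)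
  then have "boundary_profile c \<nu> (1 - e) \<le> 0"
    using e by (simp add: boundary_profile_def field_simps)
  moreover have "profile 0 1 c \<nu> (1 - e) < boundary_profile c \<nu> (1 - e)" by (rule profile_minus_le[OF a]) (use e x in auto)
  moreover have "0 < profile 0 1 c \<nu> (1 - e)"
    by (rule riccati_sign[OF smooth_profile[OF a weights_01] riccati_profile[OF a weights_01] c nu(1) _ _ _ nn])
       (use e x in auto)
  ultimately show False by simp
qed

section \<open>Profiles with an interior layer\<close>

text \<open>
  The weight for which the layer profile takes at \<open>y\<close> the value closest to \<open>0\<close> in the interval between the two
  extremal profiles. For positive \<open>P\<^sub>c\<close> this value is \<open>0\<close>; for other admissible parameters \<open>0\<close> may lie outside of the
  interval, and the truncation keeps the weight in \<open>[0,1]\<close> and continuous.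
\<close>

definition layer_weight :: "real^3 \<Rightarrow> real \<Rightarrow> real \<Rightarrow> real" where
  "layer_weight c \<nu> y = (max (profile 0 1 c \<nu> y) (min 0 (profile 1 0 c \<nu> y)) - profile 0 1 c \<nu> y)
     / (profile 1 0 c \<nu> y - profile 0 1 c \<nu> y)"

text \<open>
  Normalising both solutions to \<open>1\<close> at \<open>y\<close> makes the value of the profile at \<open>y\<close> the convex combination of the two
  extremal values.
\<close>

definition layer_profile :: "real^3 \<Rightarrow> real \<Rightarrow> real \<Rightarrow> real \<Rightarrow> real" where
  "layer_profile c \<nu> y = profile (layer_weight c \<nu> y * inverse (w_plus c \<nu> y)) ((1 - layer_weight c \<nu> y) * inverse (w_minus c \<nu> y)) c \<nu>"

lemma layer_weight_bounds:
  assumes a: "admissible c \<nu>" and y: "y \<in> {-1<..<1}"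
  shows "0 \<le> layer_weight c \<nu> y" "layer_weight c \<nu> y \<le> 1"
proof -
  have "profile 0 1 c \<nu> y < profile 1 0 c \<nu> y"
    using profile_plus_ge[OF a y] profile_minus_le[OF a y] by simp
  then show "0 \<le> layer_weight c \<nu> y" "layer_weight c \<nu> y \<le> 1"
    by (auto simp: layer_weight_def divide_le_eq)
qed

lemma layer_weights:
  assumes a: "admissible c \<nu>" and y: "y \<in> {-1<..<1}"
  shows "weights (layer_weight c \<nu> y * inverse (w_plus c \<nu> y)) ((1 - layer_weight c \<nu> y) * inverse (w_minus c \<nu> y))"
proof -
  define L where "L = layer_weight c \<nu> y"
  have L: "0 \<le> L" "L \<le> 1" unfolding L_def by (rule layer_weight_bounds[OF a y])+
  have w: "w_plus c \<nu> y > 0" "w_minus c \<nu> y > 0" using w_plus_ode(3)[OF a y] w_minus_ode(3)[OF a y] by simp_all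
  have "0 < L * inverse (w_plus c \<nu> y) + (1 - L) * inverse (w_minus c \<nu> y)"
  proof (cases "L = 0")
    case False
    then show ?thesis using L w by (intro add_pos_nonneg mult_pos_pos mult_nonneg_nonneg) auto
  qed (use w in simp)
  then show ?thesis using L w by (simp add: weights_def L_def)
qed

lemma layer_profile_center:
  assumes a: "admissible c \<nu>" and c: "c \<in> positive_params" and y: "y \<in> {-1<..<1}"
  shows "layer_profile c \<nu> y y = 0"
proof -
  define L where "L = layer_weight c \<nu> y"
  define p m where "p = profile 1 0 c \<nu> y" and "m = profile 0 1 c \<nu> y"
  have pm: "p > 0" "m < 0" unfolding p_def m_def by (rule profile_plus_pos[OF a c y], rule profile_minus_neg[OF a c y])
  have w: "w_plus c \<nu> y > 0" "w_minus c \<nu> y > 0" using w_plus_ode(3)[OF a y] w_minus_ode(3)[OF a y] by simp_all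
  have L: "L * (p - m) = - m" using pm by (simp add: L_def layer_weight_def p_def[symmetric] m_def[symmetric])
  have "layer_profile c \<nu> y y = L * p + (1 - L) * m"
    using w by (simp add: layer_profile_def profile_def L_def[symmetric] p_def m_def algebra_simps)
  also have "\<dots> = 0" using L by (simp add: algebra_simps)
  finally show ?thesis .
qed

lemma layer_profile_sign:
  assumes a: "admissible c \<nu>" and c: "c \<in> positive_params" and y: "y \<in> {-1<..<1}" and x: "x \<in> {-1<..<1}"
  shows "y < x \<Longrightarrow> 0 \<le> layer_profile c \<nu> y x" "x < y \<Longrightarrow> layer_profile c \<nu> y x \<le> 0"
proof -
  note w = layer_weights[OF a y]
  have nu: "\<nu> > 0" using a by (simp add: admissible_def)
  note sgn = riccati_sign[OF smooth_profile[OF a w] riccati_profile[OF a w] c nu, folded layer_profile_def]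
  note z = layer_profile_center[OF a c y]
  show "0 \<le> layer_profile c \<nu> y x" if "y < x" using sgn[of y x] that x y z by auto
  show "layer_profile c \<nu> y x \<le> 0" if "x < y"
  proof (rule ccontr)
    assume "\<not> ?thesis"
    then have "0 < layer_profile c \<nu> y y" using sgn[of x y] that x y by auto
    with z show False by simp
  qed
qed

lemma jointly_smooth_layer_profile:
  fixes cc :: "'p::topological_space \<Rightarrow> real^3"
  assumes c: "continuous_on D cc" and n: "continuous_on D nn" and y: "continuous_on D y"
    and adm: "\<And>p. p \<in> D \<Longrightarrow> admissible (cc p) (nn p)" and yI: "\<And>p. p \<in> D \<Longrightarrow> y p \<in> {-1<..<1}"
  shows "jointly_smooth D (\<lambda>p. layer_profile (cc p) (nn p) (y p))"
proof -
  have sec: "continuous_on D (\<lambda>p. (p, y p))" by (intro continuous_on_Pair continuous_on_id y)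
  have sub: "(\<lambda>p. (p, y p)) ` D \<subseteq> D \<times> {-1<..<1}" using yI by auto
  have at: "continuous_on D (\<lambda>p. f p (y p))" if "continuous_on (D \<times> {-1<..<1}) (\<lambda>z. f (fst z) (snd z))" for f :: "'p \<Rightarrow> real \<Rightarrow> real"
    using continuous_on_compose2[OF that sec sub] by simp
  note cw = continuous_on_linear_solutions[OF c n adm]
  have pp: "continuous_on D (\<lambda>p. profile 1 0 (cc p) (nn p) (y p))"
    by (rule at[of "\<lambda>p. profile 1 0 (cc p) (nn p)"], rule continuous_on_profile[OF c n continuous_on_const continuous_on_const adm]) (auto simp: weights_10)
  have pm: "continuous_on D (\<lambda>p. profile 0 1 (cc p) (nn p) (y p))"
    by (rule at[of "\<lambda>p. profile 0 1 (cc p) (nn p)"], rule continuous_on_profile[OF c n continuous_on_const continuous_on_const adm]) (auto simp: weights_01)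
  have wp: "continuous_on D (\<lambda>p. w_plus (cc p) (nn p) (y p))"
    by (rule at[of "\<lambda>p. w_plus (cc p) (nn p)"], rule cw(1))
  have wm: "continuous_on D (\<lambda>p. w_minus (cc p) (nn p) (y p))"
    by (rule at[of "\<lambda>p. w_minus (cc p) (nn p)"], rule cw(3))
  have nz: "profile 1 0 (cc p) (nn p) (y p) - profile 0 1 (cc p) (nn p) (y p) \<noteq> 0"
    "w_plus (cc p) (nn p) (y p) \<noteq> 0" "w_minus (cc p) (nn p) (y p) \<noteq> 0" if "p \<in> D" for p
    using profile_plus_ge[OF adm[OF that] yI[OF that]] profile_minus_le[OF adm[OF that] yI[OF that]]
      w_plus_ode(3)[OF adm[OF that] yI[OF that]] w_minus_ode(3)[OF adm[OF that] yI[OF that]] by auto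
  have lw: "continuous_on D (\<lambda>p. layer_weight (cc p) (nn p) (y p))"
    unfolding layer_weight_def
    by (intro continuous_on_divide continuous_on_diff continuous_on_max continuous_on_min continuous_on_const pp pm) (use nz in auto)
  show ?thesis unfolding layer_profile_def
    by (rule jointly_smooth_profile[OF c n _ _ adm layer_weights[OF adm yI]])
       (intro continuous_on_mult continuous_on_inverse continuous_on_diff continuous_on_const lw wp wm ballI nz; assumption)+
qed

section \<open>The parameter region\<close>

lemma interior_shift:
  fixes c :: "real^3"
  assumes "c \<in> interior S"
  shows "\<exists>e>0. \<forall>i. c - e *\<^sub>R axis i 1 \<in> S"
proof -
  obtain r where r: "r > 0" "ball c r \<subseteq> S" using assms by (auto simp: mem_interior)
  have "c - (r / 2) *\<^sub>R axis i 1 \<in> ball c r" for i using r(1) by (simp add: dist_norm norm_axis_1)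
  then show ?thesis using r by (intro exI[of _ "r / 2"]) auto
qed

lemma interior_J:
  assumes "c \<in> interior (J \<nu>)"
  shows "- \<nu>\<^sup>2 < c $ 1" "- \<nu>\<^sup>2 < c $ 2" "c3_bar (c $ 1) (c $ 2) \<nu> < c $ 3"
proof -
  obtain e where e: "e > 0" "\<And>i. c - e *\<^sub>R axis i 1 \<in> J \<nu>" using interior_shift[OF assms] by blast
  have "(axis i 1 :: real^3) $ i = 1" for i by simp
  moreover have "(axis 3 1 :: real^3) $ 1 = 0" "(axis 3 1 :: real^3) $ 2 = 0" by (simp_all add: axis_def)
  ultimately show "- \<nu>\<^sup>2 < c $ 1" "- \<nu>\<^sup>2 < c $ 2" "c3_bar (c $ 1) (c $ 2) \<nu> < c $ 3"
    using e(1) e(2)[of 1] e(2)[of 2] e(2)[of 3] unfolding J_def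
    by (simp_all add: J_def)
qed

lemma interior_J_admissible: "0 < \<nu> \<Longrightarrow> c \<in> interior (J \<nu>) \<Longrightarrow> admissible c \<nu>"
  using interior_J[of c \<nu>] by (simp add: admissible_def)

text \<open>
  \<open>c3_bar\<close> decreases in \<open>\<nu>\<close>.
\<close>

lemma interior_J0_admissible:
  assumes "0 < \<nu>" "c \<in> interior (J 0)"
  shows "admissible c \<nu>"
proof -
  have c: "0 < c $ 1" "0 < c $ 2" "c3_bar (c $ 1) (c $ 2) 0 < c $ 3" using interior_J[OF assms(2)] by simp_all
  define a b a' b' where "a = sqrt (c $ 1)" and "b = sqrt (c $ 2)" and "a' = root1 c \<nu>" and "b' = root2 c \<nu>"
  have ab: "0 \<le> a" "a \<le> a'" "0 \<le> b" "b \<le> b'" using c by (simp_all add: a_def b_def a'_def b'_def)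
  have "(a + b) * (a + b) \<le> (a' + b') * (a' + b' + 2 * \<nu>)" using ab assms by (intro mult_mono) auto
  then have "c3_bar (c $ 1) (c $ 2) \<nu> \<le> c3_bar (c $ 1) (c $ 2) 0"
    by (simp add: c3_bar_def a_def b_def a'_def b'_def)
  then show ?thesis using c assms(1) by (auto simp: admissible_def intro: order_trans[of _ 0])
qed

text \<open>
  At the boundary value of \<open>c\<^sub>3\<close> the polynomial \<open>P\<^sub>c\<close> is the square
  \<open>(\<surd>c\<^sub>1 (1 - t) - \<surd>c\<^sub>2 (1 + t))\<^sup>2 / 2\<close>.
\<close>

lemma interior_J0_positive:
  assumes "c \<in> interior (J 0)"
  shows "c \<in> positive_params"
proof -
  have c: "0 < c $ 1" "0 < c $ 2" "c3_bar (c $ 1) (c $ 2) 0 < c $ 3" using interior_J[OF assms] by simp_all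
  define a b where "a = sqrt (c $ 1)" and "b = sqrt (c $ 2)"
  have ab: "c $ 1 = a * a" "c $ 2 = b * b" using c by (simp_all add: a_def b_def)
  have c3: "c $ 3 > - (1/2) * ((a + b) * (a + b))" using c(3) by (simp add: c3_bar_def a_def b_def)
  have "P c t > 0" if t: "t \<in> {-1..1}" for t
  proof (cases "t = 1 \<or> t = -1")
    case True then show ?thesis using c by (auto simp: P_def)
  next
    case False
    then have "0 < 1 - t * t" using t by (intro one_minus_sq_pos) auto
    then have "- (1/2) * ((a + b) * (a + b)) * (1 - t * t) < c $ 3 * (1 - t * t)" using c3 by (intro mult_strict_right_mono)
    moreover have "a * a * (1 - t) + b * b * (1 + t) + - (1/2) * ((a + b) * (a + b)) * (1 - t * t)
       = (1/2) * ((a * (1 - t) - b * (1 + t)) * (a * (1 - t) - b * (1 + t)))" by (simp add: field_simps)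
    moreover have "0 \<le> (1/2) * ((a * (1 - t) - b * (1 + t)) * (a * (1 - t) - b * (1 + t)))" by simp
    ultimately show ?thesis unfolding P_def ab power2_eq_square by linarith
  qed
  then show ?thesis by (simp add: positive_params_def)
qed

section \<open>Convergence to the left of a sign change\<close>

text \<open>
  The mirror image of \<open>right_branch\<close>: under \<open>t \<mapsto> - t\<close>, \<open>b \<mapsto> - b\<close> and the exchange of \<open>c\<^sub>1\<close> and \<open>c\<^sub>2\<close> the Riccati
  equation is invariant.
\<close>

definition left_branch :: "(real^3) set \<Rightarrow> real^3 \<Rightarrow> real \<Rightarrow> (real \<Rightarrow> real) \<Rightarrow> real \<Rightarrow> bool" where
  "left_branch K c \<nu> b x2 \<longleftrightarrow> c \<in> K \<and> 0 < \<nu> \<and> \<nu> \<le> 1 \<and> smooth b \<and> riccati c \<nu> b \<and> x2 \<le> 1 \<and> (\<forall>y\<in>{-1<..<x2}. b y \<le> 0)"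

definition swap12 :: "real^3 \<Rightarrow> real^3" where
  "swap12 c = vector [c $ 2, c $ 1, c $ 3]"

lemma P_swap12: "P (swap12 c) t = P c (- t)"
  by (simp add: P_def swap12_def)

lemma euler_profile_swap12: "euler_profile (swap12 c) t = euler_profile c (- t)"
  by (simp add: euler_profile_def P_swap12)

lemma continuous_on_swap12: "continuous_on S swap12"
proof -
  have eq: "swap12 = (\<lambda>c. \<chi> i. if i = 1 then c $ 2 else if i = 2 then c $ 1 else c $ 3)"
  proof (rule ext)
    fix c
    have "swap12 c $ i = (if i = 1 then c $ 2 else if i = 2 then c $ 1 else c $ 3)" for i
      using exhaust_3[of i] by (auto simp: swap12_def)
    then show "swap12 c = (\<chi> i. if i = 1 then c $ 2 else if i = 2 then c $ 1 else c $ 3)"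
      by (simp add: vec_eq_iff)
  qed
  have "continuous_on S (\<lambda>c::real^3. if i = 1 then c $ 2 else if i = 2 then c $ 1 else c $ 3)" for i :: 3
    by (cases "i = 1"; cases "i = 2") (auto intro!: continuous_intros)
  then show ?thesis unfolding eq by (rule continuous_on_vec_lambda)
qed

lemma left_branch_reflect:
  assumes "left_branch K c \<nu> b x2"
  shows "right_branch (swap12 ` K) (swap12 c) \<nu> (\<lambda>t. - b (- t)) (- x2)"
proof -
  note a = assms[unfolded left_branch_def]
  have sm: "smooth (\<lambda>t. - b (- t))" using smooth_cmult[OF smooth_reflect[of b], of "-1"] a by simp
  have "riccati (swap12 c) \<nu> (\<lambda>t. - b (- t))"
    unfolding riccati_def
  proof
    fix t :: real assume t: "t \<in> {-1<..<1}"
    then have t': "- t \<in> {-1<..<1}" by auto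
    have "deriv (\<lambda>t. - b (- t)) t = deriv b (- t)"
      by (rule DERIV_imp_deriv)
         (use DERIV_minus[OF DERIV_chain2[OF smooth_DERIV[of b, OF _ t'] DERIV_minus[OF DERIV_ident]]] a in simp)
    moreover have "(1 - - t * - t)\<^sup>2 * (\<nu> * deriv b (- t) + b (- t) * b (- t) / 2) = P c (- t)"
      using a t' unfolding riccati_def by blast
    ultimately show "(1 - t * t)\<^sup>2 * (\<nu> * deriv (\<lambda>t. - b (- t)) t + - b (- t) * - b (- t) / 2) = P (swap12 c) t"
      by (simp add: P_swap12)
  qed
  then show ?thesis using a sm by (auto simp: right_branch_def)
qed

text \<open>
  The sign \<open>s\<close> selects the root \<open>s \<beta>\<close> that attracts the solution.
\<close>

definition signed_deviation :: "real \<Rightarrow> real^3 \<Rightarrow> (real \<Rightarrow> real) \<Rightarrow> real \<Rightarrow> real" where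
  "signed_deviation s c b t = b t - s * euler_profile c t"

lemma left_deviation_estimate:
  assumes K: "compact K" "K \<subseteq> positive_params" and \<eta>: "0 < \<eta>" "\<eta> \<le> 1"
  shows "\<exists>C\<ge>0. \<forall>c \<nu> b x2 x. left_branch K c \<nu> b x2 \<longrightarrow> -1 + \<eta> \<le> x \<longrightarrow> x \<le> x2 - \<eta> \<longrightarrow>
     \<bar>(deriv ^^ j) (signed_deviation (-1) c b) x\<bar> \<le> C * \<nu>"
proof -
  have K': "compact (swap12 ` K)" by (rule compact_continuous_image[OF continuous_on_swap12 K(1)])
  have K'': "swap12 ` K \<subseteq> positive_params"
    using K(2) by (auto simp: positive_params_def P_swap12 subset_iff)
  from deviation_estimate[OF K' K'' \<eta>, of j] obtain C where C: "C \<ge> 0"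
    "\<forall>c \<nu> b x1 x. right_branch (swap12 ` K) c \<nu> b x1 \<longrightarrow> x1 + \<eta> \<le> x \<longrightarrow> x \<le> 1 - \<eta> \<longrightarrow> \<bar>(deriv ^^ j) (deviation c b) x\<bar> \<le> C * \<nu>"
    by (elim exE conjE) (rule that)
  show ?thesis
  proof (intro exI[of _ C] conjI C(1) allI impI)
    fix c \<nu> b x2 x assume lb: "left_branch K c \<nu> b x2" and x: "-1 + \<eta> \<le> x" "x \<le> x2 - \<eta>"
    note a = lb[unfolded left_branch_def]
    have c: "c \<in> positive_params" using a K by auto
    have xI: "- x \<in> {-1<..<1}" using x a \<eta> by auto
    have sm: "smooth (signed_deviation (-1) c b)"
      unfolding signed_deviation_def[abs_def] using a by (intro smooth_diff smooth_cmult smooth_euler_profile c) auto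
    have "deviation (swap12 c) (\<lambda>t. - b (- t)) = (\<lambda>t. -1 * signed_deviation (-1) c b (- t))"
      by (simp add: fun_eq_iff deviation_def signed_deviation_def euler_profile_swap12)
    then have "(deriv ^^ j) (deviation (swap12 c) (\<lambda>t. - b (- t))) (- x) = -1 * ((-1) ^ j * (deriv ^^ j) (signed_deviation (-1) c b) x)"
      by (simp only: higher_deriv_cmult[OF smooth_reflect[OF sm] xI] higher_deriv_reflect[OF sm xI] minus_minus)
    then have "\<bar>(deriv ^^ j) (deviation (swap12 c) (\<lambda>t. - b (- t))) (- x)\<bar> = \<bar>(deriv ^^ j) (signed_deviation (-1) c b) x\<bar>"
      by (simp add: abs_mult power_abs)
    moreover have "\<bar>(deriv ^^ j) (deviation (swap12 c) (\<lambda>t. - b (- t))) (- x)\<bar> \<le> C * \<nu>"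
      using C(2)[rule_format, OF left_branch_reflect[OF lb], of "- x"] x by simp
    ultimately show "\<bar>(deriv ^^ j) (signed_deviation (-1) c b) x\<bar> \<le> C * \<nu>" by simp
  qed
qed

section \<open>Coefficients of the fields\<close>

text \<open>
  Smooth functions whose first \<open>m\<close> derivatives at the point \<open>t\<close> are bounded by \<open>U\<close>. Pointwise bounds with explicit
  constants keep the uniformity in all parameters automatic.
\<close>

definition derivs_le :: "nat \<Rightarrow> real \<Rightarrow> real \<Rightarrow> (real \<Rightarrow> real) \<Rightarrow> bool" where
  "derivs_le m t U f \<longleftrightarrow> smooth f \<and> 0 \<le> U \<and> (\<forall>k\<le>m. \<bar>(deriv ^^ k) f t\<bar> \<le> U)"

context
  fixes t :: real
  assumes t: "t \<in> {-1<..<1}"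
begin

lemma derivs_le_mult: "derivs_le m t U f \<Longrightarrow> derivs_le m t V g \<Longrightarrow> derivs_le m t (2 ^ m * (U * V)) (\<lambda>x. f x * g x)"
proof -
  assume a: "derivs_le m t U f" "derivs_le m t V g"
  note a' = a[unfolded derivs_le_def]
  have "\<bar>(deriv ^^ k) (\<lambda>x. f x * g x) t\<bar> \<le> 2 ^ m * (U * V)" if k: "k \<le> m" for k
  proof -
    have "\<bar>\<Sum>i\<le>k. real (k choose i) * (deriv ^^ i) f t * (deriv ^^ (k - i)) g t\<bar> \<le> 2 ^ k * (U * V)"
      by (rule binomial_sum_bound) (use a' k in auto)
    also have "\<dots> \<le> 2 ^ m * (U * V)" using k a' by (intro mult_right_mono power_increasing) auto
    finally show ?thesis using a' by (simp add: higher_deriv_mult[OF _ _ t])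
  qed
  then show ?thesis using a' by (simp add: derivs_le_def smooth_mult)
qed

lemma derivs_le_add: "derivs_le m t U f \<Longrightarrow> derivs_le m t V g \<Longrightarrow> derivs_le m t (U + V) (\<lambda>x. f x + g x)"
  unfolding derivs_le_def
  by (auto simp: smooth_add higher_deriv_add[OF _ _ t] intro: order_trans[OF abs_triangle_ineq add_mono])

lemma derivs_le_diff: "derivs_le m t U f \<Longrightarrow> derivs_le m t V g \<Longrightarrow> derivs_le m t (U + V) (\<lambda>x. f x - g x)"
  unfolding derivs_le_def
  by (auto simp: smooth_diff higher_deriv_diff[OF _ _ t] intro: order_trans[OF abs_triangle_ineq4 add_mono])

lemma derivs_le_cmult: "derivs_le m t U f \<Longrightarrow> derivs_le m t (\<bar>c\<bar> * U) (\<lambda>x. c * f x)"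
  unfolding derivs_le_def
  by (auto simp: smooth_cmult higher_deriv_cmult[OF _ t] abs_mult intro: mult_left_mono)

lemma derivs_le_const: "derivs_le m t \<bar>c\<bar> (\<lambda>x. c)"
  by (simp add: derivs_le_def smooth_const higher_deriv_const[OF t])

lemma derivs_le_ident: "derivs_le m t 1 (\<lambda>x. x)"
proof -
  have "(deriv ^^ k) (\<lambda>x. x) t = (if k = 0 then t else if k = 1 then 1 else 0)" for k
    by (rule higher_deriv_tower[of "\<lambda>n x. if n = 0 then x else if n = 1 then 1 else 0", OF _ _ t])
       (auto intro!: derivative_eq_intros)
  then show ?thesis using t by (auto simp: derivs_le_def smooth_ident abs_le_iff)
qed

lemma derivs_le_deriv: "derivs_le (Suc m) t U f \<Longrightarrow> derivs_le m t U (deriv f)"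
  unfolding derivs_le_def by (auto simp: smooth_deriv higher_deriv_deriv simp del: funpow.simps)

lemma derivs_le_Suc: "derivs_le (Suc m) t U f \<Longrightarrow> derivs_le m t U f"
  unfolding derivs_le_def by auto

lemma derivs_le_cong: "derivs_le m t U f \<Longrightarrow> (\<And>x. x \<in> {-1<..<1} \<Longrightarrow> f x = g x) \<Longrightarrow> derivs_le m t U g"
  unfolding derivs_le_def using smooth_cong[of f g] higher_deriv_cong[of f g t] t by auto

lemma derivs_le_weaken: "derivs_le m t U f \<Longrightarrow> U \<le> V \<Longrightarrow> derivs_le m t V f"
  unfolding derivs_le_def by force

end

text \<open>
  The coefficients of velocity and pressure, restricted to the unit sphere, with respect to \<open>frame\<close> below.
\<close>

definition field_coeff :: "real^3 \<Rightarrow> real \<Rightarrow> (real \<Rightarrow> real) \<Rightarrow> nat \<Rightarrow> real \<Rightarrow> real" where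
  "field_coeff c \<nu> b j = (if j = 0 then radial_coeff b else if j = 1 then (\<lambda>t. - b t) else pressure_coeff c \<nu> b)"

lemma smooth_field_coeff: "smooth b \<Longrightarrow> smooth (field_coeff c \<nu> b j)"
  using smooth_cmult[of b "-1"] by (auto simp: field_coeff_def smooth_radial_coeff smooth_pressure_coeff)

text \<open>
  The coefficients are polynomials in \<open>b\<close>, \<open>b'\<close>, \<open>t\<close> and \<open>\<nu>\<close>. Closeness of \<open>b\<close> and \<open>B\<close> in \<open>C\<^sup>m\<^sup>+\<^sup>1\<close> makes them close in \<open>C\<^sup>m\<close>;
  the terms with a factor \<open>\<nu>\<close>, absent from the Euler flow, are \<open>O(\<nu>)\<close> because \<open>b\<close> is bounded.
\<close>

lemma field_coeff_difference:
  "\<exists>C'\<ge>0. \<forall>t \<nu> c b B j. t \<in> {-1<..<1} \<longrightarrow> 0 < \<nu> \<longrightarrow> \<nu> \<le> 1 \<longrightarrow>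
     derivs_le (Suc m) t (C * \<nu>) (\<lambda>t. b t - B t) \<longrightarrow> derivs_le (Suc m) t L B \<longrightarrow> smooth b \<longrightarrow>
     derivs_le m t (C' * \<nu>) (\<lambda>t. field_coeff c \<nu> b j t - field_coeff c 0 B j t)"
proof -
  define q :: real where "q = 2 ^ m"
  have q: "q \<ge> 1" by (simp add: q_def)
  define Q where "Q = 1 + q"
  define C0 where "C0 = \<bar>C\<bar>"
  define L0 where "L0 = \<bar>L\<bar>"
  define C' where "C' = (q * Q * C0 + q * C0) + C0 + (q * Q * (C0 + L0) + 2 * (q * (C0 + L0)) + 1/2 * (q * Q * (q * C0 * (C0 + 2 * L0))))"
  have nn: "0 \<le> q" "0 \<le> Q" "0 \<le> C0" "0 \<le> L0" using q by (auto simp: Q_def C0_def L0_def)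
  show ?thesis
  proof (intro exI[of _ C'] conjI allI impI)
    show "0 \<le> C'" using nn by (simp add: C'_def)
    fix t \<nu> :: real and c b B and j :: nat
    assume t: "t \<in> {-1<..<1}" and nu: "0 < \<nu>" "\<nu> \<le> 1"
      and E0: "derivs_le (Suc m) t (C * \<nu>) (\<lambda>t. b t - B t)" and B0: "derivs_le (Suc m) t L B" and b: "smooth b"
    let ?E = "\<lambda>t. b t - B t"
    have E: "derivs_le (Suc m) t (C0 * \<nu>) ?E" by (rule derivs_le_weaken[OF t E0]) (use nu in \<open>auto simp: C0_def intro: mult_right_mono\<close>)
    have B: "derivs_le (Suc m) t L0 B" by (rule derivs_le_weaken[OF t B0]) (auto simp: L0_def)
    have smB: "smooth B" using B by (simp add: derivs_le_def)
    have "derivs_le (Suc m) t (C0 * \<nu> + L0) b"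
      by (rule derivs_le_cong[OF t derivs_le_add[OF t E B]]) simp
    then have bb: "derivs_le (Suc m) t (C0 + L0) b"
      by (rule derivs_le_weaken[OF t]) (use nu mult_left_mono[of \<nu> 1 C0] nn in simp)
    have w: "derivs_le m t Q (\<lambda>t. 1 - t * t)"
      using derivs_le_diff[OF t derivs_le_const[OF t, of m 1] derivs_le_mult[OF t derivs_le_ident[OF t] derivs_le_ident[OF t]]] by (simp add: Q_def q_def)
    have dE: "deriv ?E x = deriv b x - deriv B x" if "x \<in> {-1<..<1}" for x
      using higher_deriv_diff[OF b smB that, of 1] by simp
    have b0: "derivs_le m t (q * (Q * (C0 * \<nu>)) + q * (1 * (C0 * \<nu>))) (\<lambda>t. field_coeff c \<nu> b 0 t - field_coeff c 0 B 0 t)"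
      by (rule derivs_le_cong[OF t derivs_le_diff[OF t derivs_le_mult[OF t w derivs_le_deriv[OF t E]]
            derivs_le_mult[OF t derivs_le_ident[OF t] derivs_le_Suc[OF t E]], folded q_def]])
         (simp add: field_coeff_def radial_coeff_def dE algebra_simps)
    have b1: "derivs_le m t (\<bar>-1\<bar> * (C0 * \<nu>)) (\<lambda>t. field_coeff c \<nu> b 1 t - field_coeff c 0 B 1 t)"
      by (rule derivs_le_cong[OF t derivs_le_cmult[OF t derivs_le_Suc[OF t E], of "-1"]]) (simp add: field_coeff_def)
    have bB: "derivs_le m t (C0 + 2 * L0) (\<lambda>t. b t + B t)"
      using derivs_le_add[OF t derivs_le_Suc[OF t bb] derivs_le_Suc[OF t B]] by (simp add: add.assoc)
    have b2: "derivs_le m t (\<bar>\<nu>\<bar> * (q * (Q * (C0 + L0)) + \<bar>2\<bar> * (q * (1 * (C0 + L0)))) + \<bar>1/2\<bar> * (q * (Q * (q * (C0 * \<nu> * (C0 + 2 * L0))))))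
       (\<lambda>t. field_coeff c \<nu> b 2 t - field_coeff c 0 B 2 t)"
      by (rule derivs_le_cong[OF t derivs_le_diff[OF t
            derivs_le_cmult[OF t derivs_le_diff[OF t derivs_le_mult[OF t w derivs_le_deriv[OF t bb]] derivs_le_cmult[OF t derivs_le_mult[OF t derivs_le_ident[OF t] derivs_le_Suc[OF t bb]], of 2]], of \<nu>]
            derivs_le_cmult[OF t derivs_le_mult[OF t w derivs_le_mult[OF t derivs_le_Suc[OF t E] bB]], of "1/2"], folded q_def]])
         (simp add: field_coeff_def pressure_coeff_def field_simps)
    have c2: "field_coeff c \<nu> b j = field_coeff c \<nu> b 2" "field_coeff c 0 B j = field_coeff c 0 B 2" if "j \<noteq> 0" "j \<noteq> 1"
      using that by (simp_all add: field_coeff_def)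
    define u1 u2 u3 where "u1 = (q * Q * C0 + q * C0)" and "u2 = C0" and "u3 = q * Q * (C0 + L0) + 2 * (q * (C0 + L0)) + 1/2 * (q * Q * (q * C0 * (C0 + 2 * L0)))"
    have u: "0 \<le> u1" "0 \<le> u2" "0 \<le> u3" using nn by (auto simp: u1_def u2_def u3_def)
    have le: "u1 * \<nu> \<le> C' * \<nu>" "u2 * \<nu> \<le> C' * \<nu>" "u3 * \<nu> \<le> C' * \<nu>"
    proof -
      have "C' = u1 + u2 + u3" by (simp only: C'_def u1_def u2_def u3_def)
      then show "u1 * \<nu> \<le> C' * \<nu>" "u2 * \<nu> \<le> C' * \<nu>" "u3 * \<nu> \<le> C' * \<nu>"
        using u nu by (auto intro!: mult_right_mono)
    qed
    consider "j = 0" | "j = 1" | "j \<noteq> 0" "j \<noteq> 1" by blast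
    then show "derivs_le m t (C' * \<nu>) (\<lambda>t. field_coeff c \<nu> b j t - field_coeff c 0 B j t)"
    proof cases
      case 1
      show ?thesis unfolding 1 by (rule derivs_le_weaken[OF t b0]) (use le(1) in \<open>simp add: u1_def algebra_simps\<close>)
    next
      case 2
      show ?thesis unfolding 2 by (rule derivs_le_weaken[OF t b1]) (use le(2) in \<open>simp add: u2_def\<close>)
    next
      case 3
      show ?thesis unfolding c2[OF 3] by (rule derivs_le_weaken[OF t b2]) (use le(3) nu in \<open>simp add: u3_def field_simps\<close>)
    qed
  qed
qed

section \<open>From profiles to fields on the sphere\<close>

text \<open>
  The pair of velocity and pressure is treated as one field with values in \<open>\<real>\<^sup>3 \<times> \<real>\<close>.
\<close>

definition frame :: "nat \<Rightarrow> real^3 \<Rightarrow> (real^3) \<times> real" where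
  "frame j x = (if j = 0 then (unit_dir x, 0) else if j = 1 then (e3, 0) else (0, 1))"

lemma smooth_off_axis_Pair_left:
  fixes f :: "real^3 \<Rightarrow> real^3"
  assumes "smooth_off_axis f" shows "smooth_off_axis (\<lambda>x. (f x, 0::real))"
proof -
  have "Ck_on k (\<lambda>x. (f x, 0::real)) off_axis" if "Ck_on k f off_axis" for k and f :: "real^3 \<Rightarrow> real^3"
    using that
  proof (induction k arbitrary: f)
    case 0 then show ?case by (auto intro: continuous_intros)
  next
    case (Suc k)
    have d: "((\<lambda>x. (f x, 0::real)) has_derivative (\<lambda>h. (frechet_derivative f (at x) h, 0))) (at x)" if "x \<in> off_axis" for x
      using Suc.prems that by (intro has_derivative_Pair has_frechet_derivative has_derivative_const) auto
    have "Ck_on k (\<lambda>x. (pd i f x, 0::real)) off_axis" for i using Suc by simp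
    then have "Ck_on k (pd i (\<lambda>x. (f x, 0::real))) off_axis" for i
      using Ck_on_cong[OF open_off_axis, of "\<lambda>x. (pd i f x, 0::real)" "pd i (\<lambda>x. (f x, 0::real))"]
      by (simp add: pd_eqI[OF d]) (simp add: pd_def)
    then show ?case using d by (auto simp: differentiable_def)
  qed
  then show ?thesis using assms by (simp add: smooth_off_axis_def)
qed

lemma smooth_off_axis_frame: "smooth_off_axis (frame j)"
proof -
  have u: "smooth_off_axis unit_dir" unfolding unit_dir_def[abs_def]
    by (intro smooth_off_axis_scaleR smooth_inv_norm smooth_off_axis_ident)
  show ?thesis
    unfolding frame_def[abs_def]
    by (cases "j = 0"; cases "j = 1")
       (auto intro: smooth_off_axis_const smooth_off_axis_Pair_left[OF u])
qed

lemma off_axis_scaleR: "x \<in> off_axis \<Longrightarrow> t \<noteq> 0 \<Longrightarrow> t *\<^sub>R x \<in> off_axis"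
  by (auto simp: off_axis_def)

lemma field_radial_ext:
  assumes x: "x \<in> off_axis"
  shows "(velocity b (x /\<^sub>R norm x), pressure c \<nu> b (x /\<^sub>R norm x)) = (\<Sum>j<3. field_coeff c \<nu> b j (cos_polar x) *\<^sub>R frame j x)"
proof -
  have n: "norm x > 0" using off_axis_nz[OF x] by simp
  have c: "cos_polar (x /\<^sub>R norm x) = cos_polar x" using n by (intro cos_polar_scale) simp
  have u: "unit_dir (x /\<^sub>R norm x) = unit_dir x" using n by (simp add: unit_dir_def)
  have N1: "inv_norm (x /\<^sub>R norm x) = 1" using n by simp
  have "{..<3::nat} = {0, 1, 2}" by auto
  then show ?thesis
    unfolding velocity_unit_dir pressure_def homog_def c u N1
    by (simp add: field_coeff_def frame_def scaleR_prod_def)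
qed

lemma field_diff_radial_ext:
  assumes "x \<in> off_axis"
  shows "radial_ext (\<lambda>x. (velocity b x - velocity b' x, pressure c \<nu> b x - pressure c' \<nu>' b' x)) x =
    (\<Sum>j<3. (field_coeff c \<nu> b j (cos_polar x) - field_coeff c' \<nu>' b' j (cos_polar x)) *\<^sub>R frame j x)"
proof -
  let ?y = "x /\<^sub>R norm x"
  have "(velocity b ?y - velocity b' ?y, pressure c \<nu> b ?y - pressure c' \<nu>' b' ?y) =
     (velocity b ?y, pressure c \<nu> b ?y) - (velocity b' ?y, pressure c' \<nu>' b' ?y)" by simp
  then show ?thesis
    unfolding radial_ext_def field_radial_ext[OF assms] by (simp only: scaleR_diff_left sum_subtractf)
qed

text \<open>
  The part of the sphere at which \<open>cos \<theta>\<close> keeps the distance \<open>\<eta>\<close> from \<open>\<plusminus>1\<close>.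
\<close>

definition collar :: "real \<Rightarrow> (real^3) set" where
  "collar \<eta> = {x \<in> sphere 0 1. -1 + \<eta> \<le> x $ 3 \<and> x $ 3 \<le> 1 - \<eta>}"

lemma collarD:
  assumes "x \<in> collar \<eta>" "0 < \<eta>"
  shows "x \<in> off_axis" "cos_polar x = x $ 3" "cos_polar x \<in> {-1+\<eta>..1-\<eta>}" "cos_polar x \<in> {-1<..<1}"
proof -
  have x: "norm x = 1" "-1 + \<eta> \<le> x $ 3" "x $ 3 \<le> 1 - \<eta>" using assms by (auto simp: collar_def)
  have "(x $ 1)\<^sup>2 + (x $ 2)\<^sup>2 = 1 - x $ 3 * x $ 3" using norm_sq_3[of x] x(1) by (simp add: power2_eq_square)
  moreover have "0 < 1 - x $ 3 * x $ 3" by (rule one_minus_sq_pos) (use x assms in auto)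
  ultimately show "x \<in> off_axis" by (auto simp: off_axis_def)
  show "cos_polar x = x $ 3" by (simp add: cos_polar_def x)
  then show "cos_polar x \<in> {-1+\<eta>..1-\<eta>}" "cos_polar x \<in> {-1<..<1}" using x assms by auto
qed

lemma compact_collar: "compact (collar \<eta>)"
proof -
  have "collar \<eta> = sphere 0 1 \<inter> ({x. -1 + \<eta> \<le> x $ 3} \<inter> {x. x $ 3 \<le> 1 - \<eta>})" by (auto simp: collar_def)
  moreover have "closed ({x::real^3. -1 + \<eta> \<le> x $ 3} \<inter> {x. x $ 3 \<le> 1 - \<eta>})"
    by (intro closed_Int closed_Collect_le continuous_intros)
  ultimately show ?thesis by (simp add: compact_Int_closed)
qed

lemma sphere_minus_poles_collar:
  assumes "0 < \<epsilon>"
  shows "sphere_minus_poles \<epsilon> \<subseteq> collar (\<epsilon>\<^sup>2 / 2)"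
proof
  fix x assume a: "x \<in> sphere_minus_poles \<epsilon>"
  then have x: "norm x = 1" "dist south x \<ge> \<epsilon>" "dist north x \<ge> \<epsilon>" by (auto simp: sphere_minus_poles_def)
  have "\<epsilon>\<^sup>2 \<le> (norm (x - e3))\<^sup>2" "\<epsilon>\<^sup>2 \<le> (norm (x + e3))\<^sup>2"
    using x assms by (auto simp: dist_norm north_def south_def norm_minus_commute add.commute intro!: power_mono)
  moreover have "(norm (x - e3))\<^sup>2 = 2 - 2 * x $ 3" "(norm (x + e3))\<^sup>2 = 2 + 2 * x $ 3"
    using x(1) by (simp_all add: power2_norm_eq_inner inner_diff_left inner_diff_right inner_add_left inner_add_right
        inner_axis inner_axis_axis inner_axis' norm_eq_1)
  ultimately show "x \<in> collar (\<epsilon>\<^sup>2 / 2)" using x(1) by (simp add: collar_def)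
qed

lemma field_norm_bound:
  assumes \<eta>: "0 < \<eta>"
  shows "\<exists>C\<ge>0. \<forall>f \<phi> B A. A \<subseteq> collar \<eta> \<longrightarrow> 0 \<le> B \<longrightarrow> (\<forall>j<3. smooth (\<phi> j)) \<longrightarrow>
     (\<forall>x\<in>off_axis. radial_ext f x = (\<Sum>j<3. \<phi> j (cos_polar x) *\<^sub>R frame j x)) \<longrightarrow>
     (\<forall>j<3. \<forall>k\<le>m. \<forall>x\<in>A. \<bar>(deriv ^^ k) (\<phi> j) (cos_polar x)\<bar> \<le> B) \<longrightarrow>
     sphere_norm m A f \<le> ennreal (C * B)"
proof -
  have \<psi>: "\<forall>j\<in>{..<3}. smooth_off_axis (frame j)" by (simp add: smooth_off_axis_frame)
  have K: "collar \<eta> \<subseteq> off_axis" by (rule subsetI) (rule collarD(1)[OF _ \<eta>])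
  obtain C where C: "C \<ge> 0" "\<forall>f \<phi> B A. A \<subseteq> collar \<eta> \<longrightarrow> 0 \<le> B \<longrightarrow> (\<forall>j\<in>{..<3}. smooth (\<phi> j)) \<longrightarrow>
     (\<forall>x\<in>off_axis. radial_ext f x = (\<Sum>j<3. \<phi> j (cos_polar x) *\<^sub>R frame j x)) \<longrightarrow>
     (\<forall>j\<in>{..<3}. \<forall>k\<le>m. \<forall>x\<in>A. \<bar>(deriv ^^ k) (\<phi> j) (cos_polar x)\<bar> \<le> B) \<longrightarrow>
     sphere_norm m A f \<le> ennreal (C * B)"
    using sphere_norm_bound[OF finite_lessThan \<psi> compact_collar K, of m] by (elim exE conjE) (rule that)
  show ?thesis
  proof (intro exI[of _ C] conjI C(1) allI impI)
    fix f :: "real^3 \<Rightarrow> (real^3) \<times> real" and \<phi> B A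
    assume a: "A \<subseteq> collar \<eta>" "0 \<le> B" "\<forall>j<3. smooth (\<phi> j)"
     "\<forall>x\<in>off_axis. radial_ext f x = (\<Sum>j<3. \<phi> j (cos_polar x) *\<^sub>R frame j x)"
     "\<forall>j<3. \<forall>k\<le>m. \<forall>x\<in>A. \<bar>(deriv ^^ k) (\<phi> j) (cos_polar x)\<bar> \<le> B"
    show "sphere_norm m A f \<le> ennreal (C * B)"
      by (rule C(2)[rule_format, of A B \<phi> f]) (use a in auto)
  qed
qed

lemma jointly_smooth_field_coeff:
  assumes n: "continuous_on D nn" and c: "continuous_on D cc" and b: "jointly_smooth D b"
  shows "jointly_smooth D (\<lambda>p. field_coeff (cc p) (nn p) (b p) j)"
proof -
  have c3: "continuous_on D (\<lambda>p. cc p $ 3)" by (intro continuous_intros c)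
  have r: "jointly_smooth D (\<lambda>p x. (1 - x * x) * deriv (b p) x - x * b p x)"
    by (intro jointly_smooth_diff jointly_smooth_mult jointly_smooth_ident jointly_smooth_param[OF continuous_on_const] jointly_smooth_deriv b)
  have m: "jointly_smooth D (\<lambda>p x. 0 - b p x)"
    by (intro jointly_smooth_diff jointly_smooth_param[OF continuous_on_const] b)
  have pr: "jointly_smooth D (\<lambda>p x. cc p $ 3 + nn p * ((1 - x * x) * deriv (b p) x - 2 * (x * b p x)) - 1/2 * ((1 - x * x) * (b p x * b p x)))"
    by (intro jointly_smooth_diff jointly_smooth_add jointly_smooth_mult jointly_smooth_ident jointly_smooth_param[OF continuous_on_const]
        jointly_smooth_param[OF c3] jointly_smooth_param[OF n] jointly_smooth_deriv b)
  consider "j = 0" | "j = 1" | "j \<noteq> 0" "j \<noteq> 1" by blast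
  then show ?thesis
    by cases (use r m pr in \<open>simp_all add: field_coeff_def radial_coeff_def[abs_def] pressure_coeff_def[abs_def]\<close>)
qed

lemma ennreal_tendsto_0I:
  fixes f :: "'a \<Rightarrow> ennreal"
  assumes "\<And>e. 0 < e \<Longrightarrow> \<forall>\<^sub>F x in F. f x \<le> ennreal e"
  shows "(f \<longlongrightarrow> 0) F"
proof (rule order_tendstoI)
  fix u :: ennreal assume "0 < u"
  then obtain z where z: "0 < z" "z < u" using dense by blast
  then obtain e where e: "z = ennreal e" "0 \<le> e" by (cases z) auto
  with z have "0 < e" by (simp add: ennreal_less_zero_iff)
  from assms[OF this] show "\<forall>\<^sub>F x in F. f x < u"
    by (rule eventually_mono) (use z e in auto)
qed simp

text \<open>
  Joint continuity of the derivatives of the coefficients becomes uniform in \<open>cos \<theta>\<close> on the compact interval that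
  belongs to the complement of the polar caps.
\<close>

lemma C0_sphere_Cm_field:
  fixes cc :: "'p::topological_space \<Rightarrow> real^3"
  assumes n: "continuous_on D nn" and c: "continuous_on D cc" and b: "jointly_smooth D b" and \<epsilon>: "0 < \<epsilon>"
  shows "(\<lambda>p x. (velocity (b p) x, pressure (cc p) (nn p) (b p) x)) \<in> C0_sphere_Cm D m (sphere_minus_poles \<epsilon>)"
proof -
  define \<eta> where "\<eta> = \<epsilon>\<^sup>2 / 2"
  have \<eta>: "0 < \<eta>" using \<epsilon> by (simp add: \<eta>_def)
  have sub: "sphere_minus_poles \<epsilon> \<subseteq> collar \<eta>" unfolding \<eta>_def by (rule sphere_minus_poles_collar[OF \<epsilon>])
  have cos_polar: "cos_polar x \<in> {-1+\<eta>..1-\<eta>}" "x \<in> off_axis" if "x \<in> sphere_minus_poles \<epsilon>" for x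
    using collarD[OF _ \<eta>, of x] sub that by auto
  obtain C where C: "C \<ge> 0" "\<forall>f \<phi> B A. A \<subseteq> collar \<eta> \<longrightarrow> 0 \<le> B \<longrightarrow> (\<forall>j<3. smooth (\<phi> j)) \<longrightarrow>
     (\<forall>x\<in>off_axis. radial_ext f x = (\<Sum>j<3. \<phi> j (cos_polar x) *\<^sub>R frame j x)) \<longrightarrow>
     (\<forall>j<3. \<forall>k\<le>m. \<forall>x\<in>A. \<bar>(deriv ^^ k) (\<phi> j) (cos_polar x)\<bar> \<le> B) \<longrightarrow>
     sphere_norm m A f \<le> ennreal (C * B)"
    using field_norm_bound[OF \<eta>, of m] by (elim exE conjE) (rule that)
  define f where "f p j = field_coeff (cc p) (nn p) (b p) j" for p and j :: nat
  have js: "jointly_smooth D (\<lambda>p. f p j)" for j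
    unfolding f_def by (rule jointly_smooth_field_coeff[OF n c b])
  have sm: "smooth (f p j)" if "p \<in> D" for p j by (rule jointly_smooth_imp_smooth[OF js that])
  let ?w = "\<lambda>p x. (velocity (b p) x, pressure (cc p) (nn p) (b p) x)"
  have "?w p \<in> sphere_Cm m (sphere_minus_poles \<epsilon>)" if p: "p \<in> D" for p
  proof -
    have re: "radial_ext (?w p) x = (\<Sum>j<3. f p j (cos_polar x) *\<^sub>R frame j x)" if "x \<in> off_axis" for x
      using field_radial_ext[OF that] by (simp add: radial_ext_def f_def)
    have "smooth_off_axis (\<lambda>x. \<Sum>j<3. f p j (cos_polar x) *\<^sub>R frame j x)"
      by (intro smooth_off_axis_sum smooth_off_axis_scaleR smooth_off_axis_comp_cos_polar sm p smooth_off_axis_frame)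
    then have "smooth_off_axis (radial_ext (?w p))" by (rule smooth_off_axis_cong) (simp add: re)
    then have W: "open off_axis \<and> sphere_minus_poles \<epsilon> \<subseteq> off_axis \<and> Ck_on m (radial_ext (?w p)) off_axis"
      using cos_polar open_off_axis by (auto simp: smooth_off_axis_def)
    have "\<exists>L\<ge>0. \<forall>i\<le>m. \<forall>q\<in>{p}. \<forall>t\<in>{-1+\<eta>..1-\<eta>}. \<bar>(deriv ^^ i) (f q j) t\<bar> \<le> L" for j
      by (rule jointly_smooth_bounded[OF js _ _ \<eta>]) (use p in auto)
    then obtain L where L: "\<And>j. L j \<ge> 0" "\<And>j i t. i \<le> m \<Longrightarrow> t \<in> {-1+\<eta>..1-\<eta>} \<Longrightarrow> \<bar>(deriv ^^ i) (f p j) t\<bar> \<le> L j"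
      by (simp add: Ball_def) metis
    have "sphere_norm m (sphere_minus_poles \<epsilon>) (?w p) \<le> ennreal (C * (\<Sum>j<3. L j))"
    proof (rule C(2)[rule_format, of _ _ "f p"])
      show "0 \<le> (\<Sum>j<3. L j)" by (intro sum_nonneg L)
      fix j k x assume a: "j < (3::nat)" "k \<le> m" "x \<in> sphere_minus_poles \<epsilon>"
      have "\<bar>(deriv ^^ k) (f p j) (cos_polar x)\<bar> \<le> L j" by (rule L(2)[OF a(2) cos_polar(1)[OF a(3)]])
      also have "\<dots> \<le> (\<Sum>j<3. L j)" by (rule member_le_sum) (use a L in auto)
      finally show "\<bar>(deriv ^^ k) (f p j) (cos_polar x)\<bar> \<le> (\<Sum>j<3. L j)" .
    qed (use sub sm p re in auto)
    also have "\<dots> < \<infinity>" by simp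
    finally show ?thesis using W unfolding sphere_Cm_def by blast
  qed
  moreover have "((\<lambda>q. sphere_norm m (sphere_minus_poles \<epsilon>) (\<lambda>x. ?w q x - ?w p x)) \<longlongrightarrow> 0) (at p within D)" if p: "p \<in> D" for p
  proof (rule ennreal_tendsto_0I)
    fix e :: real assume e: "0 < e"
    \<comment> \<open>\<open>C\<close> may be zero.\<close>
    define d where "d = e / (C + 1)"
    have d: "0 < d" "C * d \<le> e" using e C(1) by (auto simp: d_def field_simps)
    have "\<forall>\<^sub>F q in at p within D. \<forall>t\<in>{-1+\<eta>..1-\<eta>}. \<bar>(deriv ^^ k) (f q j) t - (deriv ^^ k) (f p j) t\<bar> \<le> d" for j k
    proof -
      have "continuous_on (D \<times> {-1+\<eta>..1-\<eta>}) (\<lambda>(q, t). (deriv ^^ k) (f q j) t)"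
        by (rule continuous_on_subset[OF jointly_smooth_continuous[OF js]]) (use \<eta> in auto)
      then obtain X where X: "p \<in> X" "open X"
        "\<forall>q\<in>X \<inter> D. \<forall>t\<in>{-1+\<eta>..1-\<eta>}. dist (case (q, t) of (q, t) \<Rightarrow> (deriv ^^ k) (f q j) t) (case (p, t) of (q, t) \<Rightarrow> (deriv ^^ k) (f q j) t) \<le> d"
        by (rule continuous_on_prod_compactE[OF _ compact_Icc p d(1)])
      have "\<forall>\<^sub>F q in at p within D. q \<in> X \<inter> D" using X(1,2) by (auto simp: eventually_at_topological)
      then show ?thesis by (rule eventually_mono) (use X(3) in \<open>auto simp: dist_real_def\<close>)
    qed
    note ev = this
    have "\<forall>\<^sub>F q in at p within D. \<forall>j\<in>{..<3::nat}. \<forall>k\<in>{..m}. \<forall>t\<in>{-1+\<eta>..1-\<eta>}. \<bar>(deriv ^^ k) (f q j) t - (deriv ^^ k) (f p j) t\<bar> \<le> d"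
      by (rule eventually_ball_finite, simp, rule ballI, rule eventually_ball_finite, simp, rule ballI, rule ev)
    moreover have "\<forall>\<^sub>F q in at p within D. q \<in> D" by (simp add: eventually_at_filter)
    ultimately show "\<forall>\<^sub>F q in at p within D. sphere_norm m (sphere_minus_poles \<epsilon>) (\<lambda>x. ?w q x - ?w p x) \<le> ennreal e"
    proof eventually_elim
      case (elim q)
      have "sphere_norm m (sphere_minus_poles \<epsilon>) (\<lambda>x. ?w q x - ?w p x) \<le> ennreal (C * d)"
      proof (rule C(2)[rule_format, of _ _ "\<lambda>j t. f q j t - f p j t"])
        show "smooth (\<lambda>t. f q j t - f p j t)" for j by (intro smooth_diff sm elim p)
        show "radial_ext (\<lambda>x. ?w q x - ?w p x) x = (\<Sum>j<3. (f q j (cos_polar x) - f p j (cos_polar x)) *\<^sub>R frame j x)" if "x \<in> off_axis" for x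
          using field_diff_radial_ext[OF that] by (simp add: f_def)
        fix j k x assume a: "j < (3::nat)" "k \<le> m" "x \<in> sphere_minus_poles \<epsilon>"
        have "cos_polar x \<in> {-1<..<1}" using cos_polar(1)[OF a(3)] \<eta> by auto
        then show "\<bar>(deriv ^^ k) (\<lambda>t. f q j t - f p j t) (cos_polar x)\<bar> \<le> d"
          using elim(1) a cos_polar(1)[OF a(3)] by (simp add: higher_deriv_diff[OF sm[OF elim(2)] sm[OF p]])
      qed (use sub d in auto)
      also have "\<dots> \<le> ennreal e" using d by (intro ennreal_leI)
      finally show ?case .
    qed
  qed
  ultimately show ?thesis by (simp add: C0_sphere_Cm_def)
qed

abbreviation euler_error :: "nat \<Rightarrow> (real^3) set \<Rightarrow> real \<Rightarrow> real^3 \<Rightarrow> real \<Rightarrow> (real \<Rightarrow> real) \<Rightarrow> ennreal" where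
  "euler_error m A s c \<nu> b \<equiv>
     sphere_norm m A (\<lambda>x. (velocity b x - euler_v s c x, pressure c \<nu> b x - euler_q c x))"

text \<open>
  Transfers estimates for the profile, known at the latitudes selected by \<open>R\<close>, to the field on any set of such
  latitudes.
\<close>

lemma euler_difference_estimate:
  assumes K: "compact K" "K \<subseteq> positive_params" and \<eta>: "0 < \<eta>" and s: "s * s = 1"
    and est: "\<And>j. \<exists>C\<ge>0. \<forall>c \<nu> b t. R c \<nu> b t \<longrightarrow> \<bar>(deriv ^^ j) (signed_deviation s c b) t\<bar> \<le> C * \<nu>"
  shows "\<exists>C\<ge>0. \<forall>c\<in>K. \<forall>\<nu> b A. 0 < \<nu> \<longrightarrow> \<nu> \<le> 1 \<longrightarrow> smooth b \<longrightarrow> A \<subseteq> collar \<eta> \<longrightarrow> (\<forall>x\<in>A. R c \<nu> b (x $ 3)) \<longrightarrow>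
     euler_error m A s c \<nu> b \<le> ennreal (C * \<nu>)"
proof -
  from est have "\<forall>j. \<exists>C. C \<ge> 0 \<and> (\<forall>c \<nu> b t. R c \<nu> b t \<longrightarrow> \<bar>(deriv ^^ j) (signed_deviation s c b) t\<bar> \<le> C * \<nu>)" by blast
  then obtain Cs where Cs: "\<forall>j. Cs j \<ge> 0 \<and> (\<forall>c \<nu> b t. R c \<nu> b t \<longrightarrow> \<bar>(deriv ^^ j) (signed_deviation s c b) t\<bar> \<le> Cs j * \<nu>)"
    by (rule choice[THEN exE])
  define C1 where "C1 = (\<Sum>j\<le>Suc m. Cs j)"
  have C1: "C1 \<ge> 0" unfolding C1_def by (intro sum_nonneg) (use Cs in auto)
  obtain L where L: "L \<ge> 0" "\<forall>i\<le>Suc m. \<forall>c\<in>K. \<forall>t\<in>{-1+\<eta>..1-\<eta>}. \<bar>(deriv ^^ i) (euler_profile c) t\<bar> \<le> L"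
    using jointly_smooth_bounded[OF jointly_smooth_euler_profile K \<eta>, of "Suc m"] by (elim exE conjE) (rule that)
  obtain C2 where C2: "C2 \<ge> 0" "\<forall>t \<nu> c b B j. t \<in> {-1<..<1} \<longrightarrow> 0 < \<nu> \<longrightarrow> \<nu> \<le> 1 \<longrightarrow>
     derivs_le (Suc m) t (C1 * \<nu>) (\<lambda>t. b t - B t) \<longrightarrow> derivs_le (Suc m) t (\<bar>s\<bar> * L) B \<longrightarrow> smooth b \<longrightarrow>
     derivs_le m t (C2 * \<nu>) (\<lambda>t. field_coeff c \<nu> b j t - field_coeff c 0 B j t)"
    using field_coeff_difference[of m C1 "\<bar>s\<bar> * L"] by (elim exE conjE) (rule that)
  obtain C3 where C3: "C3 \<ge> 0" "\<forall>f \<phi> B A. A \<subseteq> collar \<eta> \<longrightarrow> 0 \<le> B \<longrightarrow> (\<forall>j<3. smooth (\<phi> j)) \<longrightarrow>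
     (\<forall>x\<in>off_axis. radial_ext f x = (\<Sum>j<3. \<phi> j (cos_polar x) *\<^sub>R frame j x)) \<longrightarrow>
     (\<forall>j<3. \<forall>k\<le>m. \<forall>x\<in>A. \<bar>(deriv ^^ k) (\<phi> j) (cos_polar x)\<bar> \<le> B) \<longrightarrow>
     sphere_norm m A f \<le> ennreal (C3 * B)"
    using field_norm_bound[OF \<eta>, of m] by (elim exE conjE) (rule that)
  show ?thesis
  proof (intro exI[of _ "C3 * C2"] conjI ballI allI impI)
    show "0 \<le> C3 * C2" using C2 C3 by simp
    fix c \<nu> b A assume c: "c \<in> K" and nu: "0 < \<nu>" "\<nu> \<le> 1" and b: "smooth b" and A: "A \<subseteq> collar \<eta>" "\<forall>x\<in>A. R c \<nu> b (x $ 3)"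
    define B where "B = (\<lambda>t. s * euler_profile c t)"
    have cp: "c \<in> positive_params" using c K by auto
    have \<beta>: "smooth (euler_profile c)" by (rule smooth_euler_profile[OF cp])
    have B: "smooth B" unfolding B_def by (rule smooth_cmult[OF \<beta>])
    have sd: "signed_deviation s c b = (\<lambda>t. b t - B t)" by (simp add: fun_eq_iff signed_deviation_def B_def)
    have main: "derivs_le m (cos_polar x) (C2 * \<nu>) (\<lambda>t. field_coeff c \<nu> b j t - field_coeff c 0 B j t)" if x: "x \<in> A" for x j
    proof (rule C2(2)[rule_format, OF _ nu _ _ b])
      have xc: "x \<in> collar \<eta>" using A x by auto
      note cx = collarD[OF xc \<eta>]
      show "cos_polar x \<in> {-1<..<1}" by (rule cx(4))
      have r: "R c \<nu> b (cos_polar x)" using A(2) x cx(2) by simp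
      have "\<bar>(deriv ^^ k) (\<lambda>t. b t - B t) (cos_polar x)\<bar> \<le> C1 * \<nu>" if k: "k \<le> Suc m" for k
      proof -
        have "\<bar>(deriv ^^ k) (\<lambda>t. b t - B t) (cos_polar x)\<bar> \<le> Cs k * \<nu>" using Cs r unfolding sd[symmetric] by blast
        also have "\<dots> \<le> C1 * \<nu>" unfolding C1_def using k Cs nu by (intro mult_right_mono member_le_sum) auto
        finally show ?thesis .
      qed
      then show "derivs_le (Suc m) (cos_polar x) (C1 * \<nu>) (\<lambda>t. b t - B t)"
        using C1 nu by (auto simp: derivs_le_def intro: smooth_diff b B)
      have "derivs_le (Suc m) (cos_polar x) L (euler_profile c)"
        using L c cx(3) \<beta> by (auto simp: derivs_le_def)
      then show "derivs_le (Suc m) (cos_polar x) (\<bar>s\<bar> * L) B" unfolding B_def by (rule derivs_le_cmult[OF cx(4)])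
    qed
    have "euler_error m A s c \<nu> b \<le> ennreal (C3 * (C2 * \<nu>))"
    proof (rule C3(2)[rule_format, of _ _ "\<lambda>j t. field_coeff c \<nu> b j t - field_coeff c 0 B j t"])
      show "smooth (\<lambda>t. field_coeff c \<nu> b j t - field_coeff c 0 B j t)" for j
        by (intro smooth_diff smooth_field_coeff b B)
      show "\<bar>(deriv ^^ k) (\<lambda>t. field_coeff c \<nu> b j t - field_coeff c 0 B j t) (cos_polar x)\<bar> \<le> C2 * \<nu>" if "k \<le> m" "x \<in> A" for j k x
        using main[OF that(2), of j] that(1) by (simp add: derivs_le_def)
      fix x :: "real^3" assume x: "x \<in> off_axis"
      let ?x = "x /\<^sub>R norm x"
      have x': "?x \<in> off_axis" using off_axis_scaleR[OF x] off_axis_nz[OF x] by simp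
      have "P c (cos_polar ?x) > 0" using cp cos_polar_in[OF x'] by (auto simp: positive_params_def)
      then have "euler_v s c ?x = velocity B ?x" "euler_q c ?x = pressure c 0 B ?x"
        unfolding B_def using euler_v_eq[OF x'] euler_q_eq[OF x' _ s] by auto
      then show "radial_ext (\<lambda>x. (velocity b x - euler_v s c x, pressure c \<nu> b x - euler_q c x)) x =
         (\<Sum>j<3. (field_coeff c \<nu> b j (cos_polar x) - field_coeff c 0 B j (cos_polar x)) *\<^sub>R frame j x)"
        unfolding field_diff_radial_ext[OF x, symmetric] by (simp add: radial_ext_def)
    qed (use A nu C2 in auto)
    then show "euler_error m A s c \<nu> b \<le> ennreal (C3 * C2 * \<nu>)"
      by (simp add: mult.assoc)
  qed
qed

lemma right_limit:
  assumes K: "compact K" "K \<subseteq> positive_params" and \<eta>: "0 < \<eta>" "\<eta> \<le> 1"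
  shows "\<exists>C\<ge>0. \<forall>c\<in>K. \<forall>\<nu> b A x1. right_branch K c \<nu> b x1 \<longrightarrow> A \<subseteq> collar \<eta> \<longrightarrow> (\<forall>x\<in>A. x1 + \<eta> \<le> x $ 3) \<longrightarrow>
     euler_error m A 1 c \<nu> b \<le> ennreal (C * \<nu>)"
proof -
  define R where "R c \<nu> b t \<longleftrightarrow> (\<exists>x1. right_branch K c \<nu> b x1 \<and> x1 + \<eta> \<le> t \<and> t \<le> 1 - \<eta>)" for c \<nu> b t
  have sd: "signed_deviation 1 c b = deviation c b" for c b
    by (simp add: fun_eq_iff signed_deviation_def deviation_def)
  have est: "\<exists>C\<ge>0. \<forall>c \<nu> b t. R c \<nu> b t \<longrightarrow> \<bar>(deriv ^^ j) (signed_deviation 1 c b) t\<bar> \<le> C * \<nu>" for j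
  proof -
    obtain C where C: "C \<ge> 0" "\<forall>c \<nu> b x1 x. right_branch K c \<nu> b x1 \<longrightarrow> x1 + \<eta> \<le> x \<longrightarrow> x \<le> 1 - \<eta> \<longrightarrow>
       \<bar>(deriv ^^ j) (deviation c b) x\<bar> \<le> C * \<nu>"
      using deviation_estimate[OF K \<eta>, of j] by (elim exE conjE) (rule that)
    show ?thesis
    proof (intro exI[of _ C] conjI C(1) allI impI)
      fix c \<nu> b t assume "R c \<nu> b t"
      then obtain x1 where x1: "right_branch K c \<nu> b x1" "x1 + \<eta> \<le> t" "t \<le> 1 - \<eta>" unfolding R_def by (elim exE conjE)
      show "\<bar>(deriv ^^ j) (signed_deviation 1 c b) t\<bar> \<le> C * \<nu>"
        unfolding sd by (rule C(2)[rule_format, OF x1])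
    qed
  qed
  have one: "1 * 1 = (1::real)" by simp
  obtain C where C: "C \<ge> 0"
    "\<forall>c\<in>K. \<forall>\<nu> b A. 0 < \<nu> \<longrightarrow> \<nu> \<le> 1 \<longrightarrow> smooth b \<longrightarrow> A \<subseteq> collar \<eta> \<longrightarrow> (\<forall>x\<in>A. R c \<nu> b (x $ 3)) \<longrightarrow>
     euler_error m A 1 c \<nu> b \<le> ennreal (C * \<nu>)"
    using euler_difference_estimate[of K \<eta> 1 R m, OF K \<eta>(1) one est] by (elim exE conjE) (rule that)
  show ?thesis
  proof (intro exI[of _ C] conjI C(1) ballI allI impI)
    fix c \<nu> b A x1 assume a: "c \<in> K" "right_branch K c \<nu> b x1" "A \<subseteq> collar \<eta>" "\<forall>x\<in>A. x1 + \<eta> \<le> x $ 3"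
    show "euler_error m A 1 c \<nu> b \<le> ennreal (C * \<nu>)"
      by (rule C(2)[rule_format, OF a(1)]) (use a in \<open>auto simp: R_def collar_def right_branch_def\<close>)
  qed
qed

lemma left_limit:
  assumes K: "compact K" "K \<subseteq> positive_params" and \<eta>: "0 < \<eta>" "\<eta> \<le> 1"
  shows "\<exists>C\<ge>0. \<forall>c\<in>K. \<forall>\<nu> b A x2. left_branch K c \<nu> b x2 \<longrightarrow> A \<subseteq> collar \<eta> \<longrightarrow> (\<forall>x\<in>A. x $ 3 \<le> x2 - \<eta>) \<longrightarrow>
     euler_error m A (-1) c \<nu> b \<le> ennreal (C * \<nu>)"
proof -
  define R where "R c \<nu> b t \<longleftrightarrow> (\<exists>x2. left_branch K c \<nu> b x2 \<and> -1 + \<eta> \<le> t \<and> t \<le> x2 - \<eta>)" for c \<nu> b t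
  have est: "\<exists>C\<ge>0. \<forall>c \<nu> b t. R c \<nu> b t \<longrightarrow> \<bar>(deriv ^^ j) (signed_deviation (-1) c b) t\<bar> \<le> C * \<nu>" for j
  proof -
    obtain C where C: "C \<ge> 0" "\<forall>c \<nu> b x2 x. left_branch K c \<nu> b x2 \<longrightarrow> -1 + \<eta> \<le> x \<longrightarrow> x \<le> x2 - \<eta> \<longrightarrow>
       \<bar>(deriv ^^ j) (signed_deviation (-1) c b) x\<bar> \<le> C * \<nu>"
      using left_deviation_estimate[OF K \<eta>, of j] by (elim exE conjE) (rule that)
    show ?thesis
    proof (intro exI[of _ C] conjI C(1) allI impI)
      fix c \<nu> b t assume "R c \<nu> b t"
      then obtain x2 where x2: "left_branch K c \<nu> b x2" "-1 + \<eta> \<le> t" "t \<le> x2 - \<eta>" unfolding R_def by (elim exE conjE)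
      show "\<bar>(deriv ^^ j) (signed_deviation (-1) c b) t\<bar> \<le> C * \<nu>"
        by (rule C(2)[rule_format, OF x2])
    qed
  qed
  have one: "(-1) * (-1) = (1::real)" by simp
  obtain C where C: "C \<ge> 0"
    "\<forall>c\<in>K. \<forall>\<nu> b A. 0 < \<nu> \<longrightarrow> \<nu> \<le> 1 \<longrightarrow> smooth b \<longrightarrow> A \<subseteq> collar \<eta> \<longrightarrow> (\<forall>x\<in>A. R c \<nu> b (x $ 3)) \<longrightarrow>
     euler_error m A (-1) c \<nu> b \<le> ennreal (C * \<nu>)"
    using euler_difference_estimate[of K \<eta> "-1" R m, OF K \<eta>(1) one est] by (elim exE conjE) (rule that)
  show ?thesis
  proof (intro exI[of _ C] conjI C(1) ballI allI impI)
    fix c \<nu> b A x2 assume a: "c \<in> K" "left_branch K c \<nu> b x2" "A \<subseteq> collar \<eta>" "\<forall>x\<in>A. x $ 3 \<le> x2 - \<eta>"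
    show "euler_error m A (-1) c \<nu> b \<le> ennreal (C * \<nu>)"
      by (rule C(2)[rule_format, OF a(1)]) (use a in \<open>auto simp: R_def collar_def left_branch_def\<close>)
  qed
qed

text \<open>
  The angular distance \<open>\<epsilon>\<close> corresponds to the distance \<open>\<eta> = 1 - cos \<epsilon>\<close> in the variable \<open>cos \<theta>\<close>, uniformly in the
  position of the layer.
\<close>

lemma sphere_bands_collar:
  assumes "0 < \<epsilon>"
  shows "\<exists>\<eta>>0. \<eta> \<le> 1 \<and> (\<forall>\<theta>\<^sub>0. 0 < \<theta>\<^sub>0 \<longrightarrow> \<theta>\<^sub>0 < pi \<longrightarrow>
     (\<forall>x\<in>sphere_band \<epsilon> (\<theta>\<^sub>0 - \<epsilon>). x \<in> collar \<eta> \<and> cos \<theta>\<^sub>0 + \<eta> \<le> x $ 3) \<and>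
     (\<forall>x\<in>sphere_band (\<theta>\<^sub>0 + \<epsilon>) (pi - \<epsilon>). x \<in> collar \<eta> \<and> x $ 3 \<le> cos \<theta>\<^sub>0 - \<eta>))"
proof (cases "\<epsilon> < pi / 2")
  case False
  \<comment> \<open>For \<open>\<epsilon> \<ge> \<pi> / 2\<close> the bands are empty.\<close>
  have "sphere_band \<epsilon> (\<theta>\<^sub>0 - \<epsilon>) = {}" "sphere_band (\<theta>\<^sub>0 + \<epsilon>) (pi - \<epsilon>) = {}" if "0 < \<theta>\<^sub>0" "\<theta>\<^sub>0 < pi" for \<theta>\<^sub>0
    using False that by (auto simp: sphere_band_def)
  then show ?thesis by (intro exI[of _ 1]) auto
next
  case True
  define \<eta> where "\<eta> = 1 - cos \<epsilon>"
  have c0: "0 < cos \<epsilon>" using True assms by (intro cos_gt_zero) auto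
  have c1: "cos \<epsilon> < 1" using cos_monotone_0_pi[of 0 \<epsilon>] assms True by simp
  \<comment> \<open>The difference is \<open>2 sin ((a + b) / 2) sin ((b - a) / 2)\<close>, and both arguments keep the distance \<open>\<epsilon> / 2\<close>
    from \<open>0\<close> and \<open>\<pi>\<close>; equality holds in the limit \<open>a = 0\<close>, \<open>b = \<epsilon>\<close>.\<close>
  have gap: "cos b + \<eta> \<le> cos a" if "0 < a" "b < pi" "a + \<epsilon> < b" for a b
  proof -
    have sin_ge: "sin (\<epsilon> / 2) \<le> sin z" if "\<epsilon> / 2 \<le> z" "z \<le> pi - \<epsilon> / 2" for z
    proof (cases "z \<le> pi / 2")
      case True
      then show ?thesis using that assms by (intro sin_monotone_2pi_le) auto
    next
      case F: False
      have "sin (\<epsilon> / 2) \<le> sin (pi - z)" using that assms F by (intro sin_monotone_2pi_le) auto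
      then show ?thesis by simp
    qed
    have s0: "0 \<le> sin (\<epsilon> / 2)" using assms True by (intro sin_ge_zero) auto
    have "\<eta> = 2 * (sin (\<epsilon> / 2) * sin (\<epsilon> / 2))"
      using cos_double_sin[of "\<epsilon> / 2"] by (simp add: \<eta>_def power2_eq_square)
    also have "\<dots> \<le> 2 * (sin ((a + b) / 2) * sin ((b - a) / 2))"
      by (intro mult_left_mono mult_mono sin_ge s0 order_trans[OF s0 sin_ge]) (use that assms in auto)
    also have "\<dots> = cos a - cos b" by (simp add: cos_diff_cos)
    finally show ?thesis by simp
  qed
  have th: "x $ 3 = cos (theta x)" "0 \<le> theta x" "theta x \<le> pi" if "x \<in> sphere 0 1" for x
  proof -
    have "\<bar>x $ 3\<bar> \<le> 1" using component_le_norm_cart[of x 3] that by simp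
    then show "x $ 3 = cos (theta x)" "0 \<le> theta x" "theta x \<le> pi"
      using that by (simp_all add: theta_def arccos_lbound arccos_ubound abs_le_iff)
  qed
  show ?thesis
  proof (intro exI[of _ \<eta>] conjI allI impI ballI)
    show "0 < \<eta>" "\<eta> \<le> 1" using c0 c1 by (simp_all add: \<eta>_def)
    fix \<theta>\<^sub>0 x assume t0: "0 < \<theta>\<^sub>0" "\<theta>\<^sub>0 < pi"
    { assume "x \<in> sphere_band \<epsilon> (\<theta>\<^sub>0 - \<epsilon>)"
      then have x: "x \<in> sphere 0 1" "\<epsilon> < theta x" "theta x < \<theta>\<^sub>0 - \<epsilon>" by (auto simp: sphere_band_def)
      have "cos \<theta>\<^sub>0 + \<eta> \<le> cos (theta x)" by (rule gap) (use x t0 assms in auto)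
      moreover have "cos (theta x) \<le> cos \<epsilon>" by (rule cos_monotone_0_pi_le) (use x t0 assms th in auto)
      moreover have "-1 + \<eta> \<le> cos (theta x)" using calculation(1) cos_ge_minus_one[of \<theta>\<^sub>0] by linarith
      ultimately show "cos \<theta>\<^sub>0 + \<eta> \<le> x $ 3" "x \<in> collar \<eta>"
        using x(1) th(1)[OF x(1)] by (auto simp: collar_def \<eta>_def) }
    { assume "x \<in> sphere_band (\<theta>\<^sub>0 + \<epsilon>) (pi - \<epsilon>)"
      then have x: "x \<in> sphere 0 1" "\<theta>\<^sub>0 + \<epsilon> < theta x" "theta x < pi - \<epsilon>" by (auto simp: sphere_band_def)
      have "cos (theta x) + \<eta> \<le> cos \<theta>\<^sub>0" by (rule gap) (use x t0 assms in auto)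
      moreover have "cos (pi - \<epsilon>) \<le> cos (theta x)" by (rule cos_monotone_0_pi_le) (use x t0 assms th in auto)
      moreover have "cos (theta x) \<le> 1 - \<eta>" using calculation(1) cos_le_one[of \<theta>\<^sub>0] by linarith
      ultimately show "x $ 3 \<le> cos \<theta>\<^sub>0 - \<eta>" "x \<in> collar \<eta>"
        using x(1) th(1)[OF x(1)] by (auto simp: collar_def \<eta>_def) }
  qed
qed

section \<open>The two families of solutions\<close>

lemma continuous_on_fst_subset: "continuous_on D fst" and continuous_on_snd_subset: "continuous_on D snd"
  by (intro continuous_intros)+

text \<open>
  Common to the two signs: the profile with constant weights, \<open>(1, 0)\<close> for \<open>v\<^sub>c\<^sup>+\<close> and \<open>(0, 1)\<close> for \<open>v\<^sub>c\<^sup>-\<close>.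
\<close>

lemma extremal_family:
  fixes l m s :: real
  assumes w: "weights l m" and s: "s * s = 1"
    and limit: "\<And>k K \<eta>. compact K \<Longrightarrow> K \<subseteq> interior (J 0) \<Longrightarrow> 0 < \<eta> \<Longrightarrow> \<eta> \<le> 1 \<Longrightarrow>
      \<exists>C\<ge>0. \<forall>c\<in>K. \<forall>\<nu>. 0 < \<nu> \<and> \<nu> \<le> 1 \<longrightarrow> euler_error k (collar \<eta>) s c \<nu> (profile l m c \<nu>) \<le> ennreal (C * \<nu>)"
  shows "\<exists>(u :: real^3 \<Rightarrow> real \<Rightarrow> real^3 \<Rightarrow> real^3) (p :: real^3 \<Rightarrow> real \<Rightarrow> real^3 \<Rightarrow> real).
          (\<forall>\<nu> c. 0 < \<nu> \<and> \<nu> \<le> 1 \<and> c \<in> interior (J \<nu>) \<longrightarrow>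
             homogeneous_axisym_no_swirl_solution \<nu> (u c \<nu>) (p c \<nu>)) \<and>
          (\<forall>m. \<forall>\<epsilon>>0.
             (\<lambda>(c, \<nu>) x. (u c \<nu> x, p c \<nu> x))
               \<in> C0_sphere_Cm {(c, \<nu>). 0 < \<nu> \<and> \<nu> \<le> 1 \<and> c \<in> interior (J \<nu>)}
                   m (sphere_minus_poles \<epsilon>)) \<and>
          (\<forall>m K. \<forall>\<epsilon>>0. compact K \<and> K \<subseteq> interior (J 0) \<longrightarrow>
             (\<exists>C::real. \<forall>c\<in>K. \<forall>\<nu>. 0 < \<nu> \<and> \<nu> \<le> 1 \<longrightarrow>
                sphere_norm m (sphere_minus_poles \<epsilon>)
                  (\<lambda>x. (u c \<nu> x - euler_v s c x, p c \<nu> x - euler_q c x)) \<le> ennreal (C * \<nu>)))"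
proof (intro exI[of _ "\<lambda>c \<nu>. velocity (profile l m c \<nu>)"] exI[of _ "\<lambda>c \<nu>. pressure c \<nu> (profile l m c \<nu>)"] conjI allI impI)
  fix \<nu> c assume "0 < \<nu> \<and> \<nu> \<le> 1 \<and> c \<in> interior (J \<nu>)"
  then have a: "admissible c \<nu>" using interior_J_admissible by blast
  show "homogeneous_axisym_no_swirl_solution \<nu> (velocity (profile l m c \<nu>)) (pressure c \<nu> (profile l m c \<nu>))"
    by (rule riccati_imp_solution[OF smooth_profile[OF a w] riccati_profile[OF a w]])
next
  fix k and \<epsilon> :: real assume \<epsilon>: "0 < \<epsilon>"
  let ?D = "{(c, \<nu>). 0 < \<nu> \<and> \<nu> \<le> 1 \<and> c \<in> interior (J \<nu>)}"
  have adm: "admissible (fst q) (snd q)" if "q \<in> ?D" for q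
    using interior_J_admissible that by auto
  have "jointly_smooth ?D (\<lambda>q. profile l m (fst q) (snd q))"
    by (rule jointly_smooth_profile[OF continuous_on_fst_subset continuous_on_snd_subset continuous_on_const continuous_on_const adm]) (use w in auto)
  from C0_sphere_Cm_field[OF continuous_on_snd_subset continuous_on_fst_subset this \<epsilon>, of k]
  show "(\<lambda>(c, \<nu>) x. (velocity (profile l m c \<nu>) x, pressure c \<nu> (profile l m c \<nu>) x)) \<in> C0_sphere_Cm ?D k (sphere_minus_poles \<epsilon>)"
    by (simp add: case_prod_unfold)
next
  fix k K and \<epsilon> :: real assume \<epsilon>: "0 < \<epsilon>" and K: "compact K \<and> K \<subseteq> interior (J 0)"
  \<comment> \<open>On the unit sphere \<open>|x - e\<^sub>3|\<^sup>2 = 2 - 2 x\<^sub>3\<close>.\<close>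
  define \<eta> where "\<eta> = min 1 (\<epsilon>\<^sup>2 / 2)"
  have \<eta>: "0 < \<eta>" "\<eta> \<le> 1" using \<epsilon> by (auto simp: \<eta>_def)
  have sub: "sphere_minus_poles \<epsilon> \<subseteq> collar \<eta>"
    using sphere_minus_poles_collar[OF \<epsilon>] by (auto simp: \<eta>_def collar_def min_def split: if_splits)
  obtain C where C: "C \<ge> 0" "\<forall>c\<in>K. \<forall>\<nu>. 0 < \<nu> \<and> \<nu> \<le> 1 \<longrightarrow> euler_error k (collar \<eta>) s c \<nu> (profile l m c \<nu>) \<le> ennreal (C * \<nu>)"
    using limit[OF K[THEN conjunct1] K[THEN conjunct2] \<eta>, of k] by (elim exE conjE) (rule that)
  have mono: "sphere_norm k (sphere_minus_poles \<epsilon>) f \<le> sphere_norm k (collar \<eta>) f" for f :: "real^3 \<Rightarrow> (real^3) \<times> real"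
    unfolding sphere_norm_def by (intro SUP_mono' SUP_subset_mono sub order_refl)
  show "\<exists>C. \<forall>c\<in>K. \<forall>\<nu>. 0 < \<nu> \<and> \<nu> \<le> 1 \<longrightarrow> euler_error k (sphere_minus_poles \<epsilon>) s c \<nu> (profile l m c \<nu>) \<le> ennreal (C * \<nu>)"
    by (intro exI[of _ C] ballI allI impI order_trans[OF mono]) (use C(2) in blast)
qed

lemma profile_plus_right_branch:
  assumes "K \<subseteq> interior (J 0)" "c \<in> K" "0 < \<nu>" "\<nu> \<le> 1"
  shows "right_branch K c \<nu> (profile 1 0 c \<nu>) (-1)"
proof -
  have c: "c \<in> interior (J 0)" using assms by auto
  have a: "admissible c \<nu>" by (rule interior_J0_admissible[OF assms(3) c])
  show ?thesis
    using assms smooth_profile[OF a weights_10] riccati_profile[OF a weights_10] profile_plus_pos[OF a interior_J0_positive[OF c]]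
    by (auto simp: right_branch_def intro: less_imp_le)
qed

lemma profile_minus_left_branch:
  assumes "K \<subseteq> interior (J 0)" "c \<in> K" "0 < \<nu>" "\<nu> \<le> 1"
  shows "left_branch K c \<nu> (profile 0 1 c \<nu>) 1"
proof -
  have c: "c \<in> interior (J 0)" using assms by auto
  have a: "admissible c \<nu>" by (rule interior_J0_admissible[OF assms(3) c])
  show ?thesis
    using assms smooth_profile[OF a weights_01] riccati_profile[OF a weights_01] profile_minus_neg[OF a interior_J0_positive[OF c]]
    by (auto simp: left_branch_def intro: less_imp_le)
qed

lemma layer_profile_branches:
  assumes "K \<subseteq> interior (J 0)" "c \<in> K" "0 < \<nu>" "\<nu> \<le> 1" and y: "y \<in> {-1<..<1}"
  shows "right_branch K c \<nu> (layer_profile c \<nu> y) y" "left_branch K c \<nu> (layer_profile c \<nu> y) y"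
proof -
  have c: "c \<in> interior (J 0)" using assms by auto
  have a: "admissible c \<nu>" by (rule interior_J0_admissible[OF assms(3) c])
  note w = layer_weights[OF a y]
  have "smooth (layer_profile c \<nu> y)" "riccati c \<nu> (layer_profile c \<nu> y)"
    unfolding layer_profile_def by (rule smooth_profile[OF a w], rule riccati_profile[OF a w])
  then show "right_branch K c \<nu> (layer_profile c \<nu> y) y" "left_branch K c \<nu> (layer_profile c \<nu> y) y"
    using assms layer_profile_sign[OF a interior_J0_positive[OF c] y]
    by (auto simp: right_branch_def left_branch_def)
qed

lemma interior_J0_subset: "K \<subseteq> interior (J 0) \<Longrightarrow> K \<subseteq> positive_params"
  using interior_J0_positive by blast

lemma profile_plus_limit:
  assumes K: "compact K" "K \<subseteq> interior (J 0)" and \<eta>: "0 < \<eta>" "\<eta> \<le> 1"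
  shows "\<exists>C\<ge>0. \<forall>c\<in>K. \<forall>\<nu>. 0 < \<nu> \<and> \<nu> \<le> 1 \<longrightarrow> euler_error k (collar \<eta>) 1 c \<nu> (profile 1 0 c \<nu>) \<le> ennreal (C * \<nu>)"
proof -
  obtain C where C: "C \<ge> 0" "\<forall>c\<in>K. \<forall>\<nu> b A x1. right_branch K c \<nu> b x1 \<longrightarrow> A \<subseteq> collar \<eta> \<longrightarrow> (\<forall>x\<in>A. x1 + \<eta> \<le> x $ 3) \<longrightarrow>
     euler_error k A 1 c \<nu> b \<le> ennreal (C * \<nu>)"
    using right_limit[OF K(1) interior_J0_subset[OF K(2)] \<eta>, of k] by (elim exE conjE) (rule that)
  show ?thesis
    by (intro exI[of _ C] conjI C(1) ballI allI impI, rule C(2)[rule_format, OF _ profile_plus_right_branch[OF K(2)]])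
       (auto simp: collar_def)
qed

lemma profile_minus_limit:
  assumes K: "compact K" "K \<subseteq> interior (J 0)" and \<eta>: "0 < \<eta>" "\<eta> \<le> 1"
  shows "\<exists>C\<ge>0. \<forall>c\<in>K. \<forall>\<nu>. 0 < \<nu> \<and> \<nu> \<le> 1 \<longrightarrow> euler_error k (collar \<eta>) (-1) c \<nu> (profile 0 1 c \<nu>) \<le> ennreal (C * \<nu>)"
proof -
  obtain C where C: "C \<ge> 0" "\<forall>c\<in>K. \<forall>\<nu> b A x2. left_branch K c \<nu> b x2 \<longrightarrow> A \<subseteq> collar \<eta> \<longrightarrow> (\<forall>x\<in>A. x $ 3 \<le> x2 - \<eta>) \<longrightarrow>
     euler_error k A (-1) c \<nu> b \<le> ennreal (C * \<nu>)"
    using left_limit[OF K(1) interior_J0_subset[OF K(2)] \<eta>, of k] by (elim exE conjE) (rule that)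
  show ?thesis
    by (intro exI[of _ C] conjI C(1) ballI allI impI, rule C(2)[rule_format, OF _ profile_minus_left_branch[OF K(2)]])
       (auto simp: collar_def)
qed

text \<open>
  The profile vanishes at \<open>cos \<theta>\<^sub>0\<close>. It is a right branch on the side \<open>\<theta> < \<theta>\<^sub>0\<close>, where \<open>cos \<theta>\<close> is larger, and a left
  branch on the other side.
\<close>

lemma layer_family:
  "\<exists>(u :: real^3 \<Rightarrow> real \<Rightarrow> real \<Rightarrow> real^3 \<Rightarrow> real^3) (p :: real^3 \<Rightarrow> real \<Rightarrow> real \<Rightarrow> real^3 \<Rightarrow> real).
        (\<forall>\<nu> c \<theta>\<^sub>0. 0 < \<nu> \<and> \<nu> \<le> 1 \<and> c \<in> interior (J \<nu>) \<and> 0 < \<theta>\<^sub>0 \<and> \<theta>\<^sub>0 < pi \<longrightarrow>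
           homogeneous_axisym_no_swirl_solution \<nu> (u c \<nu> \<theta>\<^sub>0) (p c \<nu> \<theta>\<^sub>0)) \<and>
        (\<forall>m. \<forall>\<epsilon>>0.
           (\<lambda>(c, \<nu>, \<theta>\<^sub>0) x. (u c \<nu> \<theta>\<^sub>0 x, p c \<nu> \<theta>\<^sub>0 x))
             \<in> C0_sphere_Cm
                 {(c, \<nu>, \<theta>\<^sub>0). 0 < \<nu> \<and> \<nu> \<le> 1 \<and> c \<in> interior (J \<nu>) \<and> 0 < \<theta>\<^sub>0 \<and> \<theta>\<^sub>0 < pi}
                 m (sphere_minus_poles \<epsilon>)) \<and>
        (\<forall>m K. \<forall>\<epsilon>>0. compact K \<and> K \<subseteq> interior (J 0) \<longrightarrow>
           (\<exists>C::real. \<forall>c\<in>K. \<forall>\<nu> \<theta>\<^sub>0. 0 < \<nu> \<and> \<nu> \<le> 1 \<and> 0 < \<theta>\<^sub>0 \<and> \<theta>\<^sub>0 < pi \<longrightarrow>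
              sphere_norm m (sphere_band \<epsilon> (\<theta>\<^sub>0 - \<epsilon>))
                (\<lambda>x. (u c \<nu> \<theta>\<^sub>0 x - euler_v 1 c x, p c \<nu> \<theta>\<^sub>0 x - euler_q c x)) +
              sphere_norm m (sphere_band (\<theta>\<^sub>0 + \<epsilon>) (pi - \<epsilon>))
                (\<lambda>x. (u c \<nu> \<theta>\<^sub>0 x - euler_v (- 1) c x, p c \<nu> \<theta>\<^sub>0 x - euler_q c x))
              \<le> ennreal (C * \<nu>)))"
proof (intro exI[of _ "\<lambda>c \<nu> \<theta>. velocity (layer_profile c \<nu> (cos \<theta>))"]
    exI[of _ "\<lambda>c \<nu> \<theta>. pressure c \<nu> (layer_profile c \<nu> (cos \<theta>))"] conjI allI impI)
  have cosI: "cos \<theta> \<in> {-1<..<1}" if "0 < \<theta>" "\<theta> < pi" for \<theta> :: real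
    using cos_monotone_0_pi[of 0 \<theta>] cos_monotone_0_pi[of \<theta> pi] that by simp
  {
    fix \<nu> c \<theta> assume a: "0 < \<nu> \<and> \<nu> \<le> 1 \<and> c \<in> interior (J \<nu>) \<and> 0 < \<theta> \<and> \<theta> < pi"
    then have adm: "admissible c \<nu>" using interior_J_admissible by blast
    have y: "cos \<theta> \<in> {-1<..<1}" using cosI a by blast
    show "homogeneous_axisym_no_swirl_solution \<nu> (velocity (layer_profile c \<nu> (cos \<theta>))) (pressure c \<nu> (layer_profile c \<nu> (cos \<theta>)))"
      unfolding layer_profile_def
      by (rule riccati_imp_solution[OF smooth_profile riccati_profile]; rule adm layer_weights[OF adm y])
  next
    fix k and \<epsilon> :: real assume \<epsilon>: "0 < \<epsilon>"
    let ?D = "{(c, \<nu>, \<theta>\<^sub>0). 0 < \<nu> \<and> \<nu> \<le> 1 \<and> c \<in> interior (J \<nu>) \<and> 0 < \<theta>\<^sub>0 \<and> \<theta>\<^sub>0 < pi}"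
    have adm: "admissible (fst q) (fst (snd q))" and yI: "cos (snd (snd q)) \<in> {-1<..<1}" if "q \<in> ?D" for q
      using interior_J_admissible cosI that by auto
    have cc: "continuous_on ?D fst" and cn: "continuous_on ?D (\<lambda>q. fst (snd q))" and cy: "continuous_on ?D (\<lambda>q. cos (snd (snd q)))"
      by (intro continuous_intros)+
    have "jointly_smooth ?D (\<lambda>q. layer_profile (fst q) (fst (snd q)) (cos (snd (snd q))))"
      by (rule jointly_smooth_layer_profile[OF cc cn cy adm yI])
    from C0_sphere_Cm_field[OF cn cc this \<epsilon>, of k]
    show "(\<lambda>(c, \<nu>, \<theta>\<^sub>0) x. (velocity (layer_profile c \<nu> (cos \<theta>\<^sub>0)) x, pressure c \<nu> (layer_profile c \<nu> (cos \<theta>\<^sub>0)) x))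
       \<in> C0_sphere_Cm ?D k (sphere_minus_poles \<epsilon>)"
      by (simp add: case_prod_unfold)
  next
    fix k K and \<epsilon> :: real assume \<epsilon>: "0 < \<epsilon>" and K: "compact K \<and> K \<subseteq> interior (J 0)"
    obtain \<eta> where \<eta>: "0 < \<eta>" "\<eta> \<le> 1" and bands: "\<forall>\<theta>\<^sub>0. 0 < \<theta>\<^sub>0 \<longrightarrow> \<theta>\<^sub>0 < pi \<longrightarrow>
     (\<forall>x\<in>sphere_band \<epsilon> (\<theta>\<^sub>0 - \<epsilon>). x \<in> collar \<eta> \<and> cos \<theta>\<^sub>0 + \<eta> \<le> x $ 3) \<and>
     (\<forall>x\<in>sphere_band (\<theta>\<^sub>0 + \<epsilon>) (pi - \<epsilon>). x \<in> collar \<eta> \<and> x $ 3 \<le> cos \<theta>\<^sub>0 - \<eta>)"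
      using sphere_bands_collar[OF \<epsilon>] by (elim exE conjE) (rule that)
    note KK = K[THEN conjunct1] interior_J0_subset[OF K[THEN conjunct2]]
    obtain C1 where C1: "C1 \<ge> 0" "\<forall>c\<in>K. \<forall>\<nu> b A x1. right_branch K c \<nu> b x1 \<longrightarrow> A \<subseteq> collar \<eta> \<longrightarrow> (\<forall>x\<in>A. x1 + \<eta> \<le> x $ 3) \<longrightarrow>
     euler_error k A 1 c \<nu> b \<le> ennreal (C1 * \<nu>)"
      using right_limit[OF KK \<eta>, of k] by (elim exE conjE) (rule that)
    obtain C2 where C2: "C2 \<ge> 0" "\<forall>c\<in>K. \<forall>\<nu> b A x2. left_branch K c \<nu> b x2 \<longrightarrow> A \<subseteq> collar \<eta> \<longrightarrow> (\<forall>x\<in>A. x $ 3 \<le> x2 - \<eta>) \<longrightarrow>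
     euler_error k A (-1) c \<nu> b \<le> ennreal (C2 * \<nu>)"
      using left_limit[OF KK \<eta>, of k] by (elim exE conjE) (rule that)
    show "\<exists>C::real. \<forall>c\<in>K. \<forall>\<nu> \<theta>\<^sub>0. 0 < \<nu> \<and> \<nu> \<le> 1 \<and> 0 < \<theta>\<^sub>0 \<and> \<theta>\<^sub>0 < pi \<longrightarrow>
              euler_error k (sphere_band \<epsilon> (\<theta>\<^sub>0 - \<epsilon>)) 1 c \<nu> (layer_profile c \<nu> (cos \<theta>\<^sub>0)) +
              euler_error k (sphere_band (\<theta>\<^sub>0 + \<epsilon>) (pi - \<epsilon>)) (- 1) c \<nu> (layer_profile c \<nu> (cos \<theta>\<^sub>0))
              \<le> ennreal (C * \<nu>)"
    proof (rule exI[of _ "C1 + C2"], intro ballI allI impI)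
      fix c and \<nu> \<theta> :: real assume c: "c \<in> K" and a: "0 < \<nu> \<and> \<nu> \<le> 1 \<and> 0 < \<theta> \<and> \<theta> < pi"
      have y: "cos \<theta> \<in> {-1<..<1}" using cosI a by blast
      have nu: "0 < \<nu>" "\<nu> \<le> 1" using a by auto
      note br = layer_profile_branches[OF K[THEN conjunct2] c nu y]
      let ?b = "layer_profile c \<nu> (cos \<theta>)"
      have 1: "euler_error k (sphere_band \<epsilon> (\<theta> - \<epsilon>)) 1 c \<nu> ?b \<le> ennreal (C1 * \<nu>)"
        by (rule C1(2)[rule_format, OF c br(1)]) (use bands a in auto)
      have 2: "euler_error k (sphere_band (\<theta> + \<epsilon>) (pi - \<epsilon>)) (-1) c \<nu> ?b \<le> ennreal (C2 * \<nu>)"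
        by (rule C2(2)[rule_format, OF c br(2)]) (use bands a in auto)
      have "ennreal ((C1 + C2) * \<nu>) = ennreal (C1 * \<nu>) + ennreal (C2 * \<nu>)"
        unfolding distrib_right using C1(1) C2(1) nu by (intro ennreal_plus) auto
      then show "euler_error k (sphere_band \<epsilon> (\<theta> - \<epsilon>)) 1 c \<nu> ?b +
          euler_error k (sphere_band (\<theta> + \<epsilon>) (pi - \<epsilon>)) (-1) c \<nu> ?b
          \<le> ennreal ((C1 + C2) * \<nu>)"
        using add_mono[OF 1 2] by simp
    qed
  }
qed

theorem theorem1p3:
  shows
    "(\<forall>s\<in>{1, - 1 :: real}.
        \<exists>(u :: real^3 \<Rightarrow> real \<Rightarrow> real^3 \<Rightarrow> real^3) (p :: real^3 \<Rightarrow> real \<Rightarrow> real^3 \<Rightarrow> real).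
          (\<forall>\<nu> c. 0 < \<nu> \<and> \<nu> \<le> 1 \<and> c \<in> interior (J \<nu>) \<longrightarrow>
             homogeneous_axisym_no_swirl_solution \<nu> (u c \<nu>) (p c \<nu>)) \<and>
          (\<forall>m. \<forall>\<epsilon>>0.
             (\<lambda>(c, \<nu>) x. (u c \<nu> x, p c \<nu> x))
               \<in> C0_sphere_Cm {(c, \<nu>). 0 < \<nu> \<and> \<nu> \<le> 1 \<and> c \<in> interior (J \<nu>)}
                   m (sphere_minus_poles \<epsilon>)) \<and>
          (\<forall>m K. \<forall>\<epsilon>>0. compact K \<and> K \<subseteq> interior (J 0) \<longrightarrow>
             (\<exists>C::real. \<forall>c\<in>K. \<forall>\<nu>. 0 < \<nu> \<and> \<nu> \<le> 1 \<longrightarrow>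
                sphere_norm m (sphere_minus_poles \<epsilon>)
                  (\<lambda>x. (u c \<nu> x - euler_v s c x, p c \<nu> x - euler_q c x)) \<le> ennreal (C * \<nu>))))
     \<and>
     (\<exists>(u :: real^3 \<Rightarrow> real \<Rightarrow> real \<Rightarrow> real^3 \<Rightarrow> real^3) (p :: real^3 \<Rightarrow> real \<Rightarrow> real \<Rightarrow> real^3 \<Rightarrow> real).
        (\<forall>\<nu> c \<theta>\<^sub>0. 0 < \<nu> \<and> \<nu> \<le> 1 \<and> c \<in> interior (J \<nu>) \<and> 0 < \<theta>\<^sub>0 \<and> \<theta>\<^sub>0 < pi \<longrightarrow>
           homogeneous_axisym_no_swirl_solution \<nu> (u c \<nu> \<theta>\<^sub>0) (p c \<nu> \<theta>\<^sub>0)) \<and>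
        (\<forall>m. \<forall>\<epsilon>>0.
           (\<lambda>(c, \<nu>, \<theta>\<^sub>0) x. (u c \<nu> \<theta>\<^sub>0 x, p c \<nu> \<theta>\<^sub>0 x))
             \<in> C0_sphere_Cm
                 {(c, \<nu>, \<theta>\<^sub>0). 0 < \<nu> \<and> \<nu> \<le> 1 \<and> c \<in> interior (J \<nu>) \<and> 0 < \<theta>\<^sub>0 \<and> \<theta>\<^sub>0 < pi}
                 m (sphere_minus_poles \<epsilon>)) \<and>
        (\<forall>m K. \<forall>\<epsilon>>0. compact K \<and> K \<subseteq> interior (J 0) \<longrightarrow>
           (\<exists>C::real. \<forall>c\<in>K. \<forall>\<nu> \<theta>\<^sub>0. 0 < \<nu> \<and> \<nu> \<le> 1 \<and> 0 < \<theta>\<^sub>0 \<and> \<theta>\<^sub>0 < pi \<longrightarrow>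
              sphere_norm m (sphere_band \<epsilon> (\<theta>\<^sub>0 - \<epsilon>))
                (\<lambda>x. (u c \<nu> \<theta>\<^sub>0 x - euler_v 1 c x, p c \<nu> \<theta>\<^sub>0 x - euler_q c x)) +
              sphere_norm m (sphere_band (\<theta>\<^sub>0 + \<epsilon>) (pi - \<epsilon>))
                (\<lambda>x. (u c \<nu> \<theta>\<^sub>0 x - euler_v (- 1) c x, p c \<nu> \<theta>\<^sub>0 x - euler_q c x))
              \<le> ennreal (C * \<nu>))))"
proof (intro conjI ballI)
  fix s :: real assume "s \<in> {1, - 1}"
  then consider "s = 1" | "s = - 1" by blast
  then show "\<exists>(u :: real^3 \<Rightarrow> real \<Rightarrow> real^3 \<Rightarrow> real^3) (p :: real^3 \<Rightarrow> real \<Rightarrow> real^3 \<Rightarrow> real).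
          (\<forall>\<nu> c. 0 < \<nu> \<and> \<nu> \<le> 1 \<and> c \<in> interior (J \<nu>) \<longrightarrow>
             homogeneous_axisym_no_swirl_solution \<nu> (u c \<nu>) (p c \<nu>)) \<and>
          (\<forall>m. \<forall>\<epsilon>>0.
             (\<lambda>(c, \<nu>) x. (u c \<nu> x, p c \<nu> x))
               \<in> C0_sphere_Cm {(c, \<nu>). 0 < \<nu> \<and> \<nu> \<le> 1 \<and> c \<in> interior (J \<nu>)}
                   m (sphere_minus_poles \<epsilon>)) \<and>
          (\<forall>m K. \<forall>\<epsilon>>0. compact K \<and> K \<subseteq> interior (J 0) \<longrightarrow>
             (\<exists>C::real. \<forall>c\<in>K. \<forall>\<nu>. 0 < \<nu> \<and> \<nu> \<le> 1 \<longrightarrow>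
                sphere_norm m (sphere_minus_poles \<epsilon>)
                  (\<lambda>x. (u c \<nu> x - euler_v s c x, p c \<nu> x - euler_q c x)) \<le> ennreal (C * \<nu>)))"
  proof cases
    case 1
    show ?thesis unfolding 1 by (rule extremal_family[OF weights_10 _ profile_plus_limit]) simp
  next
    case 2
    show ?thesis unfolding 2 by (rule extremal_family[OF weights_01 _ profile_minus_limit]) simp
  qed
qed (rule layer_family)

end
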